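(* Let $(\boldsymbol u,\boldsymbol B,P,T)$ be a smooth solution of the Taylor model (see context), and suppose that the magnetic flux is exact. Suppose that at some instant of time the magnetic field is nontrivial and dynamo action occurs, i.e. $\frac{\mathrm d}{\mathrm dt}\left(\frac12\int_V|\boldsymbol B|^2\,\mathrm dV\right)\ge 0$. Then at that instant the Archimedean part $\boldsymbol u^{\mathrm A}$ of the velocity satisfies $$ A_2\,\|\nabla_{x,y}\boldsymbol u^{\mathrm A}\|_{L^\infty_zL^2_{x,y}}\ \ge\ \frac1{Rm}. $$
   Context: Domain: $V=[0,L_x]\times[0,L_y]\times[0,1]$ with $L_x,L_y>0$; all fields are periodic in $x$ and $y$. $S_-=\{z=0\}$, $S_+=\{z=1\}$, $\boldsymbol n_\pm=\pm\boldsymbol e_z$. Taylor model (inviscid, inertialess), with positive parameters $\Lambda, Ra, Rm$: unknown velocity $\boldsymbol u$, magnetic field $\boldsymbol B$, pressure $P$, temperature $T$, satisfying $$\boldsymbol e_z\times\boldsymbol u+\nabla P=\Lambda(\nabla\times\boldsymbol B)\times\boldsymbol B+Ra\,T\boldsymbol e_z,\quad \nabla\cdot\boldsymbol u=0,\quad \partial_t\boldsymbol B-\nabla\times(\boldsymbol u\times\boldsymbol B)=\tfrac1{Rm}\nabla^2\boldsymbol B,\quad \nabla\cdot\boldsymbol B=0,$$ with boundary conditions $\boldsymbol u\cdot\boldsymbol n_\pm=0$ and $\boldsymbol B\times\boldsymbol n_\pm=0$ (ferromagnetic) on $S_\pm$. No evolution equation for $T$ is assumed; $T$ is a smooth function,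 periodic in $x,y$. Magnetic flux is exact if $\int_{S_\pm}\boldsymbol n_\pm\cdot\boldsymbol B\,\mathrm dS_\pm=0$. Archimedean part: $\boldsymbol u^{\mathrm A}$ is the divergence-free field, tangent to $\partial V$ and vanishing at $z=0$, that solves $\frac1{Ra}(\boldsymbol e_z\times\boldsymbol u^{\mathrm A}+\nabla P^{\mathrm A})=T\boldsymbol e_z$ for some pressure $P^{\mathrm A}$; explicitly $\boldsymbol u^{\mathrm A}=Ra\,\boldsymbol e_z\times\nabla\overline T=Ra\,(-\partial_y\overline T,\partial_x\overline T,0)$ with $\overline T(x,y,z)=\int_0^zT(x,y,z')\,\mathrm dz'$. $\nabla_{x,y}=(\partial_x,\partial_y)$; $\|f\|_{L^\infty_zL^2_{x,y}}=\sup_{z\in[0,1]}\left(\int|f(x,y,z)|^2\,\mathrm dx\,\mathrm dy\right)^{1/2}$ (Euclidean norm for tensor-valued $f$). Constants: $\lambda_1=\min\{\pi,2\pi/L_x,2\pi/L_y\}$, $C_{\mathrm P}=1/\lambda_1$, $C_{\mathrm L}=\left(\frac{3\pi}{32}\max\{\frac{L_x}{L_y},\frac{L_y}{L_x}\}\right)^{1/4}$ (the constant in the two-dimensional Ladyzhenskaya inequality $\|g\|_{L^4_{x,y}}\le C_{\mathrm L}\|g\|_{L^2_{x,y}}^{1/2}\|\nabla_{x,y}g\|_{L^2_{x,y}}^{1/2}$ for periodic mean-zero $g$), $C_1=C_{\mathrm L}^2C_{\mathrm P}$, $C_2=\left(\frac1{6\pi}+\frac{C_{\mathrm P}}2\right)\frac1{L_xL_yC_{\mathrm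 L}^2}$, $A_2=C_1\max\{3,C_2\}$. *)

theory Defs
  imports "HOL-Analysis.Analysis"
begin

text \<open>
  Points of space are vectors in \<open>real^3\<close> with \<open>(x, y, z) = (r$1, r$2, r$3)\<close>.  A field that is
  periodic in \<open>x\<close> and \<open>y\<close> is represented by a total function on \<open>real^3\<close> of which only the values
  on the slab \<open>0 \<le> z \<le> 1\<close> matter; \<open>cell Lx Ly\<close> is the periodicity cell \<open>V\<close>.
\<close>

definition slab :: "(real^3) set" where
  "slab = {r. 0 \<le> r$3 \<and> r$3 \<le> 1}"

definition cell :: "real \<Rightarrow> real \<Rightarrow> (real^3) set" where
  "cell Lx Ly = {r. 0 \<le> r$1 \<and> r$1 \<le> Lx \<and> 0 \<le> r$2 \<and> r$2 \<le> Ly \<and> 0 \<le> r$3 \<and> r$3 \<le> 1}"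

abbreviation e_z :: "real^3" where
  "e_z \<equiv> axis 3 1"

definition periodic_xy :: "real \<Rightarrow> real \<Rightarrow> (real^3 \<Rightarrow> 'b) \<Rightarrow> bool" where
  "periodic_xy Lx Ly f \<longleftrightarrow>
     (\<forall>r\<in>slab. f (r + axis 1 Lx) = f r \<and> f (r + axis 2 Ly) = f r)"

primrec Ck_on ::
  "('a::real_normed_vector) set \<Rightarrow> ('a \<Rightarrow> 'b::real_normed_vector) \<Rightarrow> nat \<Rightarrow> bool" where
  "Ck_on U f 0 \<longleftrightarrow> continuous_on U f"
| "Ck_on U f (Suc k) \<longleftrightarrow>
     (\<forall>p\<in>U. f differentiable at p) \<and> (\<forall>v. Ck_on U (\<lambda>p. frechet_derivative f (at p) v) k)"

text \<open>
  Smoothness up to the boundary of a time-dependent field on \<open>J \<times> slab\<close>: the field is the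
  restriction of a \<open>C\<^sup>\<infinity>\<close> function on an open neighbourhood of \<open>J \<times> slab\<close> in space-time.
\<close>

definition smooth_field ::
  "real set \<Rightarrow> (real \<Rightarrow> real^3 \<Rightarrow> 'b::real_normed_vector) \<Rightarrow> bool" where
  "smooth_field J f \<longleftrightarrow>
     (\<exists>U (g :: real \<times> (real^3) \<Rightarrow> 'b). open U \<and> J \<times> slab \<subseteq> U \<and> (\<forall>k. Ck_on U g k) \<and>
        (\<forall>t\<in>J. \<forall>r\<in>slab. f t r = g (t, r)))"

text \<open>
  The derivative is taken along a coordinate line, so that horizontal derivatives at points of
  \<open>z = 0\<close> and \<open>z = 1\<close> depend only on values in the slab.
\<close>

definition pd :: "3 \<Rightarrow> (real^3 \<Rightarrow> 'b::real_normed_vector) \<Rightarrow> real^3 \<Rightarrow> 'b" where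
  "pd i f r = vector_derivative (\<lambda>s. f (r + axis i s)) (at 0)"

definition grad :: "(real^3 \<Rightarrow> real) \<Rightarrow> real^3 \<Rightarrow> real^3" where
  "grad f r = (\<chi> i. pd i f r)"

definition divergence :: "(real^3 \<Rightarrow> real^3) \<Rightarrow> real^3 \<Rightarrow> real" where
  "divergence F r = (\<Sum>i\<in>UNIV. pd i F r $ i)"

definition curl :: "(real^3 \<Rightarrow> real^3) \<Rightarrow> real^3 \<Rightarrow> real^3" where
  "curl F r = vector [pd 2 F r $ 3 - pd 3 F r $ 2,
                      pd 3 F r $ 1 - pd 1 F r $ 3,
                      pd 1 F r $ 2 - pd 2 F r $ 1]"

definition laplacian :: "(real^3 \<Rightarrow> 'b::real_normed_vector) \<Rightarrow> real^3 \<Rightarrow> 'b" where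
  "laplacian f r = (\<Sum>i\<in>UNIV. pd i (pd i f) r)"

text \<open>
  The equations are imposed in the open slab \<open>0 < z < 1\<close>; for fields that are smooth up to the
  boundary this is the same as imposing them on the closed slab.
\<close>

definition taylor_solution ::
  "real \<Rightarrow> real \<Rightarrow> real \<Rightarrow> real \<Rightarrow> real \<Rightarrow> real set \<Rightarrow>
   (real \<Rightarrow> real^3 \<Rightarrow> real^3) \<Rightarrow> (real \<Rightarrow> real^3 \<Rightarrow> real^3) \<Rightarrow>
   (real \<Rightarrow> real^3 \<Rightarrow> real) \<Rightarrow> (real \<Rightarrow> real^3 \<Rightarrow> real) \<Rightarrow> bool" where
  "taylor_solution Lx Ly \<Lambda> Ra Rm J u B P T \<longleftrightarrow>
     smooth_field J u \<and> smooth_field J B \<and> smooth_field J P \<and> smooth_field J T \<and>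
     (\<forall>t\<in>J. periodic_xy Lx Ly (u t) \<and> periodic_xy Lx Ly (B t) \<and>
             periodic_xy Lx Ly (P t) \<and> periodic_xy Lx Ly (T t)) \<and>
     (\<forall>t\<in>J. \<forall>r. 0 < r$3 \<and> r$3 < 1 \<longrightarrow>
        cross3 e_z (u t r) + grad (P t) r =
          \<Lambda> *\<^sub>R cross3 (curl (B t) r) (B t r) + (Ra * T t r) *\<^sub>R e_z \<and>
        divergence (u t) r = 0 \<and>
        vector_derivative (\<lambda>s. B s r) (at t within J) - curl (\<lambda>q. cross3 (u t q) (B t q)) r =
          (1 / Rm) *\<^sub>R laplacian (B t) r \<and>
        divergence (B t) r = 0) \<and>
     (\<forall>t\<in>J. \<forall>r. r$3 = 1 \<longrightarrow> u t r \<bullet> e_z = 0 \<and> cross3 (B t r) e_z = 0) \<and>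
     (\<forall>t\<in>J. \<forall>r. r$3 = 0 \<longrightarrow> u t r \<bullet> (- e_z) = 0 \<and> cross3 (B t r) (- e_z) = 0)"

definition integral_xy :: "real \<Rightarrow> real \<Rightarrow> real \<Rightarrow> (real^3 \<Rightarrow> real) \<Rightarrow> real" where
  "integral_xy Lx Ly z f =
     integral ({0..Lx} \<times> {0..Ly}) (\<lambda>(x, y). f (vector [x, y, z]))"

definition exact_flux :: "real \<Rightarrow> real \<Rightarrow> (real^3 \<Rightarrow> real^3) \<Rightarrow> bool" where
  "exact_flux Lx Ly b \<longleftrightarrow>
     integral_xy Lx Ly 1 (\<lambda>r. e_z \<bullet> b r) = 0 \<and>
     integral_xy Lx Ly 0 (\<lambda>r. (- e_z) \<bullet> b r) = 0"

definition magnetic_energy :: "real \<Rightarrow> real \<Rightarrow> (real^3 \<Rightarrow> real^3) \<Rightarrow> real" where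
  "magnetic_energy Lx Ly b = 1 / 2 * integral (cell Lx Ly) (\<lambda>r. (norm (b r))\<^sup>2)"

definition T_bar :: "(real^3 \<Rightarrow> real) \<Rightarrow> real^3 \<Rightarrow> real" where
  "T_bar \<theta> r = integral {0..r$3} (\<lambda>s. \<theta> (vector [r$1, r$2, s]))"

definition archimedean :: "real \<Rightarrow> (real^3 \<Rightarrow> real) \<Rightarrow> real^3 \<Rightarrow> real^3" where
  "archimedean Ra \<theta> r = Ra *\<^sub>R vector [- pd 2 (T_bar \<theta>) r, pd 1 (T_bar \<theta>) r, 0]"

text \<open>
  The norm on the product type is the Euclidean one, so the norm of this pair is the Euclidean
  norm of the \<open>2 \<times> 3\<close> tensor of horizontal derivatives.
\<close>

definition grad_xy :: "(real^3 \<Rightarrow> real^3) \<Rightarrow> real^3 \<Rightarrow> (real^3) \<times> (real^3)" where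
  "grad_xy F r = (pd 1 F r, pd 2 F r)"

definition norm_Linf_L2 ::
  "real \<Rightarrow> real \<Rightarrow> (real^3 \<Rightarrow> 'b::real_normed_vector) \<Rightarrow> real" where
  "norm_Linf_L2 Lx Ly f = (SUP z\<in>{0..1}. sqrt (integral_xy Lx Ly z (\<lambda>r. (norm (f r))\<^sup>2)))"

definition lambda1 :: "real \<Rightarrow> real \<Rightarrow> real" where
  "lambda1 Lx Ly = Min {pi, 2 * pi / Lx, 2 * pi / Ly}"

definition C_P :: "real \<Rightarrow> real \<Rightarrow> real" where
  "C_P Lx Ly = 1 / lambda1 Lx Ly"

definition C_L :: "real \<Rightarrow> real \<Rightarrow> real" where
  "C_L Lx Ly = (3 * pi / 32 * max (Lx / Ly) (Ly / Lx)) powr (1 / 4)"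

definition C1 :: "real \<Rightarrow> real \<Rightarrow> real" where
  "C1 Lx Ly = (C_L Lx Ly)\<^sup>2 * C_P Lx Ly"

definition C2 :: "real \<Rightarrow> real \<Rightarrow> real" where
  "C2 Lx Ly = (1 / (6 * pi) + C_P Lx Ly / 2) * (1 / (Lx * Ly * (C_L Lx Ly)\<^sup>2))"

definition A2 :: "real \<Rightarrow> real \<Rightarrow> real" where
  "A2 Lx Ly = C1 Lx Ly * max 3 (C2 Lx Ly)"

end

theory Submission
  imports Defs
begin

text \<open>
  The energy balance reads \<open>dE/dt = - \<integral> u\<^sub>A \<bullet> (B \<bullet> \<nabla>) B - (1/Rm) \<integral> |\<nabla>B|\<^sup>2\<close>: taking the scalar product of the momentum
  equation first with \<open>u\<close> and then with \<open>u\<^sub>A\<close> trades the Lorentz work of \<open>u\<close> for that of \<open>u\<^sub>A\<close>, up to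
  divergences of periodic fields whose vertical component vanishes at the walls.  It remains to bound the
  first term by \<open>A\<^sub>2 N \<integral> |\<nabla>B|\<^sup>2\<close>, with \<open>N\<close> the norm of the horizontal gradient of \<open>u\<^sub>A\<close>.  Split
  \<open>B = b + B\<^sub>m z\<close> into a part of zero horizontal mean and the horizontal mean.  For the first part use
  \<open>L\<^sup>4\<close> norms of \<open>u\<^sub>A\<close> and \<open>b\<close> on each slice \<open>z = const\<close>; the second one vanishes at both walls, by the boundary
  conditions and the exactness of the flux, so that a one-dimensional Poincare inequality applies.

  Sharp constants are not needed.  Poincare inequalities with \<open>L\<^sup>2/24\<close> (periodic, zero mean) and
  \<open>L\<^sup>2/6\<close> (Dirichlet) and the elementary Ladyzhenskaya argument leave a total constant below \<open>3 C\<^sub>1 \<le> A\<^sub>2\<close>.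
\<close>

section \<open>Integral inequalities on an interval\<close>

text \<open>The trade rests on the vertical primitive \<open>Tb\<close> of the temperature. Its
  vertical derivative is T, and uA . (e_z x u) = Ra (u . grad_h Tb) by the form of
  \<open>uA\<close>. Hence Ra T u_z + uA . (e_z x u) = Ra (u . grad Tb), which is a divergence
  because div u = 0. The product with u expresses the Lorentz work through the buoyancy work, the
  Coriolis term dropping out; the product with \<open>uA\<close> expresses the Coriolis term through
  the Lorentz work of \<open>uA\<close>; the identity for \<open>Tb\<close> links the two. Only
  horizontal derivatives of \<open>uA\<close> are controlled, and only as a supremum over z. All
  estimates of \<open>uA\<close> therefore take place on two-dimensional slices, where one gradient
  in L^2 suffices for L^4. The horizontal mean of B escapes every slice inequality, hence the
  splitting. The walls are the technical obstacle: \<open>pd\<close> is two-sided and would see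
  values outside the slab. Derivatives are therefore carried as named fields that are continuous up
  to the walls, and are identified with \<open>pd\<close> only where this is legitimate.\<close>

lemma integral_mult_le_sqrt:
  fixes f g :: "'a::euclidean_space \<Rightarrow> real"
  assumes f: "continuous_on (cbox a b) f" and g: "continuous_on (cbox a b) g"
  shows "integral (cbox a b) (\<lambda>x. f x * g x)
    \<le> sqrt (integral (cbox a b) (\<lambda>x. (f x)\<^sup>2)) * sqrt (integral (cbox a b) (\<lambda>x. (g x)\<^sup>2))"
proof -
  define A where "A = integral (cbox a b) (\<lambda>x. (f x)\<^sup>2)"
  define C where "C = integral (cbox a b) (\<lambda>x. (g x)\<^sup>2)"
  define X where "X = integral (cbox a b) (\<lambda>x. f x * g x)"
  have int: "(\<lambda>x. (f x)\<^sup>2) integrable_on cbox a b" "(\<lambda>x. (g x)\<^sup>2) integrable_on cbox a b"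
    "(\<lambda>x. f x * g x) integrable_on cbox a b"
    by (intro integrable_continuous continuous_intros f g)+
  have A0: "A \<ge> 0" and C0: "C \<ge> 0"
    unfolding A_def C_def by (auto intro!: integral_nonneg int)
  have key: "2 * s * t * X \<le> s\<^sup>2 * A + t\<^sup>2 * C" for s t
  proof -
    have "integral (cbox a b) (\<lambda>x. 2 * s * t * (f x * g x))
        \<le> integral (cbox a b) (\<lambda>x. s\<^sup>2 * (f x)\<^sup>2 + t\<^sup>2 * (g x)\<^sup>2)"
    proof (rule integral_le)
      show "(\<lambda>x. 2 * s * t * (f x * g x)) integrable_on cbox a b"
        by (intro integrable_continuous continuous_intros f g)
      show "(\<lambda>x. s\<^sup>2 * (f x)\<^sup>2 + t\<^sup>2 * (g x)\<^sup>2) integrable_on cbox a b"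
        by (intro integrable_continuous continuous_intros f g)
      show "2 * s * t * (f x * g x) \<le> s\<^sup>2 * (f x)\<^sup>2 + t\<^sup>2 * (g x)\<^sup>2" for x
        using sum_squares_bound[of "s * f x" "t * g x"] by (simp add: power_mult_distrib mult_ac)
    qed
    moreover have "integral (cbox a b) (\<lambda>x. s\<^sup>2 * (f x)\<^sup>2 + t\<^sup>2 * (g x)\<^sup>2) = s\<^sup>2 * A + t\<^sup>2 * C"
      unfolding A_def C_def
      by (subst integral_add) (auto intro!: integrable_continuous continuous_intros f g)
    ultimately show ?thesis by (simp add: X_def)
  qed
  \<comment> \<open>If A and C are positive, s = sqrt C and t = sqrt A in \<open>key\<close> give
    the claim. If one of them vanishes, a large value of its own parameter forces X \<le> 0; the
    witnesses below are chosen to contradict X > 0.\<close>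
  have "X \<le> sqrt A * sqrt C"
  proof (cases "A = 0 \<or> C = 0")
    case False
    then have p: "sqrt A * sqrt C > 0" using A0 C0 by simp
    have "(2 * (sqrt A * sqrt C)) * X \<le> (2 * (sqrt A * sqrt C)) * (sqrt A * sqrt C)"
      using key[of "sqrt C" "sqrt A"] A0 C0 by (simp add: algebra_simps real_sqrt_mult_self)
    with p show ?thesis by (simp add: mult_le_cancel_left)
  next
    case True
    show ?thesis
    proof (rule ccontr)
      assume "\<not> ?thesis"
      with True have X: "X > 0" by auto
      from True show False
      proof
        assume "A = 0"
        with key[of "(C + 1) / (2 * X)" 1] X show False by simp
      next
        assume "C = 0"
        with key[of 1 "(A + 1) / (2 * X)"] X show False by simp
      qed
    qed
  qed
  then show ?thesis by (simp add: A_def C_def X_def)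
qed

lemma integral_square_le:
  fixes f :: "real \<Rightarrow> real"
  assumes "continuous_on {a..b} f" "a \<le> b"
  shows "(integral {a..b} f)\<^sup>2 \<le> (b - a) * integral {a..b} (\<lambda>x. (f x)\<^sup>2)"
proof -
  have c: "continuous_on (cbox a b) f" "continuous_on (cbox a b) (\<lambda>x. norm (f x))"
    using assms by (auto intro: continuous_intros)
  have "\<bar>integral {a..b} f\<bar> \<le> integral {a..b} (\<lambda>x. norm (f x))"
    using integral_norm_bound_integral[of f "cbox a b" "\<lambda>x. norm (f x)"] c
    by (simp add: integrable_continuous_interval)
  also have "\<dots> \<le> sqrt (b - a) * sqrt (integral {a..b} (\<lambda>x. (f x)\<^sup>2))"
    using integral_mult_le_sqrt[of a b "\<lambda>_. 1" "\<lambda>x. norm (f x)"] c assms by simp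
  finally have "\<bar>integral {a..b} f\<bar>\<^sup>2 \<le> (sqrt (b - a) * sqrt (integral {a..b} (\<lambda>x. (f x)\<^sup>2)))\<^sup>2"
    by (rule power_mono) simp
  moreover have "integral {a..b} (\<lambda>x. (f x)\<^sup>2) \<ge> 0"
    by (intro integral_nonneg integrable_continuous_interval continuous_intros assms) auto
  ultimately show ?thesis
    using assms(2) by (simp add: power_mult_distrib)
qed

lemma norm_increment_square_le:
  fixes f f' :: "real \<Rightarrow> 'a::euclidean_space"
  assumes ab: "a \<le> b"
    and f: "\<And>x. x \<in> {a..b} \<Longrightarrow> (f has_vector_derivative f' x) (at x within {a..b})"
    and c: "continuous_on {a..b} f'"
  shows "(norm (f b - f a))\<^sup>2 \<le> (b - a) * integral {a..b} (\<lambda>x. (norm (f' x))\<^sup>2)"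
proof -
  have "(f' has_integral f b - f a) {a..b}"
    by (rule fundamental_theorem_of_calculus[OF ab f])
  then have "norm (f b - f a) = norm (integral {a..b} f')" by (simp add: integral_unique)
  also have "\<dots> \<le> integral {a..b} (\<lambda>x. norm (f' x))"
    by (rule integral_norm_bound_integral) (auto intro!: integrable_continuous_interval continuous_intros c)
  finally have "(norm (f b - f a))\<^sup>2 \<le> (integral {a..b} (\<lambda>x. norm (f' x)))\<^sup>2"
    by (rule power_mono) simp
  also have "\<dots> \<le> (b - a) * integral {a..b} (\<lambda>x. (norm (f' x))\<^sup>2)"
    by (rule integral_square_le) (auto intro!: continuous_intros c ab)
  finally show ?thesis .
qed

text \<open>Bounding \<open>f x\<close> from the left end and from the right end, with weights b - x
  and x - a, joins the two partial energies into the full one. The weight (b - x)(x - a) integrates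
  to (b - a)^3 / 6, the source of the constant; the sharp inequality has pi^2 in place of 6.\<close>

lemma poincare_dirichlet:
  fixes f f' :: "real \<Rightarrow> 'a::euclidean_space"
  assumes ab: "a < b"
    and f: "\<And>x. x \<in> {a..b} \<Longrightarrow> (f has_vector_derivative f' x) (at x within {a..b})"
    and c: "continuous_on {a..b} f'"
    and "f a = 0" "f b = 0"
  shows "integral {a..b} (\<lambda>x. (norm (f x))\<^sup>2) \<le> (b - a)\<^sup>2 / 6 * integral {a..b} (\<lambda>x. (norm (f' x))\<^sup>2)"
proof -
  define D where "D = integral {a..b} (\<lambda>x. (norm (f' x))\<^sup>2)"
  have cf: "continuous_on {a..b} f"
    using f by (meson continuous_on_eq_continuous_within has_vector_derivative_continuous)
  have pt: "(b - a) * (norm (f x))\<^sup>2 \<le> (b - x) * (x - a) * D" if x: "x \<in> {a..b}" for x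
  proof -
    have sub: "{a..x} \<subseteq> {a..b}" "{x..b} \<subseteq> {a..b}" using x by auto
    have d: "(f has_vector_derivative f' y) (at y within S)" if "y \<in> S" "S \<subseteq> {a..b}" for y S
      using f that by (blast intro: has_vector_derivative_within_subset)
    have c': "continuous_on {a..x} f'" "continuous_on {x..b} f'"
      using c sub continuous_on_subset by blast+
    have 1: "(norm (f x))\<^sup>2 \<le> (x - a) * integral {a..x} (\<lambda>x. (norm (f' x))\<^sup>2)"
      using norm_increment_square_le[OF _ d c'(1)] x sub(1) assms(4) by simp
    have 2: "(norm (f x))\<^sup>2 \<le> (b - x) * integral {x..b} (\<lambda>x. (norm (f' x))\<^sup>2)"
      using norm_increment_square_le[OF _ d c'(2)] x sub(2) assms(5) by simp
    have D: "D = integral {a..x} (\<lambda>x. (norm (f' x))\<^sup>2) + integral {x..b} (\<lambda>x. (norm (f' x))\<^sup>2)"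
      unfolding D_def using x
      by (intro Henstock_Kurzweil_Integration.integral_combine[symmetric]) (auto intro!: integrable_continuous_interval continuous_intros c)
    have "(b - a) * (norm (f x))\<^sup>2 = (b - x) * (norm (f x))\<^sup>2 + (x - a) * (norm (f x))\<^sup>2"
      by (simp add: algebra_simps)
    also have "\<dots> \<le> (b - x) * ((x - a) * integral {a..x} (\<lambda>x. (norm (f' x))\<^sup>2))
        + (x - a) * ((b - x) * integral {x..b} (\<lambda>x. (norm (f' x))\<^sup>2))"
      using 1 2 x by (intro add_mono mult_left_mono) auto
    also have "\<dots> = (b - x) * (x - a) * D" by (simp add: D algebra_simps)
    finally show ?thesis .
  qed
  have w: "((\<lambda>x. (b - x) * (x - a)) has_integral (b - a)^3 / 6) {a..b}"
  proof -
    have "((\<lambda>x. (b - x) * (x - a)) has_integral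
        ((\<lambda>x. (b - a) * (x - a)^2 / 2 - (x - a)^3 / 3) b - (\<lambda>x. (b - a) * (x - a)^2 / 2 - (x - a)^3 / 3) a)) {a..b}"
    proof (rule fundamental_theorem_of_calculus)
      show "((\<lambda>x. (b - a) * (x - a)^2 / 2 - (x - a)^3 / 3) has_vector_derivative (b - x) * (x - a)) (at x within {a..b})" for x
        unfolding has_real_derivative_iff_has_vector_derivative[symmetric]
        by (auto intro!: derivative_eq_intros simp: field_simps power2_eq_square)
    qed (use ab in auto)
    moreover have "(b - a) * (b - a)^2 / 2 - (b - a)^3 / 3 = (b - a)^3 / 6"
      by (simp add: power2_eq_square power3_eq_cube)
    ultimately show ?thesis by simp
  qed
  have "(b - a) * integral {a..b} (\<lambda>x. (norm (f x))\<^sup>2) = integral {a..b} (\<lambda>x. (b - a) * (norm (f x))\<^sup>2)"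
    by simp
  also have "\<dots> \<le> integral {a..b} (\<lambda>x. (b - x) * (x - a) * D)"
    by (rule integral_le) (auto intro!: integrable_continuous_interval continuous_intros cf pt)
  also have "\<dots> = (b - a)^3 / 6 * D"
    using w by (simp add: integral_unique)
  also have "\<dots> = (b - a) * ((b - a)\<^sup>2 / 6 * D)" by (simp add: power2_eq_square power3_eq_cube)
  finally show ?thesis using ab by (simp add: D_def mult_le_cancel_left)
qed

lemma integral_periodic_shift:
  fixes f :: "real \<Rightarrow> real"
  assumes c: "continuous_on UNIV f" and per: "\<And>x. f (x + L) = f x" and a: "0 \<le> a" "a \<le> L"
  shows "integral {a..a+L} f = integral {0..L} f"
proof -
  have i: "f integrable_on {x..y}" for x y
    by (rule integrable_continuous_interval) (use c in \<open>auto intro: continuous_on_subset\<close>)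
  have "integral {a..a+L} f = integral {a..L} f + integral {L..a+L} f"
    using a by (intro Henstock_Kurzweil_Integration.integral_combine[symmetric] i) auto
  also have "integral {L..a+L} f = integral {0..a} f"
    using integral_shift_real_ivl[of L L "a+L" f] by (simp add: per)
  also have "integral {a..L} f + integral {0..a} f = integral {0..L} f"
    using Henstock_Kurzweil_Integration.integral_combine[OF a i] by simp
  finally show ?thesis .
qed

text \<open>Hurwitz's trick: by the intermediate value theorem \<open>f\<close> takes equal values at two points half
  a period apart, and subtracting that value gives zero boundary values on both half periods.\<close>

lemma poincare_periodic:
  fixes f f' :: "real \<Rightarrow> real"
  assumes L: "L > 0"
    and f: "\<And>x. (f has_real_derivative f' x) (at x)"
    and c: "continuous_on UNIV f'"
    and per: "\<And>x. f (x + L) = f x"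
    and mean: "integral {0..L} f = 0"
  shows "integral {0..L} (\<lambda>x. (f x)\<^sup>2) \<le> L\<^sup>2 / 24 * integral {0..L} (\<lambda>x. (f' x)\<^sup>2)"
proof -
  have cf: "continuous_on UNIV f"
    using f by (meson DERIV_continuous_on DERIV_subset subset_UNIV)
  have cf': "continuous_on S f" for S using cf continuous_on_subset by blast
  have cc: "continuous_on S f'" for S using c continuous_on_subset by blast
  have per': "f' (x + L) = f' x" for x
  proof -
    have "((\<lambda>x. f (x + L)) has_real_derivative f' (x + L)) (at x)"
      using f[of "x + L"] by (subst (asm) DERIV_shift) (simp add: o_def)
    with f[of x] show ?thesis by (simp add: per DERIV_unique)
  qed
  obtain a where a: "0 \<le> a" "a \<le> L/2" and eq: "f a = f (a + L/2)"
  proof -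
    let ?\<phi> = "\<lambda>x. f x - f (x + L/2)"
    have cphi: "continuous_on {0..L/2} ?\<phi>"
      by (auto intro!: continuous_intros cf' continuous_on_compose2[OF cf])
    \<comment> \<open>The difference over half a period changes sign between the two ends, so it has
      a zero in between.\<close>
    have op: "?\<phi> (L/2) = - ?\<phi> 0" using per[of 0] by simp
    have "\<exists>x. 0 \<le> x \<and> x \<le> L/2 \<and> ?\<phi> x = 0"
    proof (cases "?\<phi> 0 \<le> 0")
      case True
      then show ?thesis using IVT'[of ?\<phi> 0 0 "L/2"] op cphi L by auto
    next
      case False
      then show ?thesis using IVT2'[of ?\<phi> "L/2" 0 0] op cphi L by auto
    qed
    then show thesis using that by auto
  qed
  define k where "k = f a"
  define h where "h = a + L/2"
  have int: "continuous_on UNIV g \<Longrightarrow> g integrable_on {x..y}" for x y and g :: "real \<Rightarrow> real"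
    by (rule integrable_continuous_interval) (auto intro: continuous_on_subset)
  have der: "((\<lambda>x. f x - k) has_vector_derivative f' x) (at x within S)" for x S
    unfolding has_real_derivative_iff_has_vector_derivative[symmetric]
    using has_field_derivative_at_within[OF f[of x], of S] by (auto intro!: derivative_eq_intros)
  \<comment> \<open>Half a period has length L/2, and (L/2)^2 / 6 = L^2 / 24.\<close>
  have h1: "integral {a..h} (\<lambda>x. (f x - k)\<^sup>2) \<le> L\<^sup>2 / 24 * integral {a..h} (\<lambda>x. (f' x)\<^sup>2)"
    using poincare_dirichlet[of a h "\<lambda>x. f x - k" f'] der cc L eq
    by (simp add: h_def k_def power_divide)
  have h2: "integral {h..a+L} (\<lambda>x. (f x - k)\<^sup>2) \<le> L\<^sup>2 / 24 * integral {h..a+L} (\<lambda>x. (f' x)\<^sup>2)"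
    using poincare_dirichlet[of h "a+L" "\<lambda>x. f x - k" f'] der cc L eq per[of a]
    by (simp add: h_def k_def power_divide)
  have s1: "integral {a..h} g + integral {h..a+L} g = integral {0..L} g"
    if "continuous_on UNIV g" "\<And>x. g (x + L) = g x" for g :: "real \<Rightarrow> real"
    using integral_periodic_shift[OF that, of a] Henstock_Kurzweil_Integration.integral_combine[of a h "a+L" g] int[OF that(1)] a L
    by (simp add: h_def)
  have e1: "integral {a..h} (\<lambda>x. (f x - k)\<^sup>2) + integral {h..a+L} (\<lambda>x. (f x - k)\<^sup>2)
      = integral {0..L} (\<lambda>x. (f x - k)\<^sup>2)"
    by (rule s1) (auto intro!: continuous_intros cf simp: per)
  have e2: "integral {a..h} (\<lambda>x. (f' x)\<^sup>2) + integral {h..a+L} (\<lambda>x. (f' x)\<^sup>2)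
      = integral {0..L} (\<lambda>x. (f' x)\<^sup>2)"
    by (rule s1) (auto intro!: continuous_intros cc simp: per')
  have "integral {0..L} (\<lambda>x. (f x - k)\<^sup>2) \<le> L\<^sup>2 / 24 * integral {0..L} (\<lambda>x. (f' x)\<^sup>2)"
    unfolding e1[symmetric] e2[symmetric] distrib_left by (rule add_mono[OF h1 h2])
  \<comment> \<open>The zero mean removes the cross term, so the subtraction of k can only increase
    the integral of the square.\<close>
  moreover have "integral {0..L} (\<lambda>x. (f x - k)\<^sup>2) = integral {0..L} (\<lambda>x. (f x)\<^sup>2) + L * k\<^sup>2"
  proof -
    have "((\<lambda>x. (f x)\<^sup>2 - 2 * k * f x + k\<^sup>2) has_integral
        (integral {0..L} (\<lambda>x. (f x)\<^sup>2) - 2 * k * integral {0..L} f + L * k\<^sup>2)) {0..L}"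
      using has_integral_const_real[of "k\<^sup>2" 0 L] L
      by (intro has_integral_add has_integral_diff has_integral_mult_right integrable_integral int
          continuous_intros cf) simp
    moreover have "(\<lambda>x. (f x - k)\<^sup>2) = (\<lambda>x. (f x)\<^sup>2 - 2 * k * f x + k\<^sup>2)"
      by (simp add: power2_eq_square algebra_simps)
    ultimately show ?thesis using mean L by (simp add: integral_unique)
  qed
  moreover have "L * k\<^sup>2 \<ge> 0" using L by simp
  ultimately show ?thesis by linarith
qed

text \<open>A minimum point y satisfies \<open>h y\<close> \<le> mean. On the circle two arcs lead
  from y to x, and the variation on each is at least h x - h y. Twice the rise is thus bounded by
  the total variation, which explains the factor 1/2.\<close>

lemma le_mean_plus_integral_deriv:
  fixes h h' :: "real \<Rightarrow> real"
  assumes L: "L > 0"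
    and h: "\<And>x. (h has_real_derivative h' x) (at x)"
    and c: "continuous_on {0..L} h'"
    and per: "h L = h 0" and x: "x \<in> {0..L}"
  shows "h x \<le> integral {0..L} h / L + integral {0..L} (\<lambda>s. \<bar>h' s\<bar>) / 2"
proof -
  have ch: "continuous_on S h" for S
    using h by (meson DERIV_continuous_on DERIV_subset subset_UNIV)
  have int: "(\<lambda>s. \<bar>h' s\<bar>) integrable_on {a..b}" if "0 \<le> a" "b \<le> L" for a b
    by (rule integrable_continuous_interval, rule continuous_on_subset[of "{0..L}"])
       (use c that in \<open>auto intro!: continuous_intros\<close>)
  have inc: "\<bar>h b - h a\<bar> \<le> integral {a..b} (\<lambda>s. \<bar>h' s\<bar>)" if "0 \<le> a" "a \<le> b" "b \<le> L" for a b
  proof -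
    have "(h' has_integral h b - h a) {a..b}"
      using that h by (intro fundamental_theorem_of_calculus)
        (auto simp: has_real_derivative_iff_has_vector_derivative[symmetric] intro: DERIV_subset)
    moreover have "h' integrable_on {a..b}" using calculation by blast
    ultimately show ?thesis
      using integral_norm_bound_integral[of h' "{a..b}" "\<lambda>s. \<bar>h' s\<bar>"] int[of a b] that
      by (simp add: integral_unique)
  qed
  have tot: "integral {0..L} (\<lambda>s. \<bar>h' s\<bar>) = integral {0..a} (\<lambda>s. \<bar>h' s\<bar>)
     + integral {a..b} (\<lambda>s. \<bar>h' s\<bar>) + integral {b..L} (\<lambda>s. \<bar>h' s\<bar>)" if "0 \<le> a" "a \<le> b" "b \<le> L" for a b
    using Henstock_Kurzweil_Integration.integral_combine[of 0 a b "\<lambda>s. \<bar>h' s\<bar>"] Henstock_Kurzweil_Integration.integral_combine[of 0 b L "\<lambda>s. \<bar>h' s\<bar>"] int that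
    by (smt (verit))
  obtain y where y: "y \<in> {0..L}" and hy: "h y \<le> integral {0..L} h / L"
  proof -
    have "\<exists>y\<in>{0..L}. \<forall>z\<in>{0..L}. h y \<le> h z"
      by (rule continuous_attains_inf) (use L ch in auto)
    then obtain y where y: "y \<in> {0..L}" "\<And>z. z \<in> {0..L} \<Longrightarrow> h y \<le> h z" by blast
    have "integral {0..L} (\<lambda>_. h y) \<le> integral {0..L} h"
      by (rule integral_le) (auto intro!: integrable_continuous_interval ch y)
    then have "h y \<le> integral {0..L} h / L" using L by (simp add: field_simps)
    with y that show thesis by blast
  qed
  have "2 * (h x - h y) \<le> integral {0..L} (\<lambda>s. \<bar>h' s\<bar>)"
  proof (cases "x \<le> y")
    case True
    then show ?thesis using inc[of x y] inc[of 0 x] inc[of y L] tot[of x y] x y per by auto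
  next
    case False
    then show ?thesis using inc[of y x] inc[of 0 y] inc[of x L] tot[of y x] x y per by auto
  qed
  then show ?thesis using hy by (simp add: field_simps)
qed

section \<open>Periodic functions on a rectangle\<close>

definition rect_integral :: "real \<Rightarrow> real \<Rightarrow> (real \<Rightarrow> real \<Rightarrow> 'a::euclidean_space) \<Rightarrow> 'a" where
  "rect_integral Lx Ly f = integral ({0..Lx} \<times> {0..Ly}) (\<lambda>(x, y). f x y)"

abbreviation cont2 :: "(real \<Rightarrow> real \<Rightarrow> 'a::euclidean_space) \<Rightarrow> bool" where
  "cont2 f \<equiv> continuous_on UNIV (\<lambda>p. f (fst p) (snd p))"

lemma rect_box: "{0..Lx} \<times> {0..Ly} = cbox (0, 0) (Lx :: real, Ly :: real)"
  by (simp add: cbox_Pair_eq)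

lemma rect_integral_cbox:
  "rect_integral Lx Ly f = integral (cbox (0, 0) (Lx, Ly)) (\<lambda>p. f (fst p) (snd p))"
  by (simp add: rect_integral_def rect_box case_prod_unfold)

lemma cont2_integrable:
  assumes "cont2 f"
  shows "(\<lambda>p. f (fst p) (snd p)) integrable_on cbox a b"
  by (rule integrable_continuous) (use assms continuous_on_subset in blast)

lemma cont2_compose:
  assumes "cont2 f" "continuous_on S g" "continuous_on S h"
  shows "continuous_on S (\<lambda>z. f (g z) (h z))"
  using continuous_on_compose2[OF assms(1) continuous_on_Pair[OF assms(2,3)]] by simp

lemma rect_integral_iterated:
  assumes "cont2 f"
  shows "rect_integral Lx Ly f = integral {0..Lx} (\<lambda>x. integral {0..Ly} (\<lambda>y. f x y))"
proof -
  have "continuous_on (cbox (0, 0) (Lx, Ly)) (\<lambda>p. f (fst p) (snd p))"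
    using assms continuous_on_subset by blast
  from integral_prod_continuous[OF this] show ?thesis by (simp add: rect_integral_cbox)
qed

lemma rect_integral_iterated':
  assumes "cont2 f"
  shows "rect_integral Lx Ly f = integral {0..Ly} (\<lambda>y. integral {0..Lx} (\<lambda>x. f x y))"
proof -
  have "continuous_on (cbox (0, 0) (Lx, Ly)) (\<lambda>(x, y). f x y)"
    unfolding case_prod_beta using assms continuous_on_subset by blast
  from integral_swap_continuous[OF this] show ?thesis
    by (simp add: rect_integral_iterated assms)
qed

lemma cont2_integral_fst:
  assumes "cont2 f"
  shows "continuous_on UNIV (\<lambda>y. integral {0..L} (\<lambda>x. f x y))"
proof -
  have "continuous_on (UNIV \<times> cbox 0 L) (\<lambda>(y, x). f x y)"
    unfolding case_prod_beta by (intro cont2_compose[OF assms] continuous_intros)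
  from integral_continuous_on_param[OF this] show ?thesis by simp
qed

lemma cont2_integral_snd:
  assumes "cont2 f"
  shows "continuous_on UNIV (\<lambda>x. integral {0..L} (\<lambda>y. f x y))"
proof -
  have "continuous_on (UNIV \<times> cbox 0 L) (\<lambda>(x, y). f x y)"
    unfolding case_prod_beta by (intro cont2_compose[OF assms] continuous_intros)
  from integral_continuous_on_param[OF this] show ?thesis by simp
qed

lemma rect_integral_mono:
  fixes f g :: "real \<Rightarrow> real \<Rightarrow> real"
  assumes "cont2 f" "cont2 g"
    and "\<And>x y. x \<in> {0..Lx} \<Longrightarrow> y \<in> {0..Ly} \<Longrightarrow> f x y \<le> g x y"
  shows "rect_integral Lx Ly f \<le> rect_integral Lx Ly g"
  unfolding rect_integral_cbox
  by (rule integral_le[OF cont2_integrable[OF assms(1)] cont2_integrable[OF assms(2)]])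
    (use assms(3) in \<open>auto simp: rect_box[symmetric]\<close>)

lemma rect_integral_nonneg:
  fixes f :: "real \<Rightarrow> real \<Rightarrow> real"
  assumes "cont2 f" "\<And>x y. f x y \<ge> 0"
  shows "rect_integral Lx Ly f \<ge> 0"
  unfolding rect_integral_cbox
  by (rule integral_nonneg) (auto intro!: cont2_integrable assms)

lemma rect_integral_add:
  assumes "cont2 f" "cont2 g"
  shows "rect_integral Lx Ly (\<lambda>x y. f x y + g x y) = rect_integral Lx Ly f + rect_integral Lx Ly g"
  unfolding rect_integral_cbox by (rule integral_add) (auto intro!: cont2_integrable assms)

lemma rect_integral_cmult:
  "rect_integral Lx Ly (\<lambda>x y. c * f x y) = (c::real) * rect_integral Lx Ly f"
  unfolding rect_integral_cbox by simp

lemma rect_integral_sum: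
  assumes "\<And>i. i \<in> I \<Longrightarrow> cont2 (f i)" "finite I"
  shows "rect_integral Lx Ly (\<lambda>x y. \<Sum>i\<in>I. f i x y) = (\<Sum>i\<in>I. rect_integral Lx Ly (f i))"
  unfolding rect_integral_cbox by (rule integral_sum) (auto intro!: cont2_integrable assms)

lemma rect_integral_Cauchy_Schwarz:
  fixes f g :: "real \<Rightarrow> real \<Rightarrow> real"
  assumes "cont2 f" "cont2 g"
  shows "rect_integral Lx Ly (\<lambda>x y. f x y * g x y)
    \<le> sqrt (rect_integral Lx Ly (\<lambda>x y. (f x y)\<^sup>2)) * sqrt (rect_integral Lx Ly (\<lambda>x y. (g x y)\<^sup>2))"
  unfolding rect_integral_cbox
  by (rule integral_mult_le_sqrt) (use assms continuous_on_subset in blast)+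

lemma rect_integral_component:
  fixes f :: "real \<Rightarrow> real \<Rightarrow> 'a::euclidean_space"
  assumes "cont2 f"
  shows "rect_integral Lx Ly f \<bullet> b = rect_integral Lx Ly (\<lambda>x y. f x y \<bullet> b)"
  unfolding rect_integral_cbox
  by (subst integral_linear[OF cont2_integrable[OF assms] bounded_linear_inner_left, symmetric])
    (simp add: o_def)

section \<open>Poincare and Ladyzhenskaya inequalities for periodic functions of two
  variables\<close>

locale periodic_C1 =
  fixes Lx Ly :: real and v vx vy :: "real \<Rightarrow> real \<Rightarrow> 'a::euclidean_space"
  assumes Lx: "Lx > 0" and Ly: "Ly > 0"
    and vx: "\<And>x y. ((\<lambda>x. v x y) has_vector_derivative vx x y) (at x)"
    and vy: "\<And>x y. ((\<lambda>y. v x y) has_vector_derivative vy x y) (at y)"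
    and cv: "cont2 v" and cvx: "cont2 vx" and cvy: "cont2 vy"
    and perx: "\<And>x y. v (x + Lx) y = v x y" and pery: "\<And>x y. v x (y + Ly) = v x y"
begin

definition grad_energy where
  "grad_energy = rect_integral Lx Ly (\<lambda>x y. (norm (vx x y))\<^sup>2 + (norm (vy x y))\<^sup>2)"

lemma component: "periodic_C1 Lx Ly (\<lambda>x y. v x y \<bullet> b) (\<lambda>x y. vx x y \<bullet> b) (\<lambda>x y. vy x y \<bullet> b)"
  by unfold_locales
    (auto simp: Lx Ly perx pery intro!: continuous_intros cv cvx cvy
      bounded_linear.has_vector_derivative[OF bounded_linear_inner_left] vx vy)

end

text \<open>With \<open>M\<close> the mean over x, v - M has zero mean in every row, and
  \<open>M\<close> is periodic with zero mean in y, so the one-dimensional inequality applies to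
  both. They are orthogonal in each row, so each direction keeps its own constant. Cauchy-Schwarz
  bounds the derivative of \<open>M\<close> by that of v.\<close>

lemma poincare_rect_real:
  fixes v vx vy :: "real \<Rightarrow> real \<Rightarrow> real"
  assumes "periodic_C1 Lx Ly v vx vy"
    and mean: "rect_integral Lx Ly v = 0"
  shows "rect_integral Lx Ly (\<lambda>x y. (v x y)\<^sup>2)
    \<le> Lx\<^sup>2 / 24 * rect_integral Lx Ly (\<lambda>x y. (vx x y)\<^sup>2) + Ly\<^sup>2 / 24 * rect_integral Lx Ly (\<lambda>x y. (vy x y)\<^sup>2)"
proof -
  interpret periodic_C1 Lx Ly v vx vy by fact
  define M where "M y = integral {0..Lx} (\<lambda>x. v x y) / Lx" for y
  define M' where "M' y = integral {0..Lx} (\<lambda>x. vy x y) / Lx" for y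
  have M: "(M has_real_derivative M' y) (at y)" for y
  proof -
    have "((\<lambda>y. integral (cbox 0 Lx) (\<lambda>x. v x y)) has_field_derivative integral (cbox 0 Lx) (\<lambda>x. vy x y)) (at y within UNIV)"
    proof (rule leibniz_rule_field_derivative)
      show "((\<lambda>y. v x y) has_field_derivative vy x y) (at y within UNIV)" for x y
        using vy by (simp add: has_real_derivative_iff_has_vector_derivative)
      show "(\<lambda>x. v x y) integrable_on cbox 0 Lx" for y
        by (intro integrable_continuous cont2_compose[OF cv] continuous_intros)
      show "continuous_on (UNIV \<times> cbox 0 Lx) (\<lambda>(y, x). vy x y)"
        unfolding case_prod_beta by (intro cont2_compose[OF cvy] continuous_intros)
    qed auto
    then show ?thesis
      unfolding M_def M'_def using Lx by (auto intro!: derivative_eq_intros)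
  qed
  have cM: "continuous_on UNIV M" and cM': "continuous_on UNIV M'"
    unfolding M_def M'_def
    by (intro continuous_on_divide continuous_on_const cont2_integral_fst cv cvy; use Lx in simp)+
  have cM_: "continuous_on S M" and cM'_: "continuous_on S M'" for S
    using cM cM' continuous_on_subset by blast+
  have row: "integral {0..Lx} (\<lambda>x. (v x y)\<^sup>2) \<le> Lx\<^sup>2 / 24 * integral {0..Lx} (\<lambda>x. (vx x y)\<^sup>2) + Lx * (M y)\<^sup>2" for y
  proof -
    have ci: "continuous_on S (\<lambda>x. v x y)" for S
      by (intro cont2_compose[OF cv] continuous_intros)
    have iv: "integral {0..Lx} (\<lambda>x. v x y) = Lx * M y" using Lx by (simp add: M_def)
    have hc: "((\<lambda>_. c) has_integral Lx * c) {0..Lx}" for c :: real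
      using has_integral_const_real[of c 0 Lx] Lx by simp
    have h1: "((\<lambda>x. v x y - M y) has_integral (Lx * M y - Lx * M y)) {0..Lx}"
      by (intro has_integral_diff hc) (metis iv ci integrable_integral integrable_continuous_interval)
    have h2: "((\<lambda>x. (v x y)\<^sup>2 - 2 * M y * v x y + (M y)\<^sup>2) has_integral
        (integral {0..Lx} (\<lambda>x. (v x y)\<^sup>2) - 2 * M y * integral {0..Lx} (\<lambda>x. v x y) + Lx * (M y)\<^sup>2)) {0..Lx}"
      by (intro has_integral_add has_integral_diff has_integral_mult_right integrable_integral hc
          integrable_continuous_interval continuous_intros ci)
    have "(\<lambda>x. (v x y - M y)\<^sup>2) = (\<lambda>x. (v x y)\<^sup>2 - 2 * M y * v x y + (M y)\<^sup>2)"
      by (simp add: power2_eq_square algebra_simps)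
    with h2 have "integral {0..Lx} (\<lambda>x. (v x y - M y)\<^sup>2) = integral {0..Lx} (\<lambda>x. (v x y)\<^sup>2) - Lx * (M y)\<^sup>2"
      by (simp add: integral_unique iv power2_eq_square)
    moreover have "integral {0..Lx} (\<lambda>x. (v x y - M y)\<^sup>2) \<le> Lx\<^sup>2 / 24 * integral {0..Lx} (\<lambda>x. (vx x y)\<^sup>2)"
    proof (rule poincare_periodic[OF Lx])
      show "((\<lambda>x. v x y - M y) has_real_derivative vx x y) (at x)" for x
        using vx[of y x] unfolding has_real_derivative_iff_has_vector_derivative[symmetric]
        by (auto intro!: derivative_eq_intros)
      show "continuous_on UNIV (\<lambda>x. vx x y)"
        by (intro cont2_compose[OF cvx] continuous_intros)
      show "integral {0..Lx} (\<lambda>x. v x y - M y) = 0" using h1 by (simp add: integral_unique)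
    qed (simp add: perx)
    ultimately show ?thesis by simp
  qed
  have M2: "integral {0..Ly} (\<lambda>y. (M y)\<^sup>2) \<le> Ly\<^sup>2 / 24 * integral {0..Ly} (\<lambda>y. (M' y)\<^sup>2)"
  proof (rule poincare_periodic[OF Ly M cM'])
    show "M (y + Ly) = M y" for y by (simp add: M_def pery)
    show "integral {0..Ly} M = 0"
      using mean unfolding rect_integral_iterated'[OF cv] M_def by simp
  qed
  have M'2: "Lx * (M' y)\<^sup>2 \<le> integral {0..Lx} (\<lambda>x. (vy x y)\<^sup>2)" for y
  proof -
    have "(integral {0..Lx} (\<lambda>x. vy x y))\<^sup>2 \<le> (Lx - 0) * integral {0..Lx} (\<lambda>x. (vy x y)\<^sup>2)"
      by (rule integral_square_le) (use Lx in \<open>auto intro!: cont2_compose[OF cvy] continuous_intros\<close>)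
    then show ?thesis using Lx by (simp add: M'_def power2_eq_square field_simps)
  qed
  have c2: "cont2 (\<lambda>x y. (v x y)\<^sup>2)" "cont2 (\<lambda>x y. (vx x y)\<^sup>2)" "cont2 (\<lambda>x y. (vy x y)\<^sup>2)"
    by (intro continuous_intros cv cvx cvy)+
  have ci: "(\<lambda>y. integral {0..Lx} (\<lambda>x. f x y)) integrable_on {0..Ly}" if "cont2 f" for f :: "real \<Rightarrow> real \<Rightarrow> real"
    by (intro integrable_continuous_interval continuous_on_subset[OF cont2_integral_fst[OF that]]) simp
  have "rect_integral Lx Ly (\<lambda>x y. (v x y)\<^sup>2)
      \<le> integral {0..Ly} (\<lambda>y. Lx\<^sup>2 / 24 * integral {0..Lx} (\<lambda>x. (vx x y)\<^sup>2) + Lx * (M y)\<^sup>2)"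
    unfolding rect_integral_iterated'[OF c2(1)]
    by (rule integral_le[OF ci[OF c2(1)] _ row])
      (intro integrable_add integrable_on_mult_right ci c2 integrable_continuous_interval continuous_intros cM_)
  also have "\<dots> = Lx\<^sup>2 / 24 * rect_integral Lx Ly (\<lambda>x y. (vx x y)\<^sup>2) + Lx * integral {0..Ly} (\<lambda>y. (M y)\<^sup>2)"
    unfolding rect_integral_iterated'[OF c2(2)]
    by (subst integral_add; (intro integrable_on_mult_right ci c2 integrable_continuous_interval
      continuous_intros cM_)?) simp
  also have "Lx * integral {0..Ly} (\<lambda>y. (M y)\<^sup>2) \<le> Lx * (Ly\<^sup>2 / 24 * integral {0..Ly} (\<lambda>y. (M' y)\<^sup>2))"
    using M2 Lx by (intro mult_left_mono) auto
  also have "\<dots> = Ly\<^sup>2 / 24 * integral {0..Ly} (\<lambda>y. Lx * (M' y)\<^sup>2)" by simp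
  also have "\<dots> \<le> Ly\<^sup>2 / 24 * rect_integral Lx Ly (\<lambda>x y. (vy x y)\<^sup>2)"
    unfolding rect_integral_iterated'[OF c2(3)]
    by (rule mult_left_mono, rule integral_le[OF _ ci[OF c2(3)] M'2])
      (auto intro!: integrable_continuous_interval continuous_intros cM'_)
  finally show ?thesis by simp
qed


lemma norm_square_sum_Basis: "(norm (x :: 'a::euclidean_space))\<^sup>2 = (\<Sum>b\<in>Basis. (x \<bullet> b)\<^sup>2)"
  by (subst power2_norm_eq_inner, subst euclidean_inner) (simp add: power2_eq_square)

context periodic_C1
begin

lemma poincare_rect:
  assumes mean: "rect_integral Lx Ly v = 0"
  shows "rect_integral Lx Ly (\<lambda>x y. (norm (v x y))\<^sup>2) \<le> (max Lx Ly)\<^sup>2 / 24 * grad_energy"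
proof -
  have c: "cont2 (\<lambda>x y. (v x y \<bullet> b)\<^sup>2)" "cont2 (\<lambda>x y. (vx x y \<bullet> b)\<^sup>2)" "cont2 (\<lambda>x y. (vy x y \<bullet> b)\<^sup>2)" for b
    by (intro continuous_intros cv cvx cvy)+
  have cn: "cont2 (\<lambda>x y. (norm (vx x y))\<^sup>2)" "cont2 (\<lambda>x y. (norm (vy x y))\<^sup>2)"
    by (intro continuous_intros cvx cvy)+
  have e: "rect_integral Lx Ly (\<lambda>x y. (norm (f x y))\<^sup>2) = (\<Sum>b\<in>Basis. rect_integral Lx Ly (\<lambda>x y. (f x y \<bullet> b)\<^sup>2))"
    if "\<And>b. cont2 (\<lambda>x y. (f x y \<bullet> b)\<^sup>2)" for f :: "real \<Rightarrow> real \<Rightarrow> 'a"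
    unfolding norm_square_sum_Basis by (rule rect_integral_sum[OF that]) simp
  define X where "X = rect_integral Lx Ly (\<lambda>x y. (norm (vx x y))\<^sup>2)"
  define Y where "Y = rect_integral Lx Ly (\<lambda>x y. (norm (vy x y))\<^sup>2)"
  have "rect_integral Lx Ly (\<lambda>x y. (norm (v x y))\<^sup>2)
      \<le> (\<Sum>b\<in>Basis. Lx\<^sup>2 / 24 * rect_integral Lx Ly (\<lambda>x y. (vx x y \<bullet> b)\<^sup>2)
          + Ly\<^sup>2 / 24 * rect_integral Lx Ly (\<lambda>x y. (vy x y \<bullet> b)\<^sup>2))"
    unfolding e[OF c(1)]
    by (intro sum_mono poincare_rect_real[OF component])
      (simp add: rect_integral_component[OF cv, symmetric] mean)
  also have "\<dots> = Lx\<^sup>2 / 24 * X + Ly\<^sup>2 / 24 * Y"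
    by (simp add: X_def Y_def e[OF c(2)] e[OF c(3)] sum.distrib sum_distrib_left)
  also have "\<dots> \<le> (max Lx Ly)\<^sup>2 / 24 * X + (max Lx Ly)\<^sup>2 / 24 * Y"
    using Lx Ly rect_integral_nonneg[OF cn(1)] rect_integral_nonneg[OF cn(2)]
    by (intro add_mono mult_right_mono divide_right_mono power_mono) (auto simp: X_def Y_def)
  also have "\<dots> = (max Lx Ly)\<^sup>2 / 24 * grad_energy"
    by (simp add: grad_energy_def rect_integral_add[OF cn] X_def Y_def distrib_left)
  finally show ?thesis .
qed

text \<open>This is \<open>le_mean_plus_integral_deriv\<close> for the square of the norm, whose
  derivative 2 v . vx absorbs the factor 1/2. The bound depends on y alone, which later separates
  the variables.\<close>

lemma square_le_mean_x:
  assumes x: "x \<in> {0..Lx}"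
  shows "(norm (v x y))\<^sup>2 \<le> integral {0..Lx} (\<lambda>x. (norm (v x y))\<^sup>2) / Lx
    + integral {0..Lx} (\<lambda>x. norm (v x y) * norm (vx x y))"
proof -
  have c: "continuous_on S (\<lambda>x. v x y)" "continuous_on S (\<lambda>x. vx x y)" for S
    by (intro cont2_compose[OF cv] cont2_compose[OF cvx] continuous_intros)+
  have 1: "(norm (v x y))\<^sup>2 \<le> integral {0..Lx} (\<lambda>x. (norm (v x y))\<^sup>2) / Lx
      + integral {0..Lx} (\<lambda>x. \<bar>2 * (v x y \<bullet> vx x y)\<bar>) / 2"
  proof (rule le_mean_plus_integral_deriv[OF Lx _ _ _ x])
    show "((\<lambda>x. (norm (v x y))\<^sup>2) has_real_derivative 2 * (v x y \<bullet> vx x y)) (at x)" for x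
      unfolding has_real_derivative_iff_has_vector_derivative power2_norm_eq_inner
      by (rule has_vector_derivative_eq_rhs[OF bounded_bilinear.has_vector_derivative[OF bounded_bilinear_inner vx vx]])
        (simp add: inner_commute)
    show "(norm (v Lx y))\<^sup>2 = (norm (v 0 y))\<^sup>2" using perx[of 0 y] by simp
  qed (intro continuous_intros c)
  have 2: "integral {0..Lx} (\<lambda>x. \<bar>2 * (v x y \<bullet> vx x y)\<bar>) \<le> integral {0..Lx} (\<lambda>x. 2 * (norm (v x y) * norm (vx x y)))"
  proof (rule integral_le)
    show "\<bar>2 * (v x y \<bullet> vx x y)\<bar> \<le> 2 * (norm (v x y) * norm (vx x y))" for x
      using Cauchy_Schwarz_ineq2[of "v x y" "vx x y"] by (simp add: abs_mult)
  qed (intro integrable_continuous_interval continuous_intros c)+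
  from 1 2 show ?thesis by simp
qed

text \<open>Lets the estimate along x serve along y as well.\<close>

lemma swap: "periodic_C1 Ly Lx (\<lambda>x y. v y x) (\<lambda>x y. vy y x) (\<lambda>x y. vx y x)"
proof -
  have "cont2 (\<lambda>x y. f y x)" if "cont2 f" for f :: "real \<Rightarrow> real \<Rightarrow> 'a"
    by (rule cont2_compose[OF that]) (intro continuous_intros)+
  then show ?thesis
    by unfold_locales (auto simp: Lx Ly perx pery vx vy cv cvx cvy)
qed

text \<open>The square of the norm is bounded by a function of y alone and by a function of x alone.
  Their product dominates the fourth power, and its integral factors; Cauchy-Schwarz then bounds
  each factor. No zero mean is assumed here, which is why the terms n^2 / Lx and n^2 / Ly
  appear.\<close>

lemma ladyzhenskaya_rect:
  defines "n \<equiv> sqrt (rect_integral Lx Ly (\<lambda>x y. (norm (v x y))\<^sup>2))"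
    and "gx \<equiv> sqrt (rect_integral Lx Ly (\<lambda>x y. (norm (vx x y))\<^sup>2))"
    and "gy \<equiv> sqrt (rect_integral Lx Ly (\<lambda>x y. (norm (vy x y))\<^sup>2))"
  shows "rect_integral Lx Ly (\<lambda>x y. (norm (v x y))^4) \<le> (n\<^sup>2 / Lx + n * gx) * (n\<^sup>2 / Ly + n * gy)"
proof -
  define \<alpha> where "\<alpha> y = integral {0..Lx} (\<lambda>x. (norm (v x y))\<^sup>2) / Lx
    + integral {0..Lx} (\<lambda>x. norm (v x y) * norm (vx x y))" for y
  define \<beta> where "\<beta> x = integral {0..Ly} (\<lambda>y. (norm (v x y))\<^sup>2) / Ly
    + integral {0..Ly} (\<lambda>y. norm (v x y) * norm (vy x y))" for x
  have cn: "cont2 (\<lambda>x y. norm (v x y))" "cont2 (\<lambda>x y. norm (vx x y))" "cont2 (\<lambda>x y. norm (vy x y))"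
    by (intro continuous_intros cv cvx cvy)+
  have c: "cont2 (\<lambda>x y. (norm (v x y))\<^sup>2)" "cont2 (\<lambda>x y. norm (v x y) * norm (vx x y))"
    "cont2 (\<lambda>x y. norm (v x y) * norm (vy x y))" "cont2 (\<lambda>x y. (norm (v x y))^4)"
    by (intro continuous_intros cn)+
  have c\<alpha>: "continuous_on UNIV \<alpha>" and c\<beta>: "continuous_on UNIV \<beta>"
    unfolding \<alpha>_def \<beta>_def
    by (intro continuous_on_add continuous_on_divide continuous_on_const cont2_integral_fst
        cont2_integral_snd c; use Lx Ly in simp)+
  have cab: "cont2 (\<lambda>x y. \<alpha> y * \<beta> x)"
    by (intro continuous_intros continuous_on_compose2[OF c\<alpha>] continuous_on_compose2[OF c\<beta>]) auto
  have n2: "n\<^sup>2 = rect_integral Lx Ly (\<lambda>x y. (norm (v x y))\<^sup>2)"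
    unfolding n_def by (simp add: rect_integral_nonneg c)
  have a: "(norm (v x y))\<^sup>2 \<le> \<alpha> y" if "x \<in> {0..Lx}" for x y
    unfolding \<alpha>_def by (rule square_le_mean_x[OF that])
  have b: "(norm (v x y))\<^sup>2 \<le> \<beta> x" if "y \<in> {0..Ly}" for x y
    unfolding \<beta>_def by (rule periodic_C1.square_le_mean_x[OF swap that])
  have \<alpha>0: "\<alpha> y \<ge> 0" for y using a[of 0 y] Lx by (smt (verit) atLeastAtMost_iff zero_le_power2)
  have \<beta>0: "\<beta> x \<ge> 0" for x using b[of 0 x] Ly by (smt (verit) atLeastAtMost_iff zero_le_power2)
  have ints: "(\<lambda>y. integral {0..Lx} (\<lambda>x. f x y)) integrable_on {0..Ly}"
    "(\<lambda>x. integral {0..Ly} (\<lambda>y. f x y)) integrable_on {0..Lx}"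
    if "cont2 f" for f :: "real \<Rightarrow> real \<Rightarrow> real"
    by (intro integrable_continuous_interval continuous_on_subset[OF cont2_integral_fst[OF that]]
        continuous_on_subset[OF cont2_integral_snd[OF that]]; simp)+
  have I\<alpha>: "integral {0..Ly} \<alpha> \<le> n\<^sup>2 / Lx + n * gx"
  proof -
    have "integral {0..Ly} \<alpha> = n\<^sup>2 / Lx + rect_integral Lx Ly (\<lambda>x y. norm (v x y) * norm (vx x y))"
      unfolding n2 rect_integral_iterated'[OF c(1)] rect_integral_iterated'[OF c(2)] \<alpha>_def
      by (subst integral_add[OF integrable_on_divide[OF ints(1)[OF c(1)]] ints(1)[OF c(2)]]) simp
    then show ?thesis
      using rect_integral_Cauchy_Schwarz[OF cn(1,2), of Lx Ly] by (simp add: n_def gx_def)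
  qed
  have I\<beta>: "integral {0..Lx} \<beta> \<le> n\<^sup>2 / Ly + n * gy"
  proof -
    have "integral {0..Lx} \<beta> = n\<^sup>2 / Ly + rect_integral Lx Ly (\<lambda>x y. norm (v x y) * norm (vy x y))"
      unfolding n2 rect_integral_iterated[OF c(1)] rect_integral_iterated[OF c(3)] \<beta>_def
      by (subst integral_add[OF integrable_on_divide[OF ints(2)[OF c(1)]] ints(2)[OF c(3)]]) simp
    then show ?thesis
      using rect_integral_Cauchy_Schwarz[OF cn(1,3), of Lx Ly] by (simp add: n_def gy_def)
  qed
  have "rect_integral Lx Ly (\<lambda>x y. (norm (v x y))^4) \<le> rect_integral Lx Ly (\<lambda>x y. \<alpha> y * \<beta> x)"
  proof (rule rect_integral_mono[OF c(4) cab])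
    fix x y assume xy: "x \<in> {0..Lx}" "y \<in> {0..Ly}"
    have "(norm (v x y))^4 = (norm (v x y))\<^sup>2 * (norm (v x y))\<^sup>2" by (simp flip: power_add)
    also have "\<dots> \<le> \<alpha> y * \<beta> x"
      using a[OF xy(1)] b[OF xy(2)] by (intro mult_mono \<alpha>0) auto
    finally show "(norm (v x y))^4 \<le> \<alpha> y * \<beta> x" .
  qed
  also have "\<dots> = integral {0..Ly} \<alpha> * integral {0..Lx} \<beta>"
    unfolding rect_integral_iterated[OF cab] by simp
  also have "\<dots> \<le> (n\<^sup>2 / Lx + n * gx) * (n\<^sup>2 / Ly + n * gy)"
  proof (rule mult_mono[OF I\<alpha> I\<beta>])
    have nn: "n \<ge> 0" "gx \<ge> 0"
      by (auto simp: n_def gx_def intro!: rect_integral_nonneg continuous_intros cn)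
    then show "0 \<le> n\<^sup>2 / Lx + n * gx" using Lx by simp
    show "0 \<le> integral {0..Lx} \<beta>"
      by (intro integral_nonneg integrable_continuous_interval continuous_on_subset[OF c\<beta>]) (auto simp: \<beta>0)
  qed
  finally show ?thesis .
qed

text \<open>Poincare replaces n in \<open>ladyzhenskaya_rect\<close> by the gradient. The constant
  is p q, where p = 1 / sqrt 24 comes from Poincare and q = p + 1 / sqrt 2 from the two directional
  factors; p q = 1/24 + 1 / sqrt 48 is at most 3/16.\<close>

lemma L4_norm_le_grad_energy:
  assumes mean: "rect_integral Lx Ly v = 0"
  shows "sqrt (rect_integral Lx Ly (\<lambda>x y. (norm (v x y))^4))
    \<le> 3 / 16 * sqrt (max (Lx / Ly) (Ly / Lx)) * max Lx Ly * grad_energy"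
proof -
  define n where "n = sqrt (rect_integral Lx Ly (\<lambda>x y. (norm (v x y))\<^sup>2))"
  define gx where "gx = sqrt (rect_integral Lx Ly (\<lambda>x y. (norm (vx x y))\<^sup>2))"
  define gy where "gy = sqrt (rect_integral Lx Ly (\<lambda>x y. (norm (vy x y))\<^sup>2))"
  define G where "G = sqrt grad_energy"
  define L where "L = max Lx Ly"
  define \<rho> where "\<rho> = max (Lx / Ly) (Ly / Lx)"
  define p where "p = 1 / sqrt (24::real)"
  have cn: "cont2 (\<lambda>x y. (norm (v x y))\<^sup>2)" "cont2 (\<lambda>x y. (norm (vx x y))\<^sup>2)" "cont2 (\<lambda>x y. (norm (vy x y))\<^sup>2)"
    by (intro continuous_intros cv cvx cvy)+
  have nn: "n \<ge> 0" "gx \<ge> 0" "gy \<ge> 0"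
    by (auto simp: n_def gx_def gy_def intro!: rect_integral_nonneg cn)
  have ge: "grad_energy = gx\<^sup>2 + gy\<^sup>2"
    by (simp add: grad_energy_def rect_integral_add[OF cn(2,3)] gx_def gy_def rect_integral_nonneg cn)
  then have G: "G\<^sup>2 = gx\<^sup>2 + gy\<^sup>2" "G \<ge> 0" by (simp_all add: G_def)
  have L: "L > 0" using Lx by (simp add: L_def)
  have p: "p > 0" "p\<^sup>2 = 1 / 24" by (simp_all add: p_def power_divide)
  have \<rho>: "\<rho> \<ge> 1" using Lx Ly by (cases "Lx \<le> Ly") (auto simp: \<rho>_def le_max_iff_disj)
  have "n\<^sup>2 \<le> (p * L * G)\<^sup>2"
    using poincare_rect[OF mean] rect_integral_nonneg[OF cn(1)] ge G
    by (simp add: n_def p power_mult_distrib L_def)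
  then have nG: "n \<le> p * L * G" by (rule power2_le_imp_le) (use p L G in auto)
  \<comment> \<open>The bound on n contains the longer side L. Division by that side leaves p G, and
    division by the shorter one costs the aspect ratio \<rho>, which is then granted to the whole
    factor.\<close>
  have prod: "(n / Lx + gx) * (n / Ly + gy) \<le> \<rho> * ((p * G + gx) * (p * G + gy))"
  proof (cases "Ly \<le> Lx")
    case True
    then have "L = Lx" "\<rho> = Lx / Ly"
      using Lx Ly by (auto simp: L_def \<rho>_def max_def field_simps power2_eq_square[symmetric] abs_le_square_iff[symmetric])
    then have "n / Lx \<le> p * G" "n / Ly \<le> \<rho> * (p * G)"
      using nG Lx Ly by (auto simp: field_simps)
    moreover have "gy \<le> \<rho> * gy" using \<rho> nn by (simp add: mult_le_cancel_right1)
    ultimately have "(n / Lx + gx) * (n / Ly + gy) \<le> (p * G + gx) * (\<rho> * (p * G) + \<rho> * gy)"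
      using nn p G Lx Ly by (intro mult_mono add_mono) auto
    then show ?thesis by (simp add: algebra_simps)
  next
    case False
    then have "L = Ly" "\<rho> = Ly / Lx"
      using Lx Ly by (auto simp: L_def \<rho>_def max_def field_simps power2_eq_square[symmetric] abs_le_square_iff[symmetric])
    then have "n / Ly \<le> p * G" "n / Lx \<le> \<rho> * (p * G)"
      using nG Lx Ly by (auto simp: field_simps)
    moreover have "gx \<le> \<rho> * gx" using \<rho> nn by (simp add: mult_le_cancel_right1)
    ultimately have "(n / Lx + gx) * (n / Ly + gy) \<le> (\<rho> * (p * G) + \<rho> * gx) * (p * G + gy)"
      using nn p G Lx Ly \<rho> by (intro mult_mono add_mono) auto
    then show ?thesis by (simp add: algebra_simps)
  qed
  define q where "q = p + 1 / sqrt 2"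
  \<comment> \<open>The product is at most the square of the arithmetic mean, and gx + gy \<le> sqrt
    2 G because gx^2 + gy^2 = G^2.\<close>
  have amgm: "(p * G + gx) * (p * G + gy) \<le> (q * G)\<^sup>2"
  proof -
    have "gx + gy \<le> sqrt 2 * G"
    proof (rule power2_le_imp_le)
      show "(gx + gy)\<^sup>2 \<le> (sqrt 2 * G)\<^sup>2"
        using sum_squares_bound[of gx gy] by (simp add: power_mult_distrib G power2_sum)
    qed (use G in auto)
    then have "(gx + gy) / 2 \<le> sqrt 2 * G / 2" by simp
    also have "\<dots> = 1 / sqrt 2 * G" by (simp add: real_div_sqrt field_simps)
    finally have h: "p * G + (gx + gy) / 2 \<le> q * G"
      unfolding q_def distrib_right by simp
    have "(p * G + gx) * (p * G + gy) \<le> (p * G + (gx + gy) / 2)\<^sup>2"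
      using zero_le_power2[of "gx - gy"] by (simp add: power2_eq_square field_simps)
    also have "\<dots> \<le> (q * G)\<^sup>2" using h nn p G by (intro power_mono) auto
    finally show ?thesis .
  qed
  have "rect_integral Lx Ly (\<lambda>x y. (norm (v x y))^4) \<le> (n\<^sup>2 / Lx + n * gx) * (n\<^sup>2 / Ly + n * gy)"
    unfolding n_def gx_def gy_def by (rule ladyzhenskaya_rect)
  also have "\<dots> = n\<^sup>2 * ((n / Lx + gx) * (n / Ly + gy))" by (simp add: power2_eq_square algebra_simps)
  also have "\<dots> \<le> (p * L * G)\<^sup>2 * (\<rho> * (q * G)\<^sup>2)"
    using prod amgm \<rho> nn nG Lx Ly
    by (intro mult_mono power_mono order_trans[OF prod] mult_left_mono) auto
  also have "\<dots> = (p * q * sqrt \<rho> * L * G\<^sup>2)\<^sup>2" using \<rho> by (simp add: power_mult_distrib)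
  finally have "sqrt (rect_integral Lx Ly (\<lambda>x y. (norm (v x y))^4)) \<le> \<bar>p * q * sqrt \<rho> * L * G\<^sup>2\<bar>"
    using real_sqrt_le_mono by fastforce
  also have "\<bar>p * q * sqrt \<rho> * L * G\<^sup>2\<bar> = p * q * (sqrt \<rho> * L * G\<^sup>2)"
    using p L \<rho> by (simp add: q_def)
  also have "\<dots> \<le> 3 / 16 * (sqrt \<rho> * L * G\<^sup>2)"
  proof (rule mult_right_mono)
    have "p * q = 1 / 24 + 1 / sqrt 48"
      by (simp add: q_def distrib_left p(2)[unfolded power2_eq_square]) (simp add: p_def flip: real_sqrt_mult)
    \<comment> \<open>As 49 is just above 48, sqrt 48 is only slightly larger than 48/7; then 1/24 +
      7/48 = 9/48 = 3/16.\<close>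
    moreover have "sqrt 48 \<ge> 48 / 7" by (rule real_le_rsqrt) (simp add: power2_eq_square)
    then have "1 / sqrt 48 \<le> 7 / (48::real)" by (simp add: field_simps)
    ultimately show "p * q \<le> 3 / 16" by simp
  qed (use L \<rho> in auto)
  finally show ?thesis by (simp add: \<rho>_def L_def G ge algebra_simps)
qed

end

lemma rect_integral_const:
  assumes "Lx > 0" "Ly > 0"
  shows "rect_integral Lx Ly (\<lambda>x y. c) = (Lx * Ly) *\<^sub>R c"
  unfolding rect_integral_cbox using assms by (simp add: content_Pair)

lemma rect_integral_diff:
  assumes "cont2 f" "cont2 g"
  shows "rect_integral Lx Ly (\<lambda>x y. f x y - g x y) = rect_integral Lx Ly f - rect_integral Lx Ly g"
  unfolding rect_integral_cbox by (rule integral_diff) (auto intro!: cont2_integrable assms)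

lemma norm_rect_integral_square_le:
  fixes f :: "real \<Rightarrow> real \<Rightarrow> 'a::euclidean_space"
  assumes f: "cont2 f" and L: "Lx > 0" "Ly > 0"
  shows "(norm (rect_integral Lx Ly f))\<^sup>2 \<le> Lx * Ly * rect_integral Lx Ly (\<lambda>x y. (norm (f x y))\<^sup>2)"
proof -
  have c: "cont2 (\<lambda>x y. norm (f x y))" "cont2 (\<lambda>x y. (norm (f x y))\<^sup>2)" "cont2 (\<lambda>x y. 1 :: real)"
    by (intro continuous_intros f)+
  have "norm (rect_integral Lx Ly f) \<le> rect_integral Lx Ly (\<lambda>x y. 1 * norm (f x y))"
    unfolding rect_integral_cbox
    by (rule integral_norm_bound_integral) (use cont2_integrable f c in auto)
  also have "\<dots> \<le> sqrt (Lx * Ly) * sqrt (rect_integral Lx Ly (\<lambda>x y. (norm (f x y))\<^sup>2))"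
    using rect_integral_Cauchy_Schwarz[OF c(3,1), of Lx Ly] rect_integral_const[OF L, of "1::real"] by simp
  finally have "(norm (rect_integral Lx Ly f))\<^sup>2
      \<le> (sqrt (Lx * Ly) * sqrt (rect_integral Lx Ly (\<lambda>x y. (norm (f x y))\<^sup>2)))\<^sup>2"
    by (rule power_mono) simp
  then show ?thesis
    using L by (simp add: power_mult_distrib rect_integral_nonneg c)
qed

lemma rect_integral_eq_0_imp:
  fixes f :: "real \<Rightarrow> real \<Rightarrow> real"
  assumes f: "cont2 f" "\<And>x y. f x y \<ge> 0" and L: "Lx > 0" "Ly > 0"
    and 0: "rect_integral Lx Ly f = 0" and xy: "x \<in> {0..Lx}" "y \<in> {0..Ly}"
  shows "f x y = 0"
proof -
  have "integral (cbox (0, 0) (Lx, Ly)) (\<lambda>p. f (fst p) (snd p)) = 0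
      \<longleftrightarrow> (\<forall>p\<in>cbox (0, 0) (Lx, Ly). f (fst p) (snd p) = 0)"
  proof (rule integral_cbox_eq_0_iff)
    show "continuous_on (cbox (0, 0) (Lx, Ly)) (\<lambda>p. f (fst p) (snd p))"
      using f(1) continuous_on_subset by blast
    show "box (0, 0) (Lx, Ly) \<noteq> {}"
      using L by (auto simp: box_ne_empty Basis_prod_def)
  qed (rule f(2))
  with 0 xy show ?thesis
    unfolding rect_integral_cbox by (auto simp: cbox_Pair_eq dest!: bspec[of _ _ "(x, y)"])
qed

lemma periodic_representative:
  fixes f :: "real \<Rightarrow> 'a"
  assumes "L > 0" "\<And>x. f (x + L) = f x"
  obtains x' where "x' \<in> {0..L}" "f x' = f x"
proof -
  interpret periodic_fun_simple f L by standard (rule assms)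
  define n where "n = \<lfloor>x / L\<rfloor>"
  have "of_int n \<le> x / L" "x / L \<le> of_int n + 1" unfolding n_def by linarith+
  then have "x - of_int n * L \<in> {0..L}"
    using assms(1) by (auto simp: field_simps)
  moreover have "f (x - of_int n * L) = f x" by (rule minus_of_int)
  ultimately show thesis by (rule that)
qed

section \<open>Fields on the slab\<close>

abbreviation pt :: "real \<Rightarrow> real \<Rightarrow> real \<Rightarrow> real^3" where
  "pt x y z \<equiv> vector [x, y, z]"

lemma pt_eq: "pt x y z = x *\<^sub>R axis 1 1 + y *\<^sub>R axis 2 1 + z *\<^sub>R axis 3 1"
  by (simp add: vec_eq_iff forall_3 axis_def)

lemma pt_components [simp]: "pt (r$1) (r$2) (r$3) = r"
  by (simp add: vec_eq_iff forall_3)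

lemma pt_add_axis [simp]:
  "pt x y z + axis 1 s = pt (x + s) y z"
  "pt x y z + axis 2 s = pt x (y + s) z"
  "pt x y z + axis 3 s = pt x y (z + s)"
  by (simp_all add: vec_eq_iff forall_3 axis_def)

lemma axis_scaleR: "axis i (s::real) = s *\<^sub>R axis i 1"
  by (simp add: vec_eq_iff axis_def)

lemma pt_in_slab [simp]: "pt x y z \<in> slab \<longleftrightarrow> 0 \<le> z \<and> z \<le> 1"
  by (simp add: slab_def)

lemma axis_nth_3 [simp]: "(axis 1 s :: real^3) $ 3 = 0" "(axis 2 s :: real^3) $ 3 = 0" "(axis 3 s :: real^3) $ 3 = s"
  by (simp_all add: axis_def)

lemma add_axis_in_slab:
  "r + axis 1 s \<in> slab \<longleftrightarrow> r \<in> slab" "r + axis 2 s \<in> slab \<longleftrightarrow> r \<in> slab"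
  "r + axis 3 s \<in> slab \<longleftrightarrow> 0 \<le> r$3 + s \<and> r$3 + s \<le> 1"
  by (simp_all add: slab_def)

lemma continuous_on_pt [continuous_intros]:
  assumes "continuous_on S f" "continuous_on S g" "continuous_on S h"
  shows "continuous_on S (\<lambda>p. pt (f p) (g p) (h p))"
  unfolding pt_eq by (intro continuous_intros assms)

text \<open>The derivative along a coordinate line is one-sided in \<open>z\<close> at the walls, so it depends only on the
  values in the slab; in the interior and in horizontal directions it agrees with \<^const>\<open>pd\<close>.\<close>

definition slab_deriv :: "3 \<Rightarrow> (real^3 \<Rightarrow> 'b::real_normed_vector) \<Rightarrow> (real^3 \<Rightarrow> 'b) \<Rightarrow> bool" where
  "slab_deriv i f D \<longleftrightarrow> (\<forall>r\<in>slab.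
     ((\<lambda>s. f (r + axis i s)) has_vector_derivative D r) (at 0 within {s. r + axis i s \<in> slab}))"

lemma slab_deriv_cong:
  assumes "slab_deriv i f D" "\<And>r. r \<in> slab \<Longrightarrow> f r = g r" "\<And>r. r \<in> slab \<Longrightarrow> D r = E r"
  shows "slab_deriv i g E"
  unfolding slab_deriv_def
proof
  fix r :: "real^3" assume r: "r \<in> slab"
  show "((\<lambda>s. g (r + axis i s)) has_vector_derivative E r) (at 0 within {s. r + axis i s \<in> slab})"
    by (rule has_vector_derivative_transform[of _ _ _ "\<lambda>s. f (r + axis i s)"])
      (use assms r in \<open>auto simp: slab_deriv_def axis_def zero_vec_def[symmetric]\<close>)
qed

lemma axis_zero: "axis i (0::real) = 0"
  by (simp add: axis_def vec_eq_iff)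

lemma slab_deriv_at:
  assumes "slab_deriv i f D" "r \<in> slab" "i \<noteq> 3 \<or> 0 < r$3 \<and> r$3 < 1"
  shows "((\<lambda>s. f (r + axis i s)) has_vector_derivative D r) (at 0)"
proof -
  have "(0::real) \<in> interior {s. r + axis i s \<in> slab}"
  proof -
    consider "i \<noteq> 3" | "i = 3" "0 < r$3" "r$3 < 1" using assms(3) by blast
    then show ?thesis
    proof cases
      case 1
      then have "{s. r + axis i s \<in> slab} = UNIV"
        using exhaust_3[of i] assms(2) by (auto simp: add_axis_in_slab)
      then show ?thesis by simp
    next
      case 2
      have "{- r$3<..<1 - r$3} \<subseteq> interior {s. r + axis i s \<in> slab}"
        by (rule interior_maximal) (use 2 in \<open>auto simp: add_axis_in_slab\<close>)
      then show ?thesis using 2 by (auto simp: subset_iff)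
    qed
  qed
  then have "at (0::real) within {s. r + axis i s \<in> slab} = at 0" by (rule at_within_interior)
  then show ?thesis
    using assms(1,2) unfolding slab_deriv_def by metis
qed

lemma pd_eq:
  assumes "slab_deriv i f D" "r \<in> slab" "i \<noteq> 3 \<or> 0 < r$3 \<and> r$3 < 1"
  shows "pd i f r = D r"
  unfolding pd_def by (rule vector_derivative_at[OF slab_deriv_at[OF assms]])

lemma slab_deriv_bilinear:
  assumes "bounded_bilinear op" "slab_deriv i f D" "slab_deriv i g E"
  shows "slab_deriv i (\<lambda>r. op (f r) (g r)) (\<lambda>r. op (D r) (g r) + op (f r) (E r))"
  unfolding slab_deriv_def
proof
  fix r :: "real^3" assume r: "r \<in> slab"
  have "((\<lambda>s. op (f (r + axis i s)) (g (r + axis i s))) has_vector_derivative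
      op (f (r + axis i 0)) (E r) + op (D r) (g (r + axis i 0))) (at 0 within {s. r + axis i s \<in> slab})"
    by (rule bounded_bilinear.has_vector_derivative[OF assms(1)])
      (use assms(2,3) r in \<open>auto simp: slab_deriv_def\<close>)
  then show "((\<lambda>s. op (f (r + axis i s)) (g (r + axis i s))) has_vector_derivative
      op (D r) (g r) + op (f r) (E r)) (at 0 within {s. r + axis i s \<in> slab})"
    by (simp add: axis_zero add.commute)
qed

lemma slab_deriv_linear:
  assumes "bounded_linear L" "slab_deriv i f D"
  shows "slab_deriv i (\<lambda>r. L (f r)) (\<lambda>r. L (D r))"
  using assms(2) unfolding slab_deriv_def
  by (auto intro: bounded_linear.has_vector_derivative[OF assms(1)])

lemma slab_deriv_add:
  assumes "slab_deriv i f D" "slab_deriv i g E"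
  shows "slab_deriv i (\<lambda>r. f r + g r) (\<lambda>r. D r + E r)"
  using assms unfolding slab_deriv_def by (auto intro: has_vector_derivative_add)

lemma slab_deriv_diff:
  assumes "slab_deriv i f D" "slab_deriv i g E"
  shows "slab_deriv i (\<lambda>r. f r - g r) (\<lambda>r. D r - E r)"
  using assms unfolding slab_deriv_def by (auto intro: has_vector_derivative_diff)

lemmas slab_deriv_mult = slab_deriv_bilinear[OF bounded_bilinear_mult]
lemmas slab_deriv_nth = slab_deriv_linear[OF bounded_linear_vec_nth]

text \<open>In a horizontal direction \<open>pd\<close> is computed from values of f in the slab
  only and coincides with D on the whole slab, walls included. Invariance of f under a shift
  therefore passes to D.\<close>

lemma slab_deriv_periodic:
  assumes "slab_deriv i f D" "periodic_xy Lx Ly f" "i \<noteq> 3"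
  shows "periodic_xy Lx Ly D"
proof -
  have *: "D (r + a) = D r" if r: "r \<in> slab" and a: "\<And>q. q + a \<in> slab \<longleftrightarrow> q \<in> slab"
    and p: "\<And>q. q \<in> slab \<Longrightarrow> f (q + a) = f q" for r a
  proof -
    have ra: "r + a \<in> slab" using r a by simp
    have sl: "r + axis i s \<in> slab" "r + a + axis i s \<in> slab" for s
      using exhaust_3[of i] assms(3) r ra by (auto simp: add_axis_in_slab)
    have "f (r + a + axis i s) = f (r + axis i s)" for s
      using p[OF sl(1)[of s]] by (simp add: add_ac)
    then have "pd i f (r + a) = pd i f r" by (simp add: pd_def)
    then show ?thesis using pd_eq[OF assms(1)] r ra assms(3) by simp
  qed
  show ?thesis
    unfolding periodic_xy_def
    using * assms(2) by (auto simp: periodic_xy_def add_axis_in_slab)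
qed

lemma slab_deriv_x:
  assumes "slab_deriv 1 f D" "z \<in> {0..1}"
  shows "((\<lambda>x. f (pt x y z)) has_vector_derivative D (pt x y z)) (at x)"
proof -
  have 1: "((\<lambda>s. f (pt (x + s) y z)) has_vector_derivative D (pt x y z)) (at 0)"
    using assms unfolding slab_deriv_def by (auto dest!: bspec[of _ _ "pt x y z"])
  have "((\<lambda>s. f (pt (x + s) y z)) \<circ> (\<lambda>t. t - x) has_vector_derivative 1 *\<^sub>R D (pt x y z)) (at x)"
    by (rule vector_diff_chain_at) (use 1 in \<open>auto intro!: derivative_eq_intros\<close>)
  then show ?thesis by (simp add: o_def)
qed

lemma slab_deriv_y:
  assumes "slab_deriv 2 f D" "z \<in> {0..1}"
  shows "((\<lambda>y. f (pt x y z)) has_vector_derivative D (pt x y z)) (at y)"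
proof -
  have 1: "((\<lambda>s. f (pt x (y + s) z)) has_vector_derivative D (pt x y z)) (at 0)"
    using assms unfolding slab_deriv_def by (auto dest!: bspec[of _ _ "pt x y z"])
  have "((\<lambda>s. f (pt x (y + s) z)) \<circ> (\<lambda>t. t - y) has_vector_derivative 1 *\<^sub>R D (pt x y z)) (at y)"
    by (rule vector_diff_chain_at) (use 1 in \<open>auto intro!: derivative_eq_intros\<close>)
  then show ?thesis by (simp add: o_def)
qed

lemma slab_deriv_z:
  assumes "slab_deriv 3 f D" "z \<in> {0..1}"
  shows "((\<lambda>z. f (pt x y z)) has_vector_derivative D (pt x y z)) (at z within {0..1})"
proof -
  have im: "(\<lambda>t. t - z) ` {0..1} = {s. 0 \<le> z + s \<and> z + s \<le> 1}"
    by (auto simp: image_iff)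
  have 1: "((\<lambda>s. f (pt x y (z + s))) has_vector_derivative D (pt x y z)) (at 0 within (\<lambda>t. t - z) ` {0..1})"
    using assms unfolding slab_deriv_def im by (auto dest!: bspec[of _ _ "pt x y z"])
  have "((\<lambda>s. f (pt x y (z + s))) \<circ> (\<lambda>t. t - z) has_vector_derivative 1 *\<^sub>R D (pt x y z)) (at z within {0..1})"
    by (rule vector_diff_chain_within) (use 1 in \<open>auto intro!: derivative_eq_intros\<close>)
  then show ?thesis by (simp add: o_def)
qed

lemma slab_derivI_x:
  assumes "\<And>x y z. z \<in> {0..1} \<Longrightarrow> ((\<lambda>x. f (pt x y z)) has_vector_derivative D (pt x y z)) (at x)"
  shows "slab_deriv 1 f D"
  unfolding slab_deriv_def
proof
  fix r :: "real^3" assume r: "r \<in> slab"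
  have 1: "((\<lambda>x. f (pt x (r$2) (r$3))) has_vector_derivative D r) (at (r$1))"
    using assms[of "r$3" "r$2" "r$1"] r by (simp add: slab_def)
  have "((\<lambda>x. f (pt x (r$2) (r$3))) \<circ> (\<lambda>s. r$1 + s) has_vector_derivative 1 *\<^sub>R D r) (at 0)"
    by (rule vector_diff_chain_at) (use 1 in \<open>auto intro!: derivative_eq_intros\<close>)
  moreover have "pt (r$1 + s) (r$2) (r$3) = r + axis 1 s" for s
    by (metis pt_add_axis(1) pt_components)
  ultimately show "((\<lambda>s. f (r + axis 1 s)) has_vector_derivative D r) (at 0 within {s. r + axis 1 s \<in> slab})"
    by (simp add: o_def has_vector_derivative_at_within)
qed

lemma slab_derivI_y:
  assumes "\<And>x y z. z \<in> {0..1} \<Longrightarrow> ((\<lambda>y. f (pt x y z)) has_vector_derivative D (pt x y z)) (at y)"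
  shows "slab_deriv 2 f D"
  unfolding slab_deriv_def
proof
  fix r :: "real^3" assume r: "r \<in> slab"
  have 1: "((\<lambda>y. f (pt (r$1) y (r$3))) has_vector_derivative D r) (at (r$2))"
    using assms[of "r$3" "r$1" "r$2"] r by (simp add: slab_def)
  have "((\<lambda>y. f (pt (r$1) y (r$3))) \<circ> (\<lambda>s. r$2 + s) has_vector_derivative 1 *\<^sub>R D r) (at 0)"
    by (rule vector_diff_chain_at) (use 1 in \<open>auto intro!: derivative_eq_intros\<close>)
  moreover have "pt (r$1) (r$2 + s) (r$3) = r + axis 2 s" for s
    by (metis pt_add_axis(2) pt_components)
  ultimately show "((\<lambda>s. f (r + axis 2 s)) has_vector_derivative D r) (at 0 within {s. r + axis 2 s \<in> slab})"
    by (simp add: o_def has_vector_derivative_at_within)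
qed

lemma slab_derivI_z:
  assumes "\<And>x y z. z \<in> {0..1} \<Longrightarrow> ((\<lambda>z. f (pt x y z)) has_vector_derivative D (pt x y z)) (at z within {0..1})"
  shows "slab_deriv 3 f D"
  unfolding slab_deriv_def
proof
  fix r :: "real^3" assume r: "r \<in> slab"
  let ?S = "{s. r + axis 3 s \<in> slab}"
  have im: "(\<lambda>s. r$3 + s) ` ?S \<subseteq> {0..1}"
    by (auto simp: add_axis_in_slab)
  have "((\<lambda>z. f (pt (r$1) (r$2) z)) has_vector_derivative D r) (at (r$3) within {0..1})"
    using assms[of "r$3" "r$1" "r$2"] r by (simp add: slab_def)
  then have 1: "((\<lambda>z. f (pt (r$1) (r$2) z)) has_vector_derivative D r) (at (r$3 + 0) within (\<lambda>s. r$3 + s) ` ?S)"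
    using has_vector_derivative_within_subset[OF _ im] by simp
  have "((\<lambda>z. f (pt (r$1) (r$2) z)) \<circ> (\<lambda>s. r$3 + s) has_vector_derivative 1 *\<^sub>R D r) (at 0 within ?S)"
    by (rule vector_diff_chain_within) (use 1 in \<open>auto intro!: derivative_eq_intros\<close>)
  moreover have "pt (r$1) (r$2) (r$3 + s) = r + axis 3 s" for s
    by (metis pt_add_axis(3) pt_components)
  ultimately show "((\<lambda>s. f (r + axis 3 s)) has_vector_derivative D r) (at 0 within ?S)"
    by (simp add: o_def)
qed

section \<open>Slices, columns and integrals over the periodicity cell\<close>

lemma cont2_slice:
  assumes "continuous_on slab f" "z \<in> {0..1}"
  shows "cont2 (\<lambda>x y. f (pt x y z))"
  by (rule continuous_on_compose2[OF assms(1)]) (use assms(2) in \<open>auto intro!: continuous_intros\<close>)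

lemma integral_xy_eq_rect: "integral_xy Lx Ly z f = rect_integral Lx Ly (\<lambda>x y. f (pt x y z))"
  by (simp add: integral_xy_def rect_integral_def)

lemma cell_cbox: "cell Lx Ly = cbox (pt 0 0 0) (pt Lx Ly 1)"
  by (auto simp: cell_def mem_box_cart forall_3)

text \<open>Permuting the coordinates to (z, (x, y)) puts the cell into a product type, with z first
  so that horizontal slices become the inner integrals. The permutation maps boxes to boxes of the
  same content, which is what \<open>has_integral_twiddle\<close> requires.\<close>

lemma cell_integral_box:
  fixes f :: "real^3 \<Rightarrow> real"
  assumes "f integrable_on cell Lx Ly" "Lx > 0" "Ly > 0"
  shows "integral (cell Lx Ly) f = integral (cbox (0, (0, 0)) (1, (Lx, Ly)))
    (\<lambda>p. f (pt (fst (snd p)) (snd (snd p)) (fst p)))"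
proof -
  define g where "g p = pt (fst (snd p)) (snd (snd p)) (fst p)" for p :: "real \<times> real \<times> real"
  define h where "h r = (r$3, r$1, r$2)" for r :: "real^3"
  have hg: "h (g p) = p" and gh: "g (h r) = r" for p r
    by (simp_all add: g_def h_def)
  have mem: "g p \<in> cbox (g u) (g v) \<longleftrightarrow> p \<in> cbox u v" for p u v
    by (cases p; cases u; cases v) (auto simp: g_def mem_box_cart forall_3 cbox_Pair_eq)
  have gim: "g ` cbox u v = cbox (g u) (g v)" for u v
    using mem gh by (metis (no_types, lifting) image_eqI subsetI subset_antisym image_subsetI)
  have him: "h ` cbox u v = cbox (h u) (h v)" for u v
    using gim[of "h u" "h v"] hg by (simp add: gh) (metis (no_types, lifting) hg image_image image_ident image_cong)
  have "((\<lambda>p. f (g p)) has_integral (1 / 1) *\<^sub>R integral (cell Lx Ly) f) (h ` cbox (pt 0 0 0) (pt Lx Ly 1))"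
  proof (rule has_integral_twiddle)
    show "continuous (at p) g" for p
    proof -
      have "continuous_on UNIV g" unfolding g_def by (intro continuous_intros)
      then show ?thesis using continuous_on_eq_continuous_at open_UNIV by blast
    qed
    show "\<exists>w z. g ` cbox u v = cbox w z" "\<exists>w z. h ` cbox a b = cbox w z" for u v a b
      using gim him by blast+
    show "measure lborel (g ` cbox u v) = 1 * measure lborel (cbox u v)" for u v
    proof -
      obtain u1 u2 u3 v1 v2 v3 where uv: "u = (u1, u2, u3)" "v = (v1, v2, v3)" by (metis surj_pair)
      have "cbox (g u) (g v) = {} \<longleftrightarrow> cbox u v = {}" using gim by (metis image_is_empty)
      moreover have "(\<Prod>i\<in>UNIV. g v $ i - g u $ i) = (v1 - u1) * ((v2 - u2) * (v3 - u3))"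
        unfolding UNIV_3 by (simp add: uv g_def)
      moreover have "cbox u v \<noteq> {} \<Longrightarrow> measure lborel (cbox u v) = (v1 - u1) * ((v2 - u2) * (v3 - u3))"
      proof -
        assume "cbox u v \<noteq> {}"
        then have "u1 \<le> v1" "u2 \<le> v2" "u3 \<le> v3" by (auto simp: uv cbox_Pair_eq)
        then show "measure lborel (cbox u v) = (v1 - u1) * ((v2 - u2) * (v3 - u3))"
          by (simp add: uv content_Pair)
      qed
      ultimately show ?thesis unfolding gim content_cbox_if_cart by auto
    qed
    show "(f has_integral integral (cell Lx Ly) f) (cbox (pt 0 0 0) (pt Lx Ly 1))"
      using assms(1) unfolding cell_cbox by (rule integrable_integral)
    show "h (g p) = p" "g (h r) = r" for p r by (rule hg gh)+
  qed simp
  moreover have "h ` cbox (pt 0 0 0) (pt Lx Ly 1) = cbox (0, (0, 0)) (1, (Lx, Ly))"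
    unfolding him unfolding h_def vector_3 ..
  ultimately have "((\<lambda>p. f (g p)) has_integral integral (cell Lx Ly) f) (cbox (0, (0, 0)) (1, (Lx, Ly)))"
    by (simp only: div_by_1 scaleR_one)
  then show ?thesis
    unfolding g_def by (rule integral_unique[symmetric])
qed

lemma cell_subset_slab: "cell Lx Ly \<subseteq> slab"
  by (auto simp: cell_def slab_def)

lemma integrable_cell:
  fixes f :: "real^3 \<Rightarrow> real"
  assumes "continuous_on slab f"
  shows "f integrable_on cell Lx Ly"
  using integrable_continuous[of "pt 0 0 0" "pt Lx Ly 1" f]
    continuous_on_subset[OF assms cell_subset_slab[of Lx Ly]]
  unfolding cell_cbox by blast

lemma cell_integral_slices:
  fixes f :: "real^3 \<Rightarrow> real"
  assumes c: "continuous_on slab f" and L: "Lx > 0" "Ly > 0"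
  shows "integral (cell Lx Ly) f = integral {0..1} (\<lambda>z. integral_xy Lx Ly z f)"
proof -
  have "continuous_on (cbox (0, (0, 0)) (1, (Lx, Ly))) (\<lambda>p. f (pt (fst (snd p)) (snd (snd p)) (fst p)))"
    by (rule continuous_on_compose2[OF c]) (auto intro!: continuous_intros simp: cbox_Pair_eq)
  from integral_prod_continuous[OF this] show ?thesis
    by (simp add: cell_integral_box[OF integrable_cell[OF c] L] integral_xy_eq_rect rect_integral_cbox)
qed

lemma cell_integral_columns:
  fixes f :: "real^3 \<Rightarrow> real"
  assumes c: "continuous_on slab f" and L: "Lx > 0" "Ly > 0"
  shows "integral (cell Lx Ly) f = rect_integral Lx Ly (\<lambda>x y. integral {0..1} (\<lambda>z. f (pt x y z)))"
proof -
  have "continuous_on (cbox (0, (0, 0)) (1, (Lx, Ly))) (\<lambda>(z, p). f (pt (fst p) (snd p) z))"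
    unfolding case_prod_beta
    by (rule continuous_on_compose2[OF c]) (auto intro!: continuous_intros simp: cbox_Pair_eq)
  from integral_swap_continuous[OF this] show ?thesis
    by (simp add: cell_integral_slices[OF c L] integral_xy_eq_rect rect_integral_cbox)
qed

lemma continuous_on_integral_xy:
  assumes c: "continuous_on slab f"
  shows "continuous_on {0..1} (\<lambda>z. rect_integral Lx Ly (\<lambda>x y. f (pt x y z)))"
  unfolding rect_integral_cbox
  by (rule integral_continuous_on_param, unfold case_prod_beta, rule continuous_on_compose2[OF c])
    (auto intro!: continuous_intros)

lemma rect_integral_deriv_x:
  assumes d: "slab_deriv 1 f D" "continuous_on slab D" "periodic_xy Lx Ly f" and z: "z \<in> {0..1}" and L: "Lx > 0"
  shows "rect_integral Lx Ly (\<lambda>x y. D (pt x y z)) = 0"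
proof -
  have "integral {0..Lx} (\<lambda>x. D (pt x y z)) = 0" for y
  proof -
    have "((\<lambda>x. D (pt x y z)) has_integral f (pt Lx y z) - f (pt 0 y z)) {0..Lx}"
      by (rule fundamental_theorem_of_calculus)
        (use L slab_deriv_x[OF d(1) z] in \<open>auto intro: has_vector_derivative_at_within\<close>)
    moreover have "f (pt Lx y z) = f (pt 0 y z)"
      using d(3) z unfolding periodic_xy_def by (auto dest!: bspec[of _ _ "pt 0 y z"])
    ultimately show ?thesis by (simp add: integral_unique)
  qed
  then show ?thesis unfolding rect_integral_iterated'[OF cont2_slice[OF d(2) z]] by simp
qed

lemma rect_integral_deriv_y:
  assumes d: "slab_deriv 2 f D" "continuous_on slab D" "periodic_xy Lx Ly f" and z: "z \<in> {0..1}" and L: "Ly > 0"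
  shows "rect_integral Lx Ly (\<lambda>x y. D (pt x y z)) = 0"
proof -
  have "integral {0..Ly} (\<lambda>y. D (pt x y z)) = 0" for x
  proof -
    have "((\<lambda>y. D (pt x y z)) has_integral f (pt x Ly z) - f (pt x 0 z)) {0..Ly}"
      by (rule fundamental_theorem_of_calculus)
        (use L slab_deriv_y[OF d(1) z] in \<open>auto intro: has_vector_derivative_at_within\<close>)
    moreover have "f (pt x Ly z) = f (pt x 0 z)"
      using d(3) z unfolding periodic_xy_def by (auto dest!: bspec[of _ _ "pt x 0 z"])
    ultimately show ?thesis by (simp add: integral_unique)
  qed
  then show ?thesis unfolding rect_integral_iterated[OF cont2_slice[OF d(2) z]] by simp
qed

text \<open>A divergence theorem in which each component is differentiated in its own direction
  only. The horizontal terms vanish slice by slice through periodicity, the vertical one column by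
  column through the wall condition.\<close>

lemma integral_divergence_eq_0:
  fixes F :: "3 \<Rightarrow> real^3 \<Rightarrow> real"
  assumes d: "\<And>i. slab_deriv i (F i) (D i)" and c: "\<And>i. continuous_on slab (D i)"
    and per: "periodic_xy Lx Ly (F 1)" "periodic_xy Lx Ly (F 2)"
    and wall: "\<And>r. r$3 = 0 \<or> r$3 = 1 \<Longrightarrow> F 3 r = 0" and L: "Lx > 0" "Ly > 0"
  shows "integral (cell Lx Ly) (\<lambda>r. \<Sum>i\<in>UNIV. D i r) = 0"
proof -
  have "integral (cell Lx Ly) (D 1) = 0"
    unfolding cell_integral_slices[OF c L] integral_xy_eq_rect
    by (subst integral_cong[where g = "\<lambda>_. 0"]) (use rect_integral_deriv_x[OF d c per(1) _ L(1)] in auto)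
  moreover have "integral (cell Lx Ly) (D 2) = 0"
    unfolding cell_integral_slices[OF c L] integral_xy_eq_rect
    by (subst integral_cong[where g = "\<lambda>_. 0"]) (use rect_integral_deriv_y[OF d c per(2) _ L(2)] in auto)
  moreover have "integral (cell Lx Ly) (D 3) = 0"
  proof -
    have "integral {0..1} (\<lambda>z. D 3 (pt x y z)) = 0" for x y
    proof -
      have "((\<lambda>z. D 3 (pt x y z)) has_integral F 3 (pt x y 1) - F 3 (pt x y 0)) {0..1}"
        by (rule fundamental_theorem_of_calculus) (use slab_deriv_z[OF d[of 3]] in auto)
      then show ?thesis by (simp add: integral_unique wall)
    qed
    then show ?thesis unfolding cell_integral_columns[OF c L] rect_integral_cbox by simp
  qed
  ultimately show ?thesis
    by (simp add: sum_3 integral_add integrable_add integrable_cell c)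
qed

text \<open>The constant k allows for the subtraction of a horizontal mean: it is 0 for the
  Archimedean flow and the slice mean for the magnetic field.\<close>

lemma periodic_C1_slice:
  assumes d: "slab_deriv 1 f f1" "slab_deriv 2 f f2"
    and c: "continuous_on slab f" "continuous_on slab f1" "continuous_on slab f2"
    and p: "periodic_xy Lx Ly f" and z: "z \<in> {0..1}" and L: "Lx > 0" "Ly > 0"
  shows "periodic_C1 Lx Ly (\<lambda>x y. f (pt x y z) - k) (\<lambda>x y. f1 (pt x y z)) (\<lambda>x y. f2 (pt x y z))"
proof
  show "((\<lambda>x. f (pt x y z) - k) has_vector_derivative f1 (pt x y z)) (at x)" for x y
    using slab_deriv_x[OF d(1) z] by (auto intro!: derivative_eq_intros)
  show "((\<lambda>y. f (pt x y z) - k) has_vector_derivative f2 (pt x y z)) (at y)" for x y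
    using slab_deriv_y[OF d(2) z] by (auto intro!: derivative_eq_intros)
  show "f (pt (x + Lx) y z) - k = f (pt x y z) - k" "f (pt x (y + Ly) z) - k = f (pt x y z) - k" for x y
    using p z unfolding periodic_xy_def by (auto dest!: bspec[of _ _ "pt x y z"])
qed (intro L continuous_intros cont2_slice c z)+

section \<open>From smooth space-time fields to derivatives on the closed slab\<close>

lemma Ck_on_1D:
  assumes "Ck_on U g (Suc 0)"
  shows "p \<in> U \<Longrightarrow> (g has_derivative frechet_derivative g (at p)) (at p)"
    and "continuous_on U (\<lambda>p. frechet_derivative g (at p) v)"
  using assms by (auto simp: frechet_derivative_works)

text \<open>The extension is differentiable in the full sense even at the walls. Restricting it to
  the part of a coordinate line inside the slab yields the one-sided derivative of the field,
  continuous up to the walls.\<close>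

lemma slab_deriv_of_extension:
  fixes i :: 3 and f :: "real^3 \<Rightarrow> 'b::real_normed_vector" and g :: "real \<times> (real^3) \<Rightarrow> 'b"
  assumes g: "Ck_on U g (Suc 0)" and U: "{t} \<times> slab \<subseteq> U" and f: "\<And>r. r \<in> slab \<Longrightarrow> f r = g (t, r)"
  defines "D \<equiv> \<lambda>r. frechet_derivative g (at (t, r)) (0, axis i 1)"
  shows "slab_deriv i f D" and "continuous_on slab D"
proof -
  show "continuous_on slab D"
    unfolding D_def
    by (rule continuous_on_compose2[OF Ck_on_1D(2)[OF g]]) (use U in \<open>auto intro!: continuous_intros\<close>)
  show "slab_deriv i f D"
    unfolding slab_deriv_def
  proof
    fix r :: "real^3" assume r: "r \<in> slab"
    let ?S = "{s. r + axis i s \<in> slab}"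
    have line: "((\<lambda>s. (t, r + axis i s)) has_derivative (\<lambda>s. (0, s *\<^sub>R axis i 1))) (at (0::real) within ?S)"
      by (subst axis_scaleR) (auto intro!: derivative_eq_intros)
    have "(g has_derivative frechet_derivative g (at (t, r))) (at (t, r + axis i 0))"
      using Ck_on_1D(1)[OF g, of "(t, r)"] U r by (auto simp: axis_zero)
    from has_derivative_compose[OF line this]
    have "((\<lambda>s. g (t, r + axis i s)) has_derivative (\<lambda>s. frechet_derivative g (at (t, r)) (0, s *\<^sub>R axis i 1))) (at 0 within ?S)" .
    moreover have "frechet_derivative g (at (t, r)) (0, s *\<^sub>R axis i 1) = s *\<^sub>R D r" for s
    proof -
      have "linear (frechet_derivative g (at (t, r)))"
        using Ck_on_1D(1)[OF g, of "(t, r)"] U r by (auto intro: has_derivative_linear)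
      from linear_scale[OF this, of s "(0, axis i 1)"] show ?thesis by (simp add: D_def)
    qed
    ultimately have "((\<lambda>s. g (t, r + axis i s)) has_vector_derivative D r) (at 0 within ?S)"
      by (simp add: has_vector_derivative_def)
    then show "((\<lambda>s. f (r + axis i s)) has_vector_derivative D r) (at 0 within ?S)"
      by (rule has_vector_derivative_transform[rotated 2]) (use r in \<open>auto simp: axis_zero f\<close>)
  qed
qed

lemma smooth_field_slab_derivs:
  assumes "smooth_field J f" "t \<in> J"
  obtains D DD where "continuous_on slab (f t)"
    "\<And>i. slab_deriv i (f t) (D i)" "\<And>i. continuous_on slab (D i)"
    "\<And>i j. slab_deriv j (D i) (DD i j)" "\<And>i j. continuous_on slab (DD i j)"
proof -
  obtain U g where U: "open U" "J \<times> slab \<subseteq> U" and g: "\<And>k. Ck_on U g k"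
    and fg: "\<And>t r. t \<in> J \<Longrightarrow> r \<in> slab \<Longrightarrow> f t r = g (t, r)"
    using assms(1) unfolding smooth_field_def by blast
  have tU: "{t} \<times> slab \<subseteq> U" using U assms(2) by auto
  define D where "D i r = frechet_derivative g (at (t, r)) (0, axis i 1)" for i r
  define G where "G i = (\<lambda>p. frechet_derivative g (at p) (0, axis i 1))" for i :: 3
  define DD where "DD i j r = frechet_derivative (G i) (at (t, r)) (0, axis j 1)" for i j r
  have g1: "Ck_on U g (Suc 0)" by (rule g)
  have G1: "Ck_on U (G i) (Suc 0)" for i
    using g[of "Suc (Suc 0)"] unfolding Ck_on.simps(2)[of U g "Suc 0"] G_def by blast
  have 0: "continuous_on slab (f t)"
  proof -
    have "continuous_on slab (\<lambda>r. g (t, r))"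
      by (rule continuous_on_compose2[of U g]) (use g[of 0] tU in \<open>auto intro!: continuous_intros\<close>)
    then show ?thesis using fg[OF assms(2)] by (simp cong: continuous_on_cong)
  qed
  have 1: "slab_deriv i (f t) (D i)" "continuous_on slab (D i)" for i
    unfolding D_def using slab_deriv_of_extension[OF g1 tU] fg[OF assms(2)] by blast+
  have DG: "D i r = G i (t, r)" for i r by (simp add: D_def G_def)
  have 2: "slab_deriv j (D i) (DD i j)" "continuous_on slab (DD i j)" for i j
    unfolding DD_def using slab_deriv_of_extension[OF G1 tU, of "D i" i j] DG by blast+
  from 0 1 2 show thesis by (rule that)
qed

lemma smooth_field_time_deriv:
  assumes "smooth_field J f"
  obtains F where "continuous_on (J \<times> slab) (\<lambda>(t, r). f t r)" "continuous_on (J \<times> slab) (\<lambda>(t, r). F t r)"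
    "\<And>t r. t \<in> J \<Longrightarrow> r \<in> slab \<Longrightarrow> ((\<lambda>s. f s r) has_vector_derivative F t r) (at t within J)"
proof -
  obtain U g where U: "open U" "J \<times> slab \<subseteq> U" and g: "\<And>k. Ck_on U g k"
    and fg: "\<And>t r. t \<in> J \<Longrightarrow> r \<in> slab \<Longrightarrow> f t r = g (t, r)"
    using assms unfolding smooth_field_def by blast
  have g1: "Ck_on U g (Suc 0)" by (rule g)
  define F where "F t r = frechet_derivative g (at (t, r)) (1, 0)" for t r
  have 1: "continuous_on (J \<times> slab) (\<lambda>(t, r). f t r)"
  proof -
    have "continuous_on (J \<times> slab) g" using g[of 0] U(2) continuous_on_subset by auto
    then show ?thesis by (rule continuous_on_eq) (use fg in auto)
  qed
  have 2: "continuous_on (J \<times> slab) (\<lambda>(t, r). F t r)"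
    unfolding F_def using continuous_on_subset[OF Ck_on_1D(2)[OF g1] U(2)] by (simp add: case_prod_beta)
  have 3: "((\<lambda>s. f s r) has_vector_derivative F t r) (at t within J)" if t: "t \<in> J" and r: "r \<in> slab" for t r
  proof -
    have line: "((\<lambda>s. (s, r)) has_derivative (\<lambda>s. (s, 0))) (at t within J)"
      by (auto intro!: derivative_eq_intros)
    have dg: "(g has_derivative frechet_derivative g (at (t, r))) (at (t, r))"
      using Ck_on_1D(1)[OF g1, of "(t, r)"] U t r by auto
    from has_derivative_compose[OF line this]
    have "((\<lambda>s. g (s, r)) has_derivative (\<lambda>s. frechet_derivative g (at (t, r)) (s, 0))) (at t within J)" .
    moreover have "frechet_derivative g (at (t, r)) (s, 0) = s *\<^sub>R F t r" for s
      using linear_scale[OF has_derivative_linear[OF dg], of s "(1, 0)"] by (simp add: F_def)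
    ultimately have "((\<lambda>s. g (s, r)) has_vector_derivative F t r) (at t within J)"
      by (simp add: has_vector_derivative_def)
    then show ?thesis
      by (rule has_vector_derivative_transform[rotated 2]) (use t r in \<open>auto simp: fg\<close>)
  qed
  from 1 2 3 show thesis by (rule that)
qed

lemma magnetic_energy_derivative:
  assumes J: "is_interval J" and t: "t \<in> J" and L: "Lx > 0" "Ly > 0"
    and cB: "continuous_on (J \<times> slab) (\<lambda>(t, r). B t r)"
    and cB': "continuous_on (J \<times> slab) (\<lambda>(t, r). B' t r)"
    and d: "\<And>t r. t \<in> J \<Longrightarrow> r \<in> slab \<Longrightarrow> ((\<lambda>s. B s r) has_vector_derivative B' t r) (at t within J)"
  shows "((\<lambda>t. magnetic_energy Lx Ly (B t)) has_real_derivative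
      integral (cell Lx Ly) (\<lambda>r. B t r \<bullet> B' t r)) (at t within J)"
proof -
  let ?a = "pt 0 0 0" and ?b = "pt Lx Ly 1"
  have box: "cbox ?a ?b \<subseteq> slab" using cell_subset_slab cell_cbox by simp
  have cc: "continuous_on (J \<times> cbox ?a ?b) (\<lambda>p. B (fst p) (snd p))"
    "continuous_on (J \<times> cbox ?a ?b) (\<lambda>p. B' (fst p) (snd p))"
    using cB cB' box by (auto simp: case_prod_beta elim: continuous_on_subset)
  have cs: "continuous_on (cbox ?a ?b) (B s)" if "s \<in> J" for s
    by (rule continuous_on_compose2[OF cc(1), of _ "\<lambda>r. (s, r)", simplified])
      (use that in \<open>auto intro!: continuous_intros\<close>)
  have "((\<lambda>s. integral (cbox ?a ?b) (\<lambda>r. (norm (B s r))\<^sup>2)) has_field_derivative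
      integral (cbox ?a ?b) (\<lambda>r. 2 * (B t r \<bullet> B' t r))) (at t within J)"
  proof (rule leibniz_rule_field_derivative)
    show "((\<lambda>s. (norm (B s r))\<^sup>2) has_field_derivative 2 * (B s r \<bullet> B' s r)) (at s within J)"
      if "s \<in> J" "r \<in> cbox ?a ?b" for s r
      unfolding has_real_derivative_iff_has_vector_derivative power2_norm_eq_inner
      by (rule has_vector_derivative_eq_rhs[OF bounded_bilinear.has_vector_derivative[OF bounded_bilinear_inner]])
        (use d that box in \<open>auto simp: inner_commute\<close>)
    show "(\<lambda>r. (norm (B s r))\<^sup>2) integrable_on cbox ?a ?b" if "s \<in> J" for s
      by (intro integrable_continuous continuous_intros cs that)
    show "continuous_on (J \<times> cbox ?a ?b) (\<lambda>(s, r). 2 * (B s r \<bullet> B' s r))"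
      unfolding case_prod_beta by (intro continuous_intros cc)
    show "convex J" using J by (simp add: is_interval_convex)
  qed (rule t)
  then show ?thesis
    unfolding magnetic_energy_def cell_cbox
    by (auto intro!: derivative_eq_intros)
qed

text \<open>Differentiate \<open>f x s - f x b = \<integral> fy x\<close> (over \<open>{b..s}\<close>) in \<open>x\<close> under the integral sign, then in \<open>s\<close>.\<close>

lemma mixed_partials:
  fixes f fx fy fyx :: "real \<Rightarrow> real \<Rightarrow> real"
  assumes fx: "\<And>x y. ((\<lambda>x. f x y) has_real_derivative fx x y) (at x)"
    and fy: "\<And>x y. ((\<lambda>y. f x y) has_real_derivative fy x y) (at y)"
    and fyx: "\<And>x y. ((\<lambda>x. fy x y) has_real_derivative fyx x y) (at x)"
    and c: "cont2 fy" "cont2 fyx"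
  shows "((\<lambda>y. fx x y) has_real_derivative fyx x y) (at y)"
proof -
  \<comment> \<open>A base point strictly below y makes y interior to {b..y+1}, so the derivative
    within that interval is the full derivative.\<close>
  define b where "b = y - 1"
  have ftc: "f x s = f x b + integral {b..s} (fy x)" if "b \<le> s" for x s
  proof -
    have "(fy x has_integral f x s - f x b) {b..s}"
      by (rule fundamental_theorem_of_calculus[OF that])
        (use fy in \<open>auto simp: has_real_derivative_iff_has_vector_derivative[symmetric]
          intro: has_field_derivative_at_within\<close>)
    then show ?thesis by (simp add: integral_unique)
  qed
  have cy: "continuous_on S (fyx x)" for S x
    by (rule cont2_compose[OF c(2)]) (intro continuous_intros)+
  have eq: "fx x s = fx x b + integral {b..s} (fyx x)" if s: "b \<le> s" for s
  proof -
    have "((\<lambda>x. integral (cbox b s) (fy x)) has_field_derivative integral (cbox b s) (fyx x)) (at x within UNIV)"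
    proof (rule leibniz_rule_field_derivative)
      show "((\<lambda>x. fy x t) has_field_derivative fyx x t) (at x within UNIV)" for x t by (rule fyx)
      show "fy x integrable_on cbox b s" for x
        by (intro integrable_continuous cont2_compose[OF c(1)] continuous_intros)
      show "continuous_on (UNIV \<times> cbox b s) (\<lambda>(x, t). fyx x t)"
        unfolding case_prod_beta by (intro cont2_compose[OF c(2)] continuous_intros)
    qed auto
    then have "((\<lambda>x. f x b + integral {b..s} (fy x)) has_real_derivative fx x b + integral {b..s} (fyx x)) (at x)"
      using fx by (auto intro: DERIV_add)
    then have "((\<lambda>x. f x s) has_real_derivative fx x b + integral {b..s} (fyx x)) (at x)"
      using ftc[OF s] by simp
    with fx show ?thesis by (blast intro: DERIV_unique)
  qed
  have "((\<lambda>s. integral {b..s} (fyx x)) has_vector_derivative fyx x y) (at y within {b..y+1})"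
    by (rule integral_has_vector_derivative) (auto simp: b_def intro: cy)
  then have "((\<lambda>s. fx x b + integral {b..s} (fyx x)) has_vector_derivative fyx x y) (at y within {b..y+1})"
    by (auto intro!: derivative_eq_intros)
  then have "((\<lambda>s. fx x s) has_vector_derivative fyx x y) (at y within {b..y+1})"
    by (rule has_vector_derivative_transform[rotated 2]) (simp add: b_def, rule eq, simp)
  moreover have "at y within {b..y+1} = at y"
    by (rule at_within_interior) (simp add: b_def)
  ultimately show ?thesis by (simp add: has_real_derivative_iff_has_vector_derivative)
qed

text \<open>For the vertical primitive of the temperature, this symmetry is exactly the vanishing of
  the divergence of the Archimedean flow.\<close>

lemma slab_deriv_mixed:
  fixes f :: "real^3 \<Rightarrow> real"
  assumes "slab_deriv 1 f D1" "slab_deriv 2 f D2" "slab_deriv 1 D2 D21" "slab_deriv 2 D1 D12"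
    and "continuous_on slab D2" "continuous_on slab D21" and r: "r \<in> slab"
  shows "D12 r = D21 r"
proof -
  define z where "z = r$3"
  have z: "z \<in> {0..1}" using r by (simp add: z_def slab_def)
  note R = has_real_derivative_iff_has_vector_derivative
  have "((\<lambda>y. D1 (pt x y z)) has_real_derivative D21 (pt x y z)) (at y)" for x y
    by (rule mixed_partials[where f = "\<lambda>x y. f (pt x y z)" and fy = "\<lambda>x y. D2 (pt x y z)"])
      (use assms z in \<open>auto simp: R intro: slab_deriv_x slab_deriv_y intro!: cont2_slice\<close>)
  moreover have "((\<lambda>y. D1 (pt x y z)) has_real_derivative D12 (pt x y z)) (at y)" for x y
    unfolding R by (rule slab_deriv_y[OF assms(4) z])
  ultimately have "D21 (pt x y z) = D12 (pt x y z)" for x y by (blast intro: DERIV_unique)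
  then show ?thesis by (metis pt_components z_def)
qed

section \<open>The vertical primitive of the temperature\<close>

lemma T_bar_pt: "T_bar \<theta> (pt x y z) = integral {0..z} (\<lambda>s. \<theta> (pt x y s))"
  by (simp add: T_bar_def)

lemma continuous_on_column:
  assumes "continuous_on slab \<theta>" "0 \<le> a" "b \<le> 1"
  shows "continuous_on {a..b} (\<lambda>s. \<theta> (pt x y s))"
  by (rule continuous_on_compose2[OF assms(1)]) (use assms in \<open>auto intro!: continuous_intros\<close>)

text \<open>The substitution \<open>s = z \<sigma>\<close> makes the limits of integration constant.\<close>

lemma continuous_on_T_bar:
  assumes c: "continuous_on slab \<theta>"
  shows "continuous_on slab (T_bar \<theta>)"
proof -
  have sub: "T_bar \<theta> r = r$3 * integral (cbox 0 1) (\<lambda>\<sigma>. \<theta> (pt (r$1) (r$2) (r$3 * \<sigma>)))" if r: "r \<in> slab" for r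
  proof (cases "r$3 = 0")
    case False
    then have z: "r$3 > 0" "r$3 \<le> 1" using r by (auto simp: slab_def)
    have "integral ((\<lambda>x. x / r$3) ` {0..r$3}) (\<lambda>\<sigma>. \<theta> (pt (r$1) (r$2) (r$3 * \<sigma>)))
        = (1 / \<bar>r$3\<bar>) *\<^sub>R integral {0..r$3} (\<lambda>s. \<theta> (pt (r$1) (r$2) s))"
      by (rule integral_stretch_real) (use z in simp)
    moreover have "(\<lambda>x. x / r$3) ` {0..r$3} = {0..1}"
      using z image_divide_atLeastAtMost[of "r$3" 0 "r$3"] by simp
    ultimately show ?thesis using z by (simp add: T_bar_def)
  qed (simp add: T_bar_def)
  have "continuous_on slab (\<lambda>r. r$3 * integral (cbox 0 1) (\<lambda>\<sigma>. \<theta> (pt (r$1) (r$2) (r$3 * \<sigma>))))"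
  proof (intro continuous_intros integral_continuous_on_param)
    show "continuous_on (slab \<times> cbox 0 1) (\<lambda>(r, \<sigma>). \<theta> (pt (r$1) (r$2) (r$3 * \<sigma>)))"
      unfolding case_prod_beta
      by (rule continuous_on_compose2[OF c])
        (auto intro!: continuous_intros mult_le_one simp: slab_def)
  qed
  then show ?thesis using sub by (simp cong: continuous_on_cong)
qed

text \<open>Vertically this is the fundamental theorem of calculus. Horizontally it is
  differentiation under the integral sign, so horizontal derivatives commute with the vertical
  primitive.\<close>

lemma slab_deriv_T_bar:
  assumes c: "continuous_on slab \<theta>"
  shows "slab_deriv 3 (T_bar \<theta>) \<theta>"
    and "\<lbrakk>slab_deriv 1 \<theta> D; continuous_on slab D\<rbrakk> \<Longrightarrow> slab_deriv 1 (T_bar \<theta>) (T_bar D)"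
    and "\<lbrakk>slab_deriv 2 \<theta> D; continuous_on slab D\<rbrakk> \<Longrightarrow> slab_deriv 2 (T_bar \<theta>) (T_bar D)"
proof -
  show "slab_deriv 3 (T_bar \<theta>) \<theta>"
  proof (rule slab_derivI_z)
    fix x y z :: real assume z: "z \<in> {0..1}"
    show "((\<lambda>z. T_bar \<theta> (pt x y z)) has_vector_derivative \<theta> (pt x y z)) (at z within {0..1})"
      unfolding T_bar_pt by (rule integral_has_vector_derivative[OF continuous_on_column[OF c] z]) auto
  qed
  assume D: "continuous_on slab D"
  { assume d: "slab_deriv 1 \<theta> D"
    show "slab_deriv 1 (T_bar \<theta>) (T_bar D)"
    proof (rule slab_derivI_x)
      fix x y z :: real assume z: "z \<in> {0..1}"
      have "((\<lambda>x. integral (cbox 0 z) (\<lambda>s. \<theta> (pt x y s))) has_vector_derivative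
          integral (cbox 0 z) (\<lambda>s. D (pt x y s))) (at x within UNIV)"
      proof (rule leibniz_rule_vector_derivative)
        show "((\<lambda>x. \<theta> (pt x y s)) has_vector_derivative D (pt x y s)) (at x within UNIV)" if "s \<in> cbox 0 z" for x s
          using slab_deriv_x[OF d, of s] that z by auto
        show "(\<lambda>s. \<theta> (pt x y s)) integrable_on cbox 0 z" for x
          using z by (intro integrable_continuous) (auto intro!: continuous_on_column c)
        show "continuous_on (UNIV \<times> cbox 0 z) (\<lambda>(x, s). D (pt x y s))"
          unfolding case_prod_beta
          by (rule continuous_on_compose2[OF D]) (use z in \<open>auto intro!: continuous_intros\<close>)
      qed auto
      then show "((\<lambda>x. T_bar \<theta> (pt x y z)) has_vector_derivative T_bar D (pt x y z)) (at x)"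
        by (simp add: T_bar_pt)
    qed }
  { assume d: "slab_deriv 2 \<theta> D"
    show "slab_deriv 2 (T_bar \<theta>) (T_bar D)"
    proof (rule slab_derivI_y)
      fix x y z :: real assume z: "z \<in> {0..1}"
      have "((\<lambda>y. integral (cbox 0 z) (\<lambda>s. \<theta> (pt x y s))) has_vector_derivative
          integral (cbox 0 z) (\<lambda>s. D (pt x y s))) (at y within UNIV)"
      proof (rule leibniz_rule_vector_derivative)
        show "((\<lambda>y. \<theta> (pt x y s)) has_vector_derivative D (pt x y s)) (at y within UNIV)" if "s \<in> cbox 0 z" for y s
          using slab_deriv_y[OF d, of s] that z by auto
        show "(\<lambda>s. \<theta> (pt x y s)) integrable_on cbox 0 z" for y
          using z by (intro integrable_continuous) (auto intro!: continuous_on_column c)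
        show "continuous_on (UNIV \<times> cbox 0 z) (\<lambda>(y, s). D (pt x y s))"
          unfolding case_prod_beta
          by (rule continuous_on_compose2[OF D]) (use z in \<open>auto intro!: continuous_intros\<close>)
      qed auto
      then show "((\<lambda>y. T_bar \<theta> (pt x y z)) has_vector_derivative T_bar D (pt x y z)) (at y)"
        by (simp add: T_bar_pt)
    qed }
qed

lemma periodic_T_bar:
  assumes "periodic_xy Lx Ly \<theta>"
  shows "periodic_xy Lx Ly (T_bar \<theta>)"
proof -
  have "\<theta> (pt (x + Lx) y s) = \<theta> (pt x y s)" "\<theta> (pt x (y + Ly) s) = \<theta> (pt x y s)"
    if "s \<in> {0..1}" for x y s
    using assms that unfolding periodic_xy_def by (auto dest!: bspec[of _ _ "pt x y s"])
  then show ?thesis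
    unfolding periodic_xy_def T_bar_def slab_def by (auto simp: axis_def intro!: integral_cong)
qed

section \<open>The energy balance\<close>

text \<open>The argument lists the partial derivatives of the field whose curl is formed.\<close>

definition rot :: "(3 \<Rightarrow> real^3) \<Rightarrow> real^3" where
  "rot G = vector [G 2 $ 3 - G 3 $ 2, G 3 $ 1 - G 1 $ 3, G 1 $ 2 - G 2 $ 1]"

text \<open>A solution frozen at one instant, with derivatives as named fields and every equation
  valid up to the walls. \<open>B\<^sub>t\<close> is the time derivative; in \<open>ddB i j\<close>
  the derivative along i is taken first. In \<open>induction\<close> the product rule inside curl (u
  x B) is already carried out.\<close>

locale taylor_instant =
  fixes Lx Ly \<Lambda> Ra Rm :: real
    and u B B\<^sub>t :: "real^3 \<Rightarrow> real^3" and P \<theta> :: "real^3 \<Rightarrow> real"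
    and du dB :: "3 \<Rightarrow> real^3 \<Rightarrow> real^3" and ddB :: "3 \<Rightarrow> 3 \<Rightarrow> real^3 \<Rightarrow> real^3"
    and dP d\<theta> :: "3 \<Rightarrow> real^3 \<Rightarrow> real" and dd\<theta> :: "3 \<Rightarrow> 3 \<Rightarrow> real^3 \<Rightarrow> real"
  assumes pos: "Lx > 0" "Ly > 0" "\<Lambda> > 0" "Ra > 0" "Rm > 0"
    and deriv: "\<And>i. slab_deriv i u (du i)" "\<And>i. slab_deriv i B (dB i)" "\<And>i j. slab_deriv j (dB i) (ddB i j)"
      "\<And>i. slab_deriv i P (dP i)" "\<And>i. slab_deriv i \<theta> (d\<theta> i)" "\<And>i j. slab_deriv j (d\<theta> i) (dd\<theta> i j)"
    and cont: "continuous_on slab u" "continuous_on slab B" "continuous_on slab P" "continuous_on slab \<theta>"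
      "continuous_on slab B\<^sub>t"
      "\<And>i. continuous_on slab (du i)" "\<And>i. continuous_on slab (dB i)" "\<And>i j. continuous_on slab (ddB i j)"
      "\<And>i. continuous_on slab (dP i)" "\<And>i. continuous_on slab (d\<theta> i)" "\<And>i j. continuous_on slab (dd\<theta> i j)"
    and periodic: "periodic_xy Lx Ly u" "periodic_xy Lx Ly B" "periodic_xy Lx Ly P" "periodic_xy Lx Ly \<theta>"
    and momentum: "\<And>r. r \<in> slab \<Longrightarrow> cross3 e_z (u r) + (\<chi> i. dP i r)
      = \<Lambda> *\<^sub>R cross3 (rot (\<lambda>i. dB i r)) (B r) + (Ra * \<theta> r) *\<^sub>R e_z"
    and div_u: "\<And>r. r \<in> slab \<Longrightarrow> (\<Sum>i\<in>UNIV. du i r $ i) = 0"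
    and div_B: "\<And>r. r \<in> slab \<Longrightarrow> (\<Sum>i\<in>UNIV. dB i r $ i) = 0"
    and induction: "\<And>r. r \<in> slab \<Longrightarrow> B\<^sub>t r
      = rot (\<lambda>i. cross3 (du i r) (B r) + cross3 (u r) (dB i r)) + (1 / Rm) *\<^sub>R (\<Sum>i\<in>UNIV. ddB i i r)"
    and wall: "\<And>r. r$3 = 0 \<or> r$3 = 1 \<Longrightarrow> u r $ 3 = 0" "\<And>r. r$3 = 0 \<or> r$3 = 1 \<Longrightarrow> B r $ 1 = 0"
      "\<And>r. r$3 = 0 \<or> r$3 = 1 \<Longrightarrow> B r $ 2 = 0"
    and flux: "integral_xy Lx Ly 0 (\<lambda>r. B r $ 3) = 0" "integral_xy Lx Ly 1 (\<lambda>r. B r $ 3) = 0"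
begin

abbreviation "Tb \<equiv> T_bar \<theta>"
abbreviation "dT i \<equiv> T_bar (d\<theta> i)"
abbreviation "ddT i j \<equiv> T_bar (dd\<theta> i j)"

text \<open>Coincides with \<open>archimedean\<close> on the slab, but is built from
  \<open>dT\<close> rather than \<open>pd\<close>, so its regularity follows from that of the
  vertical primitives.\<close>

definition uA :: "real^3 \<Rightarrow> real^3" where
  "uA r = vector [- Ra * dT 2 r, Ra * dT 1 r, 0]"

text \<open>For i = 1, 2 this is the derivative of \<open>uA\<close> along i. For i = 3 it generally
  is not: integrating a vertical derivative from the bottom subtracts the value at z = 0.\<close>

definition duA :: "3 \<Rightarrow> real^3 \<Rightarrow> real^3" where
  "duA i r = vector [- Ra * ddT 2 i r, Ra * ddT 1 i r, 0]"

lemma slab_deriv_dT: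
  "slab_deriv 1 (dT j) (ddT j 1)" "slab_deriv 2 (dT j) (ddT j 2)"
  using slab_deriv_T_bar(2,3)[OF cont(10) deriv(6) cont(11)] by simp_all

lemma slab_deriv_Tb: "slab_deriv 1 Tb (dT 1)" "slab_deriv 2 Tb (dT 2)" "slab_deriv 3 Tb \<theta>"
  using slab_deriv_T_bar(1)[OF cont(4)] slab_deriv_T_bar(2,3)[OF cont(4) deriv(5) cont(10)] by simp_all

lemma continuous_T: "continuous_on slab Tb" "continuous_on slab (dT i)" "continuous_on slab (ddT i j)"
  using continuous_on_T_bar[OF cont(4)] continuous_on_T_bar[OF cont(10)] continuous_on_T_bar[OF cont(11)]
  by simp_all

lemma slab_deriv_uA: "slab_deriv 1 uA (duA 1)" "slab_deriv 2 uA (duA 2)"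
proof -
  have *: "slab_deriv i uA (duA i)" if "\<And>j. slab_deriv i (dT j) (ddT j i)" for i
  proof -
    have "slab_deriv i (\<lambda>r. dT 2 r *\<^sub>R (- Ra *\<^sub>R axis 1 1) + dT 1 r *\<^sub>R (Ra *\<^sub>R axis 2 1))
      (\<lambda>r. ddT 2 i r *\<^sub>R (- Ra *\<^sub>R axis 1 1) + ddT 1 i r *\<^sub>R (Ra *\<^sub>R axis 2 (1::real)) :: real^3)"
      by (intro slab_deriv_add slab_deriv_linear[OF bounded_linear_scaleR_left] that)
    then show ?thesis
      by (rule slab_deriv_cong) (simp_all add: uA_def duA_def vec_eq_iff forall_3 axis_def)
  qed
  show "slab_deriv 1 uA (duA 1)" "slab_deriv 2 uA (duA 2)"
    using * slab_deriv_dT by blast+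
qed

lemma continuous_uA: "continuous_on slab uA" "continuous_on slab (duA i)"
  unfolding uA_def duA_def by (intro continuous_intros continuous_T)+

lemma periodic_Tb: "periodic_xy Lx Ly Tb"
  by (rule periodic_T_bar[OF periodic(4)])

lemma periodic_dT: "periodic_xy Lx Ly (dT 1)" "periodic_xy Lx Ly (dT 2)"
  using slab_deriv_periodic[OF slab_deriv_Tb(1) periodic_Tb] slab_deriv_periodic[OF slab_deriv_Tb(2) periodic_Tb]
  by simp_all

lemma periodic_uA: "periodic_xy Lx Ly uA"
  using periodic_dT by (simp add: periodic_xy_def uA_def)

lemma div_uA: "r \<in> slab \<Longrightarrow> duA 1 r $ 1 + duA 2 r $ 2 = 0"
  using slab_deriv_mixed[OF slab_deriv_Tb(1,2) slab_deriv_dT(1) slab_deriv_dT(2) continuous_T(2,3), of r]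
  by (simp add: duA_def)

text \<open>The sum is (B . grad) B, so \<open>Q\<close> is the part of the Lorentz work of
  \<open>uA\<close> that survives once the magnetic pressure is split off as a divergence.\<close>

definition Q :: "real^3 \<Rightarrow> real" where
  "Q r = - (uA r \<bullet> (\<Sum>i\<in>UNIV. B r $ i *\<^sub>R dB i r))"

text \<open>The divergences left over in the energy balance, multiplied by \<open>\<Lambda>\<close>: in order, they come from
  \<open>B \<bullet> curl (u \<times> B)\<close>, from \<open>u \<bullet> \<nabla>P\<close>, from the buoyancy work \<open>T u\<^sub>z\<close>, from \<open>u\<^sub>A \<bullet> \<nabla>P\<close>, from the magnetic
  pressure in \<open>u\<^sub>A \<bullet> (curl B \<times> B)\<close>, and from the diffusion term.\<close>

definition flux_field :: "3 \<Rightarrow> real^3 \<Rightarrow> real" where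
  "flux_field i r = \<Lambda> * (B r $ i * (u r \<bullet> B r) - u r $ i * (B r \<bullet> B r)) - u r $ i * P r
     + Ra * (u r $ i * Tb r) + uA r $ i * P r + \<Lambda> / 2 * (uA r $ i * (B r \<bullet> B r))
     + \<Lambda> / Rm * (B r \<bullet> dB i r)"

text \<open>Literally the product rule applied to \<open>flux_field\<close> term by term. The
  branches for i = 3 record that the vertical derivative of \<open>Tb\<close> is the temperature and
  that \<open>uA\<close> has no vertical component.\<close>

definition flux_div :: "3 \<Rightarrow> real^3 \<Rightarrow> real" where
  "flux_div i r = \<Lambda> * ((dB i r $ i * (u r \<bullet> B r) + B r $ i * (du i r \<bullet> B r + u r \<bullet> dB i r))
       - (du i r $ i * (B r \<bullet> B r) + u r $ i * (dB i r \<bullet> B r + B r \<bullet> dB i r)))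
     - (du i r $ i * P r + u r $ i * dP i r)
     + Ra * (du i r $ i * Tb r + u r $ i * (if i = 3 then \<theta> r else dT i r))
     + ((if i = 3 then 0 else duA i r $ i) * P r + uA r $ i * dP i r)
     + \<Lambda> / 2 * ((if i = 3 then 0 else duA i r $ i) * (B r \<bullet> B r) + uA r $ i * (dB i r \<bullet> B r + B r \<bullet> dB i r))
     + \<Lambda> / Rm * (dB i r \<bullet> dB i r + B r \<bullet> ddB i i r)"

lemma slab_deriv_flux: "slab_deriv i (flux_field i) (flux_div i)"
proof -
  have T: "slab_deriv i Tb (\<lambda>r. if i = 3 then \<theta> r else dT i r)"
    using exhaust_3[of i] slab_deriv_Tb by auto
  have A: "slab_deriv i (\<lambda>r. uA r $ i) (\<lambda>r. if i = 3 then 0 else duA i r $ i)"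
  proof (cases "i = 3")
    case True
    then show ?thesis by (simp add: uA_def slab_deriv_def)
  next
    case False
    then show ?thesis using exhaust_3[of i] slab_deriv_uA slab_deriv_nth by fastforce
  qed
  note cmult = slab_deriv_linear[OF bounded_linear_mult_right]
  note inner = slab_deriv_bilinear[OF bounded_bilinear_inner]
  show ?thesis
    unfolding flux_field_def flux_div_def
    by (intro slab_deriv_add slab_deriv_diff cmult slab_deriv_mult inner slab_deriv_nth T A deriv)
qed

lemma continuous_flux_div: "continuous_on slab (flux_div i)"
proof -
  have T: "continuous_on slab (\<lambda>r. if i = 3 then \<theta> r else dT i r)"
    by (cases "i = 3") (simp_all add: cont continuous_T)
  have A: "continuous_on slab (\<lambda>r. if i = 3 then 0 else duA i r $ i)"
    by (cases "i = 3") (simp_all add: continuous_on_component continuous_uA)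
  show ?thesis
    unfolding flux_div_def
    by (intro continuous_on_add continuous_on_diff continuous_on_mult continuous_on_const continuous_on_inner
        continuous_on_component T A cont continuous_T continuous_uA)
qed

lemma periodic_flux: "i \<noteq> 3 \<Longrightarrow> periodic_xy Lx Ly (flux_field i)"
  using periodic periodic_Tb periodic_uA slab_deriv_periodic[OF deriv(2) periodic(2), of i]
  by (simp add: periodic_xy_def flux_field_def)

text \<open>On the walls \<open>B\<close> is vertical, so \<open>\<nabla> \<cdot> B = 0\<close> leaves no vertical derivative of \<open>B\<^sub>z\<close>.\<close>

lemma flux_wall:
  assumes r: "r$3 = 0 \<or> r$3 = 1"
  shows "flux_field 3 r = 0"
proof -
  have s: "r \<in> slab" using r by (auto simp: slab_def)
  have d: "slab_deriv i (\<lambda>q. B q $ j) (\<lambda>q. dB i q $ j)" for i j by (rule slab_deriv_nth[OF deriv(2)])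
  have "pd 1 (\<lambda>q. B q $ 1) r = 0" "pd 2 (\<lambda>q. B q $ 2) r = 0"
    using wall r by (simp_all add: pd_def)
  then have "dB 1 r $ 1 = 0" "dB 2 r $ 2 = 0"
    using pd_eq[OF d s] by simp_all
  then have "dB 3 r $ 3 = 0" using div_B[OF s] by (simp add: sum_3)
  then show ?thesis
    using wall[OF r] by (simp add: flux_field_def uA_def inner_vec_def sum_3)
qed

text \<open>A polynomial identity, once the momentum equation eliminates the pressure gradient and
  the divergence conditions eliminate one diagonal derivative each of u, B and \<open>uA\<close>.
  The factor \<Lambda> on the left matches the Lorentz force as it stands in the momentum
  equation.\<close>

lemma energy_density:
  assumes r: "r \<in> slab"
  shows "\<Lambda> * (B r \<bullet> B\<^sub>t r) = \<Lambda> * (Q r - (1 / Rm) * (\<Sum>i\<in>UNIV. (norm (dB i r))\<^sup>2)) + (\<Sum>i\<in>UNIV. flux_div i r)"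
proof -
  obtain u1 u2 u3 B1 B2 B3 where v: "u r = vector [u1, u2, u3]" "B r = vector [B1, B2, B3]"
    by (metis pt_components)
  obtain u11 u12 u13 u21 u22 u23 u31 u32 u33 where du:
    "du 1 r = vector [u11, u12, u13]" "du 2 r = vector [u21, u22, u23]" "du 3 r = vector [u31, u32, u33]"
    by (metis pt_components)
  obtain b11 b12 b13 b21 b22 b23 b31 b32 b33 where dB:
    "dB 1 r = vector [b11, b12, b13]" "dB 2 r = vector [b21, b22, b23]" "dB 3 r = vector [b31, b32, b33]"
    by (metis pt_components)
  have m: "dP 1 r = \<Lambda> * ((b31 - b13) * B3 - (b12 - b21) * B2) + u2"
    "dP 2 r = \<Lambda> * ((b12 - b21) * B1 - (b23 - b32) * B3) - u1"
    "dP 3 r = \<Lambda> * ((b23 - b32) * B2 - (b31 - b13) * B1) + Ra * \<theta> r"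
    using momentum[OF r] by (simp_all add: vec_eq_iff forall_3 cross3_def rot_def v dB axis_def)
  have d: "u11 = - u22 - u33" "b11 = - b22 - b33"
    using div_u[OF r] div_B[OF r] by (simp_all add: sum_3 du dB)
  have a: "duA 1 r $ 1 = - duA 2 r $ 2" using div_uA[OF r] by simp
  have uA: "uA r $ 1 = - Ra * dT 2 r" "uA r $ 2 = Ra * dT 1 r" "uA r $ 3 = 0"
    by (simp_all add: uA_def)
  have ind: "B r \<bullet> B\<^sub>t r = B1 * ((cross3 (du 2 r) (B r) + cross3 (u r) (dB 2 r)) $ 3 - (cross3 (du 3 r) (B r) + cross3 (u r) (dB 3 r)) $ 2)
    + B2 * ((cross3 (du 3 r) (B r) + cross3 (u r) (dB 3 r)) $ 1 - (cross3 (du 1 r) (B r) + cross3 (u r) (dB 1 r)) $ 3)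
    + B3 * ((cross3 (du 1 r) (B r) + cross3 (u r) (dB 1 r)) $ 2 - (cross3 (du 2 r) (B r) + cross3 (u r) (dB 2 r)) $ 1)
    + (1 / Rm) * (B r \<bullet> ddB 1 1 r + B r \<bullet> ddB 2 2 r + B r \<bullet> ddB 3 3 r)"
    unfolding induction[OF r] by (simp add: inner_vec_def sum_3 rot_def v algebra_simps)
  have n: "(\<Sum>i\<in>UNIV. (norm (dB i r))\<^sup>2) = dB 1 r \<bullet> dB 1 r + dB 2 r \<bullet> dB 2 r + dB 3 r \<bullet> dB 3 r"
    by (simp add: sum_3 power2_norm_eq_inner)
  \<comment> \<open>Diffusion is separated first: X + Y is the divergence of the terms B . dB, and Y
    is the dissipation. The componentwise expansion in \<open>main\<close> is thus free of second
    derivatives of B.\<close>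
  define X where "X = B r \<bullet> ddB 1 1 r + B r \<bullet> ddB 2 2 r + B r \<bullet> ddB 3 3 r"
  define Y where "Y = dB 1 r \<bullet> dB 1 r + dB 2 r \<bullet> dB 2 r + dB 3 r \<bullet> dB 3 r"
  define F where "F i = flux_div i r - \<Lambda> / Rm * (dB i r \<bullet> dB i r + B r \<bullet> ddB i i r)" for i
  have F: "(\<Sum>i\<in>UNIV. flux_div i r) = F 1 + F 2 + F 3 + \<Lambda> / Rm * (X + Y)"
    by (simp add: F_def sum_3 X_def Y_def algebra_simps)
  define C where "C = B r \<bullet> B\<^sub>t r - (1 / Rm) * X"
  have main: "\<Lambda> * C = \<Lambda> * Q r + (F 1 + F 2 + F 3)"
    unfolding C_def ind X_def[symmetric] Q_def F_def flux_div_def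
    by (simp add: inner_vec_def sum_3 cross3_def v du dB m d a uA) (simp add: algebra_simps add_divide_distrib diff_divide_distrib)
  have "B r \<bullet> B\<^sub>t r = C + (1 / Rm) * X" by (simp add: C_def)
  then show ?thesis
    unfolding n Y_def[symmetric] F using main by (simp add: algebra_simps add_divide_distrib)
qed

lemma continuous_Q: "continuous_on slab Q"
  unfolding Q_def by (intro continuous_intros cont continuous_uA)

lemma energy_rate:
  "integral (cell Lx Ly) (\<lambda>r. B r \<bullet> B\<^sub>t r)
    = integral (cell Lx Ly) Q - (1 / Rm) * integral (cell Lx Ly) (\<lambda>r. \<Sum>i\<in>UNIV. (norm (dB i r))\<^sup>2)"
proof -
  let ?D = "\<lambda>r. \<Sum>i\<in>UNIV. (norm (dB i r))\<^sup>2" and ?F = "\<lambda>r. \<Sum>i\<in>UNIV. flux_div i r"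
  let ?I = "integral (cell Lx Ly)"
  have i: "Q integrable_on cell Lx Ly" "?D integrable_on cell Lx Ly" "?F integrable_on cell Lx Ly"
    by (intro integrable_cell continuous_intros continuous_Q cont continuous_flux_div)+
  have "?I ?F = 0"
    by (rule integral_divergence_eq_0[OF slab_deriv_flux continuous_flux_div _ _ flux_wall])
      (auto intro: periodic_flux pos)
  moreover have "\<Lambda> * ?I (\<lambda>r. B r \<bullet> B\<^sub>t r) = ?I (\<lambda>r. \<Lambda> * (Q r - (1 / Rm) * ?D r) + ?F r)"
    unfolding integral_mult_right[symmetric]
    by (rule integral_cong) (use energy_density cell_subset_slab in blast)
  moreover have "((\<lambda>r. \<Lambda> * (Q r - (1 / Rm) * ?D r) + ?F r) has_integral
      \<Lambda> * (?I Q - (1 / Rm) * ?I ?D) + ?I ?F) (cell Lx Ly)"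
    by (intro has_integral_add has_integral_mult_right has_integral_diff integrable_integral i)
  ultimately have "\<Lambda> * ?I (\<lambda>r. B r \<bullet> B\<^sub>t r) = \<Lambda> * (?I Q - (1 / Rm) * ?I ?D)"
    by (simp add: integral_unique)
  then show ?thesis using pos by simp
qed

end

section \<open>The bound on the Archimedean flow\<close>

text \<open>Cauchy-Schwarz over the index, used for |(w . grad) B| \<le> |w| |grad B|.\<close>

lemma norm_sum_scaleR_le:
  fixes w :: "real^3" and g :: "3 \<Rightarrow> 'a::real_normed_vector"
  shows "norm (\<Sum>i\<in>UNIV. w $ i *\<^sub>R g i) \<le> norm w * sqrt (\<Sum>i\<in>UNIV. (norm (g i))\<^sup>2)"
proof -
  have "norm (\<Sum>i\<in>UNIV. w $ i *\<^sub>R g i) \<le> (\<Sum>i\<in>UNIV. \<bar>w $ i\<bar> * \<bar>norm (g i)\<bar>)"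
    by (rule order_trans[OF norm_sum]) simp
  also have "\<dots> \<le> L2_set (\<lambda>i. w $ i) UNIV * L2_set (\<lambda>i. norm (g i)) UNIV"
    by (rule L2_set_mult_ineq)
  finally show ?thesis by (simp add: norm_vec_def L2_set_def)
qed

context taylor_instant
begin

definition N :: real where
  "N = norm_Linf_L2 Lx Ly (grad_xy (archimedean Ra \<theta>))"

definition L :: real where "L = max Lx Ly"

definition \<rho> :: real where "\<rho> = max (Lx / Ly) (Ly / Lx)"

definition dB_norm :: "real^3 \<Rightarrow> real" where
  "dB_norm r = sqrt (\<Sum>i\<in>UNIV. (norm (dB i r))\<^sup>2)"

abbreviation D :: real where
  "D \<equiv> integral (cell Lx Ly) (\<lambda>r. \<Sum>i\<in>UNIV. (norm (dB i r))\<^sup>2)"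

text \<open>Includes the vertical derivative as well: the horizontal ones serve the slice
  inequalities, the vertical one bounds the derivative of the mean \<open>Bm\<close>.\<close>

definition S2 :: "real \<Rightarrow> real" where
  "S2 z = rect_integral Lx Ly (\<lambda>x y. \<Sum>i\<in>UNIV. (norm (dB i (pt x y z)))\<^sup>2)"

definition Bm :: "real \<Rightarrow> real^3" where
  "Bm z = (1 / (Lx * Ly)) *\<^sub>R rect_integral Lx Ly (\<lambda>x y. B (pt x y z))"

lemma grad_xy_archimedean:
  assumes r: "r \<in> slab"
  shows "grad_xy (archimedean Ra \<theta>) r = (duA 1 r, duA 2 r)"
proof -
  have "archimedean Ra \<theta> r = uA r" if "r \<in> slab" for r
    using pd_eq[OF slab_deriv_Tb(1) that] pd_eq[OF slab_deriv_Tb(2) that]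
    by (simp add: archimedean_def uA_def vec_eq_iff forall_3)
  then have d: "slab_deriv 1 (archimedean Ra \<theta>) (duA 1)" "slab_deriv 2 (archimedean Ra \<theta>) (duA 2)"
    using slab_deriv_cong[OF slab_deriv_uA(1)] slab_deriv_cong[OF slab_deriv_uA(2)] by simp_all
  show ?thesis using pd_eq[OF d(1) r] pd_eq[OF d(2) r] by (simp add: grad_xy_def)
qed

lemma grad_uA_le:
  assumes z: "z \<in> {0..1}"
  shows "sqrt (rect_integral Lx Ly (\<lambda>x y. (norm (duA 1 (pt x y z)))\<^sup>2 + (norm (duA 2 (pt x y z)))\<^sup>2)) \<le> N"
proof -
  let ?g = "\<lambda>z. sqrt (rect_integral Lx Ly (\<lambda>x y. (norm (duA 1 (pt x y z)))\<^sup>2 + (norm (duA 2 (pt x y z)))\<^sup>2))"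
  have eq: "sqrt (integral_xy Lx Ly z (\<lambda>r. (norm (grad_xy (archimedean Ra \<theta>) r))\<^sup>2)) = ?g z" if "z \<in> {0..1}" for z
    using that by (simp add: integral_xy_eq_rect grad_xy_archimedean norm_Pair)
  \<comment> \<open>Continuity on a compact interval gives boundedness, without which the real
    supremum need not be an upper bound.\<close>
  have "continuous_on {0..1} ?g"
    by (intro continuous_intros continuous_on_integral_xy continuous_uA)
  then have "bdd_above (?g ` {0..1})"
    by (intro compact_imp_bounded[THEN bounded_imp_bdd_above] compact_continuous_image) auto
  then have "?g z \<le> (SUP z\<in>{0..1}. ?g z)" using z by (rule cSUP_upper[rotated])
  also have "\<dots> = N" unfolding N_def norm_Linf_L2_def using eq by (intro SUP_cong) simp_all
  finally show ?thesis .
qed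

lemma N_nonneg: "N \<ge> 0"
proof -
  have "0 \<le> sqrt (rect_integral Lx Ly (\<lambda>x y. (norm (duA 1 (pt x y 0)))\<^sup>2 + (norm (duA 2 (pt x y 0)))\<^sup>2))"
    by (intro real_sqrt_ge_zero rect_integral_nonneg continuous_intros cont2_slice continuous_uA) auto
  also have "\<dots> \<le> N" by (rule grad_uA_le) simp
  finally show ?thesis .
qed

lemma slice_uA: "z \<in> {0..1} \<Longrightarrow>
    periodic_C1 Lx Ly (\<lambda>x y. uA (pt x y z)) (\<lambda>x y. duA 1 (pt x y z)) (\<lambda>x y. duA 2 (pt x y z))"
  using periodic_C1_slice[OF slab_deriv_uA continuous_uA(1,2,2) periodic_uA _ pos(1,2), of z 0] by simp

lemma slice_B: "z \<in> {0..1} \<Longrightarrow>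
    periodic_C1 Lx Ly (\<lambda>x y. B (pt x y z) - Bm z) (\<lambda>x y. dB 1 (pt x y z)) (\<lambda>x y. dB 2 (pt x y z))"
  by (rule periodic_C1_slice[OF deriv(2,2) cont(2,7,7) periodic(2) _ pos(1,2)])

text \<open>The components are horizontal derivatives of the periodic function \<open>Tb\<close>.
  The zero mean opens the slice Poincare and L^4 inequalities to \<open>uA\<close>.\<close>

lemma mean_uA:
  assumes z: "z \<in> {0..1}"
  shows "rect_integral Lx Ly (\<lambda>x y. uA (pt x y z)) = 0"
proof -
  have c: "cont2 (\<lambda>x y. uA (pt x y z))" by (rule cont2_slice[OF continuous_uA(1) z])
  have "rect_integral Lx Ly (\<lambda>x y. dT 1 (pt x y z)) = 0" "rect_integral Lx Ly (\<lambda>x y. dT 2 (pt x y z)) = 0"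
    using rect_integral_deriv_x[OF slab_deriv_Tb(1) continuous_T(2) periodic_Tb z pos(1)]
      rect_integral_deriv_y[OF slab_deriv_Tb(2) continuous_T(2) periodic_Tb z pos(2)] by simp_all
  then have "rect_integral Lx Ly (\<lambda>x y. uA (pt x y z)) \<bullet> axis i 1 = 0" for i
    unfolding rect_integral_component[OF c]
    using exhaust_3[of i] rect_integral_cmult[of Lx Ly "- Ra"] rect_integral_cmult[of Lx Ly Ra]
      rect_integral_const[OF pos(1,2), of "0::real"]
    by (auto simp: uA_def inner_axis)
  then show ?thesis by (simp add: vec_eq_iff inner_axis)
qed

lemma mean_B:
  assumes z: "z \<in> {0..1}"
  shows "rect_integral Lx Ly (\<lambda>x y. B (pt x y z) - Bm z) = 0"
  using pos by (simp add: rect_integral_diff rect_integral_const cont2_slice[OF cont(2) z] Bm_def)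

lemma continuous_Bm: "continuous_on {0..1} Bm"
  unfolding Bm_def by (intro continuous_intros continuous_on_integral_xy cont)

lemma continuous_S2: "continuous_on {0..1} S2"
  unfolding S2_def by (intro continuous_on_integral_xy continuous_intros cont)

lemma S2_nonneg: "z \<in> {0..1} \<Longrightarrow> S2 z \<ge> 0"
  unfolding S2_def
  by (intro rect_integral_nonneg continuous_intros cont2_slice cont sum_nonneg) auto

lemma D_eq: "D = integral {0..1} S2"
  unfolding S2_def
  by (subst cell_integral_slices) (auto intro!: continuous_intros cont pos simp: integral_xy_eq_rect)

lemma D_nonneg: "D \<ge> 0"
  unfolding D_eq
  by (intro integral_nonneg integrable_continuous_interval continuous_S2) (use S2_nonneg in auto)

lemma grad_energy_B_le:
  assumes z: "z \<in> {0..1}"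
  shows "periodic_C1.grad_energy Lx Ly (\<lambda>x y. dB 1 (pt x y z)) (\<lambda>x y. dB 2 (pt x y z)) \<le> S2 z"
  unfolding periodic_C1.grad_energy_def[OF slice_B[OF z]] S2_def
  by (intro rect_integral_mono continuous_intros cont2_slice cont z) (simp add: sum_3)

text \<open>The factor 1/6 is the Dirichlet Poincare constant of the unit interval, and 1 / (Lx Ly)
  comes from Cauchy-Schwarz over a slice, applied to the derivative of the mean.\<close>

lemma integral_Bm_le: "integral {0..1} (\<lambda>z. (norm (Bm z))\<^sup>2) \<le> D / (6 * (Lx * Ly))"
proof -
  define Bm' where "Bm' z = (1 / (Lx * Ly)) *\<^sub>R rect_integral Lx Ly (\<lambda>x y. dB 3 (pt x y z))" for z
  have c': "continuous_on {0..1} Bm'"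
    unfolding Bm'_def by (intro continuous_intros continuous_on_integral_xy cont)
  have d: "(Bm has_vector_derivative Bm' z) (at z within {0..1})" if z: "z \<in> {0..1}" for z
  proof -
    have "((\<lambda>z. integral (cbox (0, 0) (Lx, Ly)) (\<lambda>p. B (pt (fst p) (snd p) z))) has_vector_derivative
        integral (cbox (0, 0) (Lx, Ly)) (\<lambda>p. dB 3 (pt (fst p) (snd p) z))) (at z within {0..1})"
    proof (rule leibniz_rule_vector_derivative)
      show "((\<lambda>z. B (pt (fst p) (snd p) z)) has_vector_derivative dB 3 (pt (fst p) (snd p) z)) (at z within {0..1})"
        if "z \<in> {0..1}" for z p
        by (rule slab_deriv_z[OF deriv(2) that])
      show "(\<lambda>p. B (pt (fst p) (snd p) z)) integrable_on cbox (0, 0) (Lx, Ly)" if "z \<in> {0..1}" for z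
        by (rule cont2_integrable[OF cont2_slice[OF cont(2) that]])
      show "continuous_on ({0..1} \<times> cbox (0, 0) (Lx, Ly)) (\<lambda>(z, p). dB 3 (pt (fst p) (snd p) z))"
        unfolding case_prod_beta
        by (rule continuous_on_compose2[OF cont(7)]) (auto intro!: continuous_intros)
    qed (use z in auto)
    then show ?thesis
      unfolding Bm_def Bm'_def rect_integral_cbox
      by (rule bounded_linear.has_vector_derivative[OF bounded_linear_scaleR_right])
  qed
  have end0: "Bm z = 0" if z: "z = 0 \<or> z = 1" for z
  proof -
    have z': "z \<in> {0..1}" using z by auto
    have c: "cont2 (\<lambda>x y. B (pt x y z))" by (rule cont2_slice[OF cont(2) z'])
    have "rect_integral Lx Ly (\<lambda>x y. B (pt x y z) $ 3) = 0"
      using flux z by (auto simp: integral_xy_eq_rect)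
    moreover have "B (pt x y z) $ 1 = 0" "B (pt x y z) $ 2 = 0" for x y using wall z by auto
    ultimately have "rect_integral Lx Ly (\<lambda>x y. B (pt x y z)) \<bullet> axis i 1 = 0" for i
      unfolding rect_integral_component[OF c]
      using exhaust_3[of i] rect_integral_const[OF pos(1,2), of "0::real"] by (auto simp: inner_axis)
    then have "rect_integral Lx Ly (\<lambda>x y. B (pt x y z)) = 0" by (simp add: vec_eq_iff inner_axis)
    then show ?thesis by (simp add: Bm_def)
  qed
  have "(norm (Bm' z))\<^sup>2 \<le> (1 / (Lx * Ly)) * S2 z" if z: "z \<in> {0..1}" for z
  proof -
    have "(norm (Bm' z))\<^sup>2 = (1 / (Lx * Ly))\<^sup>2 * (norm (rect_integral Lx Ly (\<lambda>x y. dB 3 (pt x y z))))\<^sup>2"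
      using pos by (simp add: Bm'_def power_mult_distrib power_divide)
    also have "\<dots> \<le> (1 / (Lx * Ly))\<^sup>2 * (Lx * Ly * rect_integral Lx Ly (\<lambda>x y. (norm (dB 3 (pt x y z)))\<^sup>2))"
      by (intro mult_left_mono norm_rect_integral_square_le cont2_slice cont pos z) simp
    also have "\<dots> = (1 / (Lx * Ly)) * rect_integral Lx Ly (\<lambda>x y. (norm (dB 3 (pt x y z)))\<^sup>2)"
      using pos by (simp add: power2_eq_square)
    also have "\<dots> \<le> (1 / (Lx * Ly)) * S2 z"
      unfolding S2_def using pos
      by (intro mult_left_mono rect_integral_mono continuous_intros cont2_slice cont z) (auto simp: sum_3)
    finally show ?thesis .
  qed
  then have "integral {0..1} (\<lambda>z. (norm (Bm' z))\<^sup>2) \<le> integral {0..1} (\<lambda>z. (1 / (Lx * Ly)) * S2 z)"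
    by (intro integral_le integrable_continuous_interval continuous_intros c' continuous_S2)
  moreover have "integral {0..1} (\<lambda>z. (norm (Bm z))\<^sup>2) \<le> (1 - 0)\<^sup>2 / 6 * integral {0..1} (\<lambda>z. (norm (Bm' z))\<^sup>2)"
    by (rule poincare_dirichlet[OF _ d c']) (auto simp: end0)
  ultimately show ?thesis by (simp add: D_eq)
qed

text \<open>The part of zero mean is handled by Holder with exponents 4, 4, 2. The mean is constant
  on the slice and can be pulled out, leaving a product of two L^2 norms.\<close>

lemma rect_integral_Q_le:
  assumes z: "z \<in> {0..1}"
  shows "rect_integral Lx Ly (\<lambda>x y. Q (pt x y z))
    \<le> N * (3 / 16 * sqrt \<rho> * L) * S2 z + N * (L / sqrt 24) * (norm (Bm z) * sqrt (S2 z))"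
proof -
  let ?I = "rect_integral Lx Ly"
  define a where "a x y = norm (uA (pt x y z))" for x y
  define b where "b x y = norm (B (pt x y z) - Bm z)" for x y
  define s where "s x y = dB_norm (pt x y z)" for x y
  define K where "K = 3 / 16 * sqrt \<rho> * L"
  interpret A: periodic_C1 Lx Ly "\<lambda>x y. uA (pt x y z)" "\<lambda>x y. duA 1 (pt x y z)" "\<lambda>x y. duA 2 (pt x y z)"
    by (rule slice_uA[OF z])
  interpret B: periodic_C1 Lx Ly "\<lambda>x y. B (pt x y z) - Bm z" "\<lambda>x y. dB 1 (pt x y z)" "\<lambda>x y. dB 2 (pt x y z)"
    by (rule slice_B[OF z])
  have L0: "L > 0" using pos by (simp add: L_def)
  have \<rho>0: "\<rho> > 0" using pos by (simp add: \<rho>_def less_max_iff_disj)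
  have K: "K \<ge> 0" using L0 \<rho>0 by (simp add: K_def)
  have c: "cont2 a" "cont2 b" "cont2 s" "cont2 (\<lambda>x y. Q (pt x y z))"
    unfolding a_def b_def s_def dB_norm_def
    by (intro continuous_intros A.cv B.cv cont2_slice cont continuous_Q z)+
  have gA: "A.grad_energy \<ge> 0" "A.grad_energy \<le> N\<^sup>2"
  proof -
    show 0: "A.grad_energy \<ge> 0"
      unfolding A.grad_energy_def by (intro rect_integral_nonneg continuous_intros A.cvx A.cvy) simp
    have "sqrt A.grad_energy \<le> N" using grad_uA_le[OF z] by (simp add: A.grad_energy_def)
    then show "A.grad_energy \<le> N\<^sup>2" using 0 by (metis real_sqrt_le_iff real_le_lsqrt real_sqrt_ge_zero sqrt_le_D)
  qed
  have gB: "B.grad_energy \<le> S2 z" by (rule grad_energy_B_le[OF z])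
  have s2: "?I (\<lambda>x y. (s x y)\<^sup>2) = S2 z"
    by (simp add: s_def dB_norm_def S2_def sum_nonneg)
  have a2: "sqrt (?I (\<lambda>x y. (a x y)\<^sup>2)) \<le> L / sqrt 24 * N"
  proof (rule real_le_lsqrt)
    have "?I (\<lambda>x y. (a x y)\<^sup>2) \<le> L\<^sup>2 / 24 * A.grad_energy"
      unfolding a_def L_def by (rule A.poincare_rect[OF mean_uA[OF z]])
    also have "\<dots> \<le> L\<^sup>2 / 24 * N\<^sup>2" using gA by (intro mult_left_mono) auto
    finally show "?I (\<lambda>x y. (a x y)\<^sup>2) \<le> (L / sqrt 24 * N)\<^sup>2" by (simp add: power_mult_distrib power_divide)
  qed (use L0 N_nonneg in auto)
  have a4: "sqrt (?I (\<lambda>x y. (a x y)^4)) \<le> K * N\<^sup>2"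
    by (rule order_trans[OF _ mult_left_mono[OF gA(2) K]])
      (unfold a_def K_def L_def \<rho>_def, rule A.L4_norm_le_grad_energy[OF mean_uA[OF z]])
  have b4: "sqrt (?I (\<lambda>x y. (b x y)^4)) \<le> K * S2 z"
    by (rule order_trans[OF _ mult_left_mono[OF gB K]])
      (unfold b_def K_def L_def \<rho>_def, rule B.L4_norm_le_grad_energy[OF mean_B[OF z]])
  have sq: "cont2 (\<lambda>x y. (a x y)\<^sup>2)" "cont2 (\<lambda>x y. (b x y)\<^sup>2)"
    by (intro continuous_intros c)+
  have ab: "sqrt (?I (\<lambda>x y. (a x y * b x y)\<^sup>2)) \<le> K * N * sqrt (S2 z)"
  proof (rule real_le_lsqrt)
    have "?I (\<lambda>x y. (a x y * b x y)\<^sup>2) \<le> sqrt (?I (\<lambda>x y. ((a x y)\<^sup>2)\<^sup>2)) * sqrt (?I (\<lambda>x y. ((b x y)\<^sup>2)\<^sup>2))"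
      using rect_integral_Cauchy_Schwarz[OF sq, of Lx Ly] by (simp only: power_mult_distrib)
    also have "\<dots> = sqrt (?I (\<lambda>x y. (a x y)^4)) * sqrt (?I (\<lambda>x y. (b x y)^4))"
      by (simp flip: power_mult)
    also have "\<dots> \<le> (K * N\<^sup>2) * (K * S2 z)"
      by (rule mult_mono[OF a4 b4]) (use K c in \<open>auto intro!: rect_integral_nonneg continuous_intros\<close>)
    also have "\<dots> = (K * N * sqrt (S2 z))\<^sup>2"
      using S2_nonneg[OF z] by (simp add: power_mult_distrib power2_eq_square[of K] mult_ac)
    finally show "?I (\<lambda>x y. (a x y * b x y)\<^sup>2) \<le> (K * N * sqrt (S2 z))\<^sup>2" .
  qed (use K N_nonneg S2_nonneg[OF z] in auto)
  \<comment> \<open>Only the transporting factor in (B . grad) B is split; the differentiated field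
    stays whole.\<close>
  have Q_pt: "Q (pt x y z) \<le> (a x y * b x y) * s x y + norm (Bm z) * (a x y * s x y)" for x y
  proof -
    let ?r = "pt x y z"
    have "(\<Sum>i\<in>UNIV. B ?r $ i *\<^sub>R dB i ?r)
        = (\<Sum>i\<in>UNIV. (B ?r - Bm z) $ i *\<^sub>R dB i ?r) + (\<Sum>i\<in>UNIV. Bm z $ i *\<^sub>R dB i ?r)"
      by (simp add: algebra_simps flip: sum.distrib)
    then have n: "norm (\<Sum>i\<in>UNIV. B ?r $ i *\<^sub>R dB i ?r) \<le> b x y * s x y + norm (Bm z) * s x y"
      unfolding b_def s_def dB_norm_def
      by (simp only:) (rule norm_triangle_mono[OF norm_sum_scaleR_le norm_sum_scaleR_le])
    have "Q ?r \<le> a x y * norm (\<Sum>i\<in>UNIV. B ?r $ i *\<^sub>R dB i ?r)"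
      unfolding Q_def a_def using Cauchy_Schwarz_ineq2 abs_le_D2 by blast
    also have "\<dots> \<le> a x y * (b x y * s x y + norm (Bm z) * s x y)"
      by (rule mult_left_mono[OF n]) (simp add: a_def)
    finally show ?thesis by (simp add: algebra_simps)
  qed
  have cp: "cont2 (\<lambda>x y. a x y * b x y)" "cont2 (\<lambda>x y. (a x y * b x y) * s x y)"
    "cont2 (\<lambda>x y. a x y * s x y)" "cont2 (\<lambda>x y. norm (Bm z) * (a x y * s x y))"
    by (intro continuous_intros c)+
  have "?I (\<lambda>x y. Q (pt x y z)) \<le> ?I (\<lambda>x y. (a x y * b x y) * s x y + norm (Bm z) * (a x y * s x y))"
    by (rule rect_integral_mono[OF c(4) _ Q_pt]) (intro continuous_intros c)
  also have "\<dots> = ?I (\<lambda>x y. (a x y * b x y) * s x y) + norm (Bm z) * ?I (\<lambda>x y. a x y * s x y)"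
    by (simp add: rect_integral_add[OF cp(2,4)] rect_integral_cmult)
  also have "\<dots> \<le> (K * N * sqrt (S2 z)) * sqrt (S2 z) + norm (Bm z) * ((L / sqrt 24 * N) * sqrt (S2 z))"
  proof (intro add_mono mult_left_mono)
    show "?I (\<lambda>x y. (a x y * b x y) * s x y) \<le> (K * N * sqrt (S2 z)) * sqrt (S2 z)"
      using rect_integral_Cauchy_Schwarz[OF cp(1) c(3), of Lx Ly] mult_right_mono[OF ab, of "sqrt (S2 z)"]
        S2_nonneg[OF z] by (simp add: s2)
    show "?I (\<lambda>x y. a x y * s x y) \<le> (L / sqrt 24 * N) * sqrt (S2 z)"
      using rect_integral_Cauchy_Schwarz[OF c(1,3), of Lx Ly] mult_right_mono[OF a2, of "sqrt (S2 z)"]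
        S2_nonneg[OF z] by (simp add: s2)
  qed simp
  finally show ?thesis using S2_nonneg[OF z] by (simp add: K_def algebra_simps)
qed

lemma integral_Q_le: "integral (cell Lx Ly) Q \<le> N * (sqrt \<rho> * (3 / 16 * L + 1 / 12)) * D"
proof -
  let ?k = "N * (3 / 16 * sqrt \<rho> * L)" and ?l = "N * (L / sqrt 24)"
  have cs: "continuous_on {0..1} (\<lambda>z. norm (Bm z))" "continuous_on {0..1} (\<lambda>z. sqrt (S2 z))"
    by (intro continuous_intros continuous_Bm continuous_S2)+
  have L0: "L > 0" using pos by (simp add: L_def)
  have LL: "Lx * Ly > 0" using pos by simp
  have "integral (cell Lx Ly) Q = integral {0..1} (\<lambda>z. rect_integral Lx Ly (\<lambda>x y. Q (pt x y z)))"
    by (simp add: cell_integral_slices[OF continuous_Q pos(1,2)] integral_xy_eq_rect)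
  also have "\<dots> \<le> integral {0..1} (\<lambda>z. ?k * S2 z + ?l * (norm (Bm z) * sqrt (S2 z)))"
    by (intro integral_le rect_integral_Q_le integrable_continuous_interval continuous_on_integral_xy
        continuous_Q continuous_on_add continuous_on_mult continuous_on_const cs continuous_S2)
  also have "\<dots> = ?k * D + ?l * integral {0..1} (\<lambda>z. norm (Bm z) * sqrt (S2 z))"
    unfolding D_eq
    by (subst integral_add)
      (auto intro!: integrable_continuous_interval continuous_on_mult continuous_on_const cs continuous_S2)
  also have "\<dots> \<le> ?k * D + ?l * (D / sqrt (6 * (Lx * Ly)))"
  proof (intro add_left_mono mult_left_mono)
    have "integral {0..1} (\<lambda>z. norm (Bm z) * sqrt (S2 z))
        \<le> sqrt (integral {0..1} (\<lambda>z. (norm (Bm z))\<^sup>2)) * sqrt (integral {0..1} (\<lambda>z. (sqrt (S2 z))\<^sup>2))"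
      using integral_mult_le_sqrt[of 0 "1::real"] cs by simp
    also have "integral {0..1} (\<lambda>z. (sqrt (S2 z))\<^sup>2) = D"
      unfolding D_eq by (rule integral_cong) (use S2_nonneg in simp)
    also have "sqrt (integral {0..1} (\<lambda>z. (norm (Bm z))\<^sup>2)) * sqrt D \<le> sqrt (D / (6 * (Lx * Ly))) * sqrt D"
      by (intro mult_right_mono real_sqrt_le_mono integral_Bm_le) (use D_nonneg in simp)
    also have "\<dots> = D / sqrt (6 * (Lx * Ly))"
      using D_nonneg by (simp add: real_sqrt_divide)
    finally show "integral {0..1} (\<lambda>z. norm (Bm z) * sqrt (S2 z)) \<le> D / sqrt (6 * (Lx * Ly))" .
  qed (use N_nonneg L0 in simp)
  \<comment> \<open>The two Poincare constants combine to 24 * 6 = 144 = 12^2, hence the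
    1/12.\<close>
  also have "?l * (D / sqrt (6 * (Lx * Ly))) = N * (L / sqrt (Lx * Ly) / 12) * D"
  proof -
    have "sqrt 24 * sqrt (6 * (Lx * Ly)) = sqrt (144 * (Lx * Ly))" by (simp flip: real_sqrt_mult)
    also have "\<dots> = 12 * sqrt (Lx * Ly)"
      by (simp add: real_sqrt_mult)
    finally have "L / sqrt 24 / sqrt (6 * (Lx * Ly)) = L / sqrt (Lx * Ly) / 12"
      by (simp only: divide_divide_eq_left mult.commute)
    moreover have "?l * (D / sqrt (6 * (Lx * Ly))) = N * (L / sqrt 24 / sqrt (6 * (Lx * Ly))) * D" by simp
    ultimately show ?thesis by (simp only:)
  qed
  \<comment> \<open>The longer side over the geometric mean of both sides is the root of the aspect
    ratio.\<close>
  also have "L / sqrt (Lx * Ly) = sqrt \<rho>"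
  proof (rule real_sqrt_unique[symmetric])
    show "(L / sqrt (Lx * Ly))\<^sup>2 = \<rho>"
    proof (cases "Ly \<le> Lx")
      case True
      then have "Ly / Lx \<le> Lx / Ly" using pos by (intro order_trans[of "Ly / Lx" 1 "Lx / Ly"]) simp_all
      with True have "L = Lx" "\<rho> = Lx / Ly" by (simp_all add: L_def \<rho>_def)
      then show ?thesis using pos by (simp add: power_divide power2_eq_square)
    next
      case False
      then have "Lx / Ly \<le> Ly / Lx" using pos by (intro order_trans[of "Lx / Ly" 1 "Ly / Lx"]) simp_all
      with False have "L = Ly" "\<rho> = Ly / Lx" by (simp_all add: L_def \<rho>_def)
      then show ?thesis using pos by (simp add: power_divide power2_eq_square)
    qed
  qed (use L0 LL in simp)
  finally show ?thesis by (simp add: algebra_simps)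
qed

text \<open>Permits the final division by \<open>D\<close>. If \<open>D\<close> were 0, every slice
  energy and every mean would vanish, and the slice Poincare inequality would leave B = 0 on the
  cell; periodicity carries this to the given point of the slab.\<close>

lemma D_pos:
  assumes "r \<in> slab" "B r \<noteq> 0"
  shows "D > 0"
proof (rule ccontr)
  assume "\<not> D > 0"
  then have D0: "D = 0" using D_nonneg by simp
  have S0: "S2 z = 0" if "z \<in> {0..1}" for z
    using integral_eq_0_iff[OF continuous_S2] S2_nonneg D0 that unfolding D_eq by simp
  have Bm0: "Bm z = 0" if "z \<in> {0..1}" for z
  proof -
    have c: "continuous_on {0..1} (\<lambda>z. (norm (Bm z))\<^sup>2)" by (intro continuous_intros continuous_Bm)
    have "integral {0..1} (\<lambda>z. (norm (Bm z))\<^sup>2) \<ge> 0"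
      by (intro integral_nonneg integrable_continuous_interval c) simp
    with integral_Bm_le D0 have "integral {0..1} (\<lambda>z. (norm (Bm z))\<^sup>2) = 0" by simp
    then show ?thesis using integral_eq_0_iff[OF c] that by simp
  qed
  define z where "z = r$3"
  have z: "z \<in> {0..1}" using assms by (simp add: z_def slab_def)
  interpret B: periodic_C1 Lx Ly "\<lambda>x y. B (pt x y z) - Bm z" "\<lambda>x y. dB 1 (pt x y z)" "\<lambda>x y. dB 2 (pt x y z)"
    by (rule slice_B[OF z])
  have c: "cont2 (\<lambda>x y. (norm (B (pt x y z)))\<^sup>2)"
    by (intro continuous_intros cont2_slice cont z)
  have "rect_integral Lx Ly (\<lambda>x y. (norm (B (pt x y z)))\<^sup>2) \<le> (max Lx Ly)\<^sup>2 / 24 * B.grad_energy"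
    using B.poincare_rect[OF mean_B[OF z]] by (simp add: Bm0[OF z])
  also have "\<dots> \<le> (max Lx Ly)\<^sup>2 / 24 * S2 z" by (intro mult_left_mono grad_energy_B_le z) simp
  finally have "rect_integral Lx Ly (\<lambda>x y. (norm (B (pt x y z)))\<^sup>2) = 0"
    using rect_integral_nonneg[OF c] S0[OF z] by (simp add: order_antisym)
  then have zero: "B (pt x y z) = 0" if "x \<in> {0..Lx}" "y \<in> {0..Ly}" for x y
    using rect_integral_eq_0_imp[OF c _ pos(1,2) _ that] by simp
  obtain x where x: "x \<in> {0..Lx}" "B (pt x (r$2) z) = B (pt (r$1) (r$2) z)"
    using periodic_representative[OF pos(1), of "\<lambda>x. B (pt x (r$2) z)" "r$1"] B.perx by auto
  obtain y where y: "y \<in> {0..Ly}" "B (pt x y z) = B (pt x (r$2) z)"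
    using periodic_representative[OF pos(2), of "\<lambda>y. B (pt x y z)" "r$2"] B.pery by auto
  have "B r = 0" using zero[OF x(1) y(1)] x y by (simp add: z_def)
  then show False using assms by simp
qed

text \<open>The L^4 term grows with L and is paid by \<open>C_P\<close> \<ge> L / (2 pi). The
  contribution 1/12 of the mean carries no length and is paid by \<open>C_P\<close> \<ge> 1 / pi.
  The total 3 pi/8 + pi/12 = 11 pi/24 still fits below 3 sqrt (3 pi/32), the factor in 3
  \<open>C1\<close>.\<close>

lemma constant_le: "sqrt \<rho> * (3 / 16 * L + 1 / 12) \<le> A2 Lx Ly"
proof -
  have \<rho>0: "\<rho> > 0" using pos by (simp add: \<rho>_def less_max_iff_disj)
  have L0: "L > 0" using pos by (simp add: L_def)
  have lam: "lambda1 Lx Ly > 0" "lambda1 Lx Ly \<le> pi" "lambda1 Lx Ly \<le> 2 * pi / L"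
    using pos pi_gt_zero by (auto simp: lambda1_def L_def max_def)
  have CP: "C_P Lx Ly \<ge> 1 / pi" "C_P Lx Ly \<ge> L / (2 * pi)"
    using lam L0 by (auto simp: C_P_def field_simps)
  have CP0: "C_P Lx Ly > 0" using lam by (simp add: C_P_def)
  have CL: "(C_L Lx Ly)\<^sup>2 = sqrt (3 * pi / 32) * sqrt \<rho>"
  proof -
    have "(C_L Lx Ly)\<^sup>2 = (3 * pi / 32 * \<rho>) powr (1 / 2)"
      unfolding C_L_def \<rho>_def[symmetric] power2_eq_square by (simp flip: powr_add)
    then show ?thesis using \<rho>0 by (simp add: powr_half_sqrt flip: real_sqrt_mult)
  qed
  \<comment> \<open>Squared and divided by pi this reads 121 pi \<le> 486, and pi < 4 is just
    enough, since 4 * 121 = 484.\<close>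
  have num: "11 * pi / 24 \<le> 3 * sqrt (3 * pi / 32)"
  proof (rule power2_le_imp_le)
    have "121 * pi \<le> 486" using pi_less_4 by simp
    then have "pi * (121 * pi) \<le> pi * 486" by (rule mult_left_mono) simp
    then show "(11 * pi / 24)\<^sup>2 \<le> (3 * sqrt (3 * pi / 32))\<^sup>2"
      by (simp add: power_mult_distrib power_divide power2_eq_square)
  qed simp
  have "3 / 16 * L + 1 / 12 = 3 * pi / 8 * (L / (2 * pi)) + pi / 12 * (1 / pi)" by simp
  also have "\<dots> \<le> 3 * pi / 8 * C_P Lx Ly + pi / 12 * C_P Lx Ly"
    using CP by (intro add_mono mult_left_mono) auto
  also have "\<dots> = 11 * pi / 24 * C_P Lx Ly" by (simp add: field_simps)
  also have "\<dots> \<le> 3 * sqrt (3 * pi / 32) * C_P Lx Ly" using num CP0 by (intro mult_right_mono) auto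
  finally have "sqrt \<rho> * (3 / 16 * L + 1 / 12) \<le> sqrt \<rho> * (3 * sqrt (3 * pi / 32) * C_P Lx Ly)"
    using \<rho>0 by (intro mult_left_mono) auto
  also have "\<dots> = C1 Lx Ly * 3" by (simp add: C1_def CL)
  also have "\<dots> \<le> A2 Lx Ly"
    unfolding A2_def using CP0 by (intro mult_left_mono) (auto simp: C1_def)
  finally show ?thesis .
qed

theorem dynamo_bound:
  assumes "r \<in> slab" "B r \<noteq> 0" and dynamo: "integral (cell Lx Ly) (\<lambda>r. B r \<bullet> B\<^sub>t r) \<ge> 0"
  shows "1 / Rm \<le> A2 Lx Ly * norm_Linf_L2 Lx Ly (grad_xy (archimedean Ra \<theta>))"
proof -
  have D: "D > 0" by (rule D_pos[OF assms(1,2)])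
  have "(1 / Rm) * D \<le> integral (cell Lx Ly) Q" using dynamo energy_rate by simp
  also have "\<dots> \<le> N * (sqrt \<rho> * (3 / 16 * L + 1 / 12)) * D" by (rule integral_Q_le)
  also have "\<dots> \<le> N * A2 Lx Ly * D"
    using D N_nonneg constant_le by (intro mult_right_mono mult_left_mono) auto
  finally have "1 / Rm \<le> N * A2 Lx Ly" using D by (simp only: mult_le_cancel_right_pos)
  then show ?thesis by (simp add: N_def mult.commute)
qed

end

section \<open>Reduction of the Taylor model to one instant\<close>

text \<open>Carries the equations from the open slab to the walls along vertical segments. This
  matters in \<open>flux_wall\<close>, which evaluates div B = 0 at the walls.\<close>

lemma slab_eqI:
  fixes f g :: "real^3 \<Rightarrow> 'b::real_normed_vector"
  assumes c: "continuous_on slab f" "continuous_on slab g"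
    and eq: "\<And>r. 0 < r$3 \<Longrightarrow> r$3 < 1 \<Longrightarrow> f r = g r" and r: "r \<in> slab"
  shows "f r = g r"
proof -
  let ?h = "\<lambda>z. f (pt (r$1) (r$2) z) - g (pt (r$1) (r$2) z)"
  have cl: "closure {0<..<1} = {0..1::real}" by simp
  have "continuous_on (closure {0<..<1}) ?h"
    unfolding cl
    by (intro continuous_on_diff continuous_on_compose2[OF c(1)] continuous_on_compose2[OF c(2)])
      (auto intro!: continuous_intros)
  moreover have "?h z = 0" if "z \<in> {0<..<1}" for z
    using that eq by simp
  moreover have "r$3 \<in> closure {0<..<1}"
    using r by (simp add: cl slab_def)
  ultimately have "?h (r$3) = 0" by (rule continuous_constant_on_closure)
  then show ?thesis by simp
qed

lemma slab_interior: "0 < r$3 \<Longrightarrow> r$3 < 1 \<Longrightarrow> r \<in> slab"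
  by (simp add: slab_def)

lemma bounded_bilinear_cross3: "bounded_bilinear cross3"
  using bilinear_cross bilinear_conv_bounded_bilinear by blast

lemma curl_eq_rot:
  assumes "\<And>i. slab_deriv i F (D i)" "0 < r$3" "r$3 < 1"
  shows "curl F r = rot (\<lambda>i. D i r)"
  using pd_eq[OF assms(1) slab_interior] assms(2,3) by (simp add: curl_def rot_def)

lemma divergence_eq:
  assumes "\<And>i. slab_deriv i F (D i)" "0 < r$3" "r$3 < 1"
  shows "divergence F r = (\<Sum>i\<in>UNIV. D i r $ i)"
  using pd_eq[OF assms(1) slab_interior] assms(2,3) by (simp add: divergence_def)

lemma pd_pd_eq:
  assumes d: "slab_deriv i f D" "slab_deriv i D DD" and r: "0 < r$3" "r$3 < 1"
  shows "pd i (pd i f) r = DD r"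
proof -
  \<comment> \<open>These increments keep the point strictly between the walls: all of them for
    horizontal i, an open interval for i = 3. On this set the inner \<open>pd\<close> agrees with D
    and can be differentiated again.\<close>
  let ?S = "{s. 0 < r$3 + s * axis i 1 $ 3 \<and> r$3 + s * axis i 1 $ 3 < 1}"
  have "((\<lambda>s. D (r + axis i s)) has_vector_derivative DD r) (at 0)"
    by (rule slab_deriv_at[OF d(2) slab_interior[OF r]]) (use r in simp)
  moreover have "open ?S"
    by (intro open_Collect_conj open_Collect_less continuous_intros)
  moreover have "0 \<in> ?S" using r by simp
  moreover have "D (r + axis i s) = pd i f (r + axis i s)" if "s \<in> ?S" for s
  proof -
    have "(r + axis i s)$3 = r$3 + s * axis i 1 $ 3" by (simp add: axis_def)
    then have "0 < (r + axis i s)$3" "(r + axis i s)$3 < 1" using that by simp_all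
    then show ?thesis using pd_eq[OF d(1) slab_interior] by simp
  qed
  ultimately have "((\<lambda>s. pd i f (r + axis i s)) has_vector_derivative DD r) (at 0)"
    by (rule has_vector_derivative_transform_within_open)
  then show ?thesis unfolding pd_def[of i "pd i f"] by (rule vector_derivative_at)
qed

lemma laplacian_eq:
  assumes "\<And>i. slab_deriv i f (D i)" "\<And>i. slab_deriv i (D i) (DD i)" "0 < r$3" "r$3 < 1"
  shows "laplacian f r = (\<Sum>i\<in>UNIV. DD i r)"
  unfolding laplacian_def using pd_pd_eq[OF assms(1,2)] assms(3,4) by simp

lemma continuous_on_rot [continuous_intros]:
  assumes "\<And>i. continuous_on S (G i)"
  shows "continuous_on S (\<lambda>r. rot (\<lambda>i. G i r))"
  unfolding rot_def by (intro continuous_intros assms)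

lemma continuous_on_cross3:
  assumes "continuous_on S f" "continuous_on S g"
  shows "continuous_on S (\<lambda>r. cross3 (f r) (g r))"
  by (rule bounded_bilinear.continuous_on[OF bounded_bilinear_cross3 assms])

text \<open>Makes derivatives within J unique, even when the instant is an end point of J.\<close>

lemma interval_not_isolated:
  fixes J :: "real set"
  assumes "is_interval J" "interior J \<noteq> {}" "t \<in> J"
  shows "at t within J \<noteq> bot"
proof -
  have "\<nexists>a. J = {a}" using assms(2) by auto
  moreover have "connected J" using assms(1) by (simp add: is_interval_connected)
  ultimately have "t islimpt J" using assms(3) by (simp add: connected_imp_perfect)
  then show ?thesis by (simp add: trivial_limit_within)
qed

theorem corollary3p7:
  fixes Lx Ly \<Lambda> Ra Rm :: real
    and J :: "real set"
    and u B :: "real \<Rightarrow> real^3 \<Rightarrow> real^3"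
    and P T :: "real \<Rightarrow> real^3 \<Rightarrow> real"
    and t\<^sub>0 dE :: real
  assumes "Lx > 0" and "Ly > 0" and "\<Lambda> > 0" and "Ra > 0" and "Rm > 0"
    and "is_interval J" and "interior J \<noteq> {}"
    and "taylor_solution Lx Ly \<Lambda> Ra Rm J u B P T"
    and "\<forall>t\<in>J. exact_flux Lx Ly (B t)"
    and "t\<^sub>0 \<in> J"
    and "\<exists>r\<in>slab. B t\<^sub>0 r \<noteq> 0"
    and "((\<lambda>t. magnetic_energy Lx Ly (B t)) has_real_derivative dE) (at t\<^sub>0 within J)"
    and "dE \<ge> 0"
  shows "A2 Lx Ly * norm_Linf_L2 Lx Ly (grad_xy (archimedean Ra (T t\<^sub>0))) \<ge> 1 / Rm"
proof -
  note sol = assms(8)[unfolded taylor_solution_def]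
  note t0 = assms(10)
  have smooth: "smooth_field J u" "smooth_field J B" "smooth_field J P" "smooth_field J T"
    using sol by blast+
  have per: "periodic_xy Lx Ly (u t\<^sub>0)" "periodic_xy Lx Ly (B t\<^sub>0)" "periodic_xy Lx Ly (P t\<^sub>0)" "periodic_xy Lx Ly (T t\<^sub>0)"
    using sol t0 by blast+
  have pde: "cross3 e_z (u t\<^sub>0 r) + grad (P t\<^sub>0) r
        = \<Lambda> *\<^sub>R cross3 (curl (B t\<^sub>0) r) (B t\<^sub>0 r) + (Ra * T t\<^sub>0 r) *\<^sub>R e_z"
      "divergence (u t\<^sub>0) r = 0"
      "vector_derivative (\<lambda>s. B s r) (at t\<^sub>0 within J) - curl (\<lambda>q. cross3 (u t\<^sub>0 q) (B t\<^sub>0 q)) r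
        = (1 / Rm) *\<^sub>R laplacian (B t\<^sub>0) r"
      "divergence (B t\<^sub>0) r = 0" if "0 < r$3" "r$3 < 1" for r
    using sol t0 that by blast+
  have walls: "r$3 = 1 \<Longrightarrow> u t\<^sub>0 r \<bullet> e_z = 0 \<and> cross3 (B t\<^sub>0 r) e_z = 0"
    "r$3 = 0 \<Longrightarrow> u t\<^sub>0 r \<bullet> (- e_z) = 0 \<and> cross3 (B t\<^sub>0 r) (- e_z) = 0" for r
    using sol t0 by blast+
  obtain du ddu where u: "continuous_on slab (u t\<^sub>0)" "\<And>i. slab_deriv i (u t\<^sub>0) (du i)" "\<And>i. continuous_on slab (du i)"
    "\<And>i j. slab_deriv j (du i) (ddu i j)" "\<And>i j. continuous_on slab (ddu i j)"
    by (rule smooth_field_slab_derivs[OF smooth(1) t0]) blast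
  obtain dB ddB where B: "continuous_on slab (B t\<^sub>0)" "\<And>i. slab_deriv i (B t\<^sub>0) (dB i)" "\<And>i. continuous_on slab (dB i)"
    "\<And>i j. slab_deriv j (dB i) (ddB i j)" "\<And>i j. continuous_on slab (ddB i j)"
    by (rule smooth_field_slab_derivs[OF smooth(2) t0]) blast
  obtain dP ddP where P: "continuous_on slab (P t\<^sub>0)" "\<And>i. slab_deriv i (P t\<^sub>0) (dP i)" "\<And>i. continuous_on slab (dP i)"
    "\<And>i j. slab_deriv j (dP i) (ddP i j)" "\<And>i j. continuous_on slab (ddP i j)"
    by (rule smooth_field_slab_derivs[OF smooth(3) t0]) blast
  obtain dT ddT where T: "continuous_on slab (T t\<^sub>0)" "\<And>i. slab_deriv i (T t\<^sub>0) (dT i)" "\<And>i. continuous_on slab (dT i)"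
    "\<And>i j. slab_deriv j (dT i) (ddT i j)" "\<And>i j. continuous_on slab (ddT i j)"
    by (rule smooth_field_slab_derivs[OF smooth(4) t0]) blast
  obtain F where F: "continuous_on (J \<times> slab) (\<lambda>(t, r). B t r)" "continuous_on (J \<times> slab) (\<lambda>(t, r). F t r)"
    "\<And>t r. t \<in> J \<Longrightarrow> r \<in> slab \<Longrightarrow> ((\<lambda>s. B s r) has_vector_derivative F t r) (at t within J)"
    by (rule smooth_field_time_deriv[OF smooth(2)]) blast
  have nb: "at t\<^sub>0 within J \<noteq> bot" by (rule interval_not_isolated) fact+
  have cF: "continuous_on slab (F t\<^sub>0)"
  proof -
    have "continuous_on slab (\<lambda>r. (\<lambda>(t, r). F t r) (t\<^sub>0, r))"
      by (rule continuous_on_compose2[OF F(2)]) (use t0 in \<open>auto intro!: continuous_intros\<close>)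
    then show ?thesis by simp
  qed
  \<comment> \<open>Uniqueness identifies the assumed energy rate with the one obtained by
    differentiating under the integral sign.\<close>
  have dE: "dE = integral (cell Lx Ly) (\<lambda>r. B t\<^sub>0 r \<bullet> F t\<^sub>0 r)"
    using magnetic_energy_derivative[OF assms(6) t0 assms(1,2) F] assms(12)
    unfolding has_real_derivative_iff_has_vector_derivative
    by (rule vector_derivative_unique_within[OF nb, rotated])
  \<comment> \<open>Each equation is rewritten from \<open>pd\<close> to the named derivatives in
    the open slab, then extended to the closed slab by continuity of both sides.\<close>
  interpret taylor_instant Lx Ly \<Lambda> Ra Rm "u t\<^sub>0" "B t\<^sub>0" "F t\<^sub>0" "P t\<^sub>0" "T t\<^sub>0" du dB ddB dP dT ddT
  proof
    show "slab_deriv i (u t\<^sub>0) (du i)" "slab_deriv i (B t\<^sub>0) (dB i)" "slab_deriv j (dB i) (ddB i j)"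
      "slab_deriv i (P t\<^sub>0) (dP i)" "slab_deriv i (T t\<^sub>0) (dT i)" "slab_deriv j (dT i) (ddT i j)" for i j
      by (rule u B P T)+
    show "cross3 e_z (u t\<^sub>0 r) + (\<chi> i. dP i r)
        = \<Lambda> *\<^sub>R cross3 (rot (\<lambda>i. dB i r)) (B t\<^sub>0 r) + (Ra * T t\<^sub>0 r) *\<^sub>R e_z" if "r \<in> slab" for r
    proof (rule slab_eqI[OF _ _ _ that])
      show "continuous_on slab (\<lambda>r. cross3 e_z (u t\<^sub>0 r) + (\<chi> i. dP i r))"
        by (intro continuous_intros continuous_on_vec_lambda continuous_on_cross3 u P)
      show "continuous_on slab (\<lambda>r. \<Lambda> *\<^sub>R cross3 (rot (\<lambda>i. dB i r)) (B t\<^sub>0 r) + (Ra * T t\<^sub>0 r) *\<^sub>R e_z)"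
        by (intro continuous_intros continuous_on_cross3 B T)
      fix r :: "real^3" assume r: "0 < r$3" "r$3 < 1"
      have "grad (P t\<^sub>0) r = (\<chi> i. dP i r)"
        using pd_eq[OF P(2) slab_interior[OF r]] r by (simp add: grad_def)
      then show "cross3 e_z (u t\<^sub>0 r) + (\<chi> i. dP i r)
          = \<Lambda> *\<^sub>R cross3 (rot (\<lambda>i. dB i r)) (B t\<^sub>0 r) + (Ra * T t\<^sub>0 r) *\<^sub>R e_z"
        using pde(1)[OF r] curl_eq_rot[OF B(2) r] by simp
    qed
    show "(\<Sum>i\<in>UNIV. du i r $ i) = 0" if "r \<in> slab" for r
      by (rule slab_eqI[OF _ _ _ that]) (use pde(2) divergence_eq[OF u(2)] in \<open>auto intro!: continuous_intros u\<close>)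
    show "(\<Sum>i\<in>UNIV. dB i r $ i) = 0" if "r \<in> slab" for r
      by (rule slab_eqI[OF _ _ _ that]) (use pde(4) divergence_eq[OF B(2)] in \<open>auto intro!: continuous_intros B\<close>)
    show "F t\<^sub>0 r = rot (\<lambda>i. cross3 (du i r) (B t\<^sub>0 r) + cross3 (u t\<^sub>0 r) (dB i r))
        + (1 / Rm) *\<^sub>R (\<Sum>i\<in>UNIV. ddB i i r)" if "r \<in> slab" for r
    proof (rule slab_eqI[OF cF _ _ that])
      show "continuous_on slab (\<lambda>r. rot (\<lambda>i. cross3 (du i r) (B t\<^sub>0 r) + cross3 (u t\<^sub>0 r) (dB i r))
          + (1 / Rm) *\<^sub>R (\<Sum>i\<in>UNIV. ddB i i r))"
        by (intro continuous_on_add continuous_on_scaleR continuous_on_const continuous_on_sum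
            continuous_on_rot continuous_on_cross3 u B)
      fix r :: "real^3" assume r: "0 < r$3" "r$3 < 1"
      have "vector_derivative (\<lambda>s. B s r) (at t\<^sub>0 within J) = F t\<^sub>0 r"
        by (rule vector_derivative_within[OF nb F(3)[OF t0 slab_interior[OF r]]])
      moreover have "curl (\<lambda>q. cross3 (u t\<^sub>0 q) (B t\<^sub>0 q)) r
          = rot (\<lambda>i. cross3 (du i r) (B t\<^sub>0 r) + cross3 (u t\<^sub>0 r) (dB i r))"
        by (rule curl_eq_rot[OF slab_deriv_bilinear[OF bounded_bilinear_cross3 u(2) B(2)] r])
      moreover have "laplacian (B t\<^sub>0) r = (\<Sum>i\<in>UNIV. ddB i i r)"
        by (rule laplacian_eq[where D = dB and DD = "\<lambda>i. ddB i i", OF B(2) B(4) r])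
      ultimately show "F t\<^sub>0 r = rot (\<lambda>i. cross3 (du i r) (B t\<^sub>0 r) + cross3 (u t\<^sub>0 r) (dB i r))
          + (1 / Rm) *\<^sub>R (\<Sum>i\<in>UNIV. ddB i i r)"
        using pde(3)[OF r] by (simp add: algebra_simps)
    qed
    show "u t\<^sub>0 r $ 3 = 0" if "r$3 = 0 \<or> r$3 = 1" for r
      using that walls[of r] by (auto simp: inner_axis)
    show "B t\<^sub>0 r $ 1 = 0" "B t\<^sub>0 r $ 2 = 0" if "r$3 = 0 \<or> r$3 = 1" for r
      using that walls[of r] by (auto simp: cross3_def vec_eq_iff forall_3 axis_def)
    have "exact_flux Lx Ly (B t\<^sub>0)" using assms(9) t0 by blast
    then show "integral_xy Lx Ly 0 (\<lambda>r. B t\<^sub>0 r $ 3) = 0" "integral_xy Lx Ly 1 (\<lambda>r. B t\<^sub>0 r $ 3) = 0"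
      by (simp_all add: exact_flux_def inner_axis' integral_xy_def case_prod_unfold)
  qed (fact assms per cF u B P T)+
  obtain r where "r \<in> slab" "B t\<^sub>0 r \<noteq> 0" using assms(11) by blast
  then show ?thesis using dynamo_bound assms(13) dE by simp
qed

end
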